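(* Let $\alpha>0$. For $n_1$ an even positive integer, let $n_2=\lfloor \alpha n_1/2\rfloor$. For $j\ge 2$, let $U_j$ denote the number of connected components with exactly $j$ vertices in a graph drawn uniformly at random from $\mathcal{G}_{n_1,n_2}$. Then, for every $j\ge 2$, as $n_1\to\infty$ along the even integers, \[ \mathbb{E}[U_j]\sim \frac{\alpha^{j-2}}{(1+\alpha)^{j-1}}\,\frac{n_1}{2} \qquad\text{and}\qquad \operatorname{Var}(U_j)=O\!\left(\frac{n_1}{2}\right). \] Furthermore, for any integer $q\ge 2$, as $n_1\to\infty$ along the even integers, the random vector \[ \frac{1}{\sqrt{n_1/2}}\left(U_j-\frac{\alpha^{j-2}}{(1+\alpha)^{j-1}}\,\frac{n_1}{2}\right)_{2\le j\le q} \] converges in distribution to a multivariate Gaussian $\mathcal{N}(\mathbf{0},\mathcal{H}(\alpha))$, where the positive semi-definite matrix $\mathcal{H}(\alpha)=(\mathcal{H}_{i,j}(\alpha))_{2\le i,j\le q}$ is given by \[ \mathcal{H}_{i,j}(\alpha)=-\frac{\alpha^{i+j-4}}{(1+\alpha)^{i+j-2}}\left(1+\frac{(i-2-\alpha)(j-2-\alpha)}{\alpha(1+\alpha)}\right)+\frac{\mathbb{1}_{i=j}}{1+\alpha}\left(\frac{\alpha}{1+\alpha}\right)^{i-2}. \]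
   Context: $\mathcal{G}_{n_1,n_2}$ denotes the set of labelled simple graphs (vertex set $\{1,\dots,n_1+n_2\}$) in which every vertex has degree $1$ or $2$, with exactly $n_1$ vertices of degree $1$ and $n_2$ vertices of degree $2$. The size of a connected component is its number of vertices. $\mathbb{1}_{i=j}$ is $1$ if $i=j$ and $0$ otherwise. *)

theory Defs
  imports "HOL-Probability.Probability" "HOL-Library.Landau_Symbols"
begin

section \<open>Graphs with vertex set {1..n}, every vertex of degree 1 or 2\<close>

text \<open>A labelled simple graph on {1..n} is a set of edges, each edge a 2-element subset.\<close>

definition all_edges :: "nat \<Rightarrow> nat set set" where
  "all_edges n = {{u, v} | u v. u \<in> {1..n} \<and> v \<in> {1..n} \<and> u \<noteq> v}"

definition deg :: "nat set set \<Rightarrow> nat \<Rightarrow> nat" where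
  "deg E v = card {e \<in> E. v \<in> e}"

text \<open>The set G_{n1,n2}.\<close>
definition graphs12 :: "nat \<Rightarrow> nat \<Rightarrow> nat set set set" where
  "graphs12 n1 n2 = {E. E \<subseteq> all_edges (n1 + n2)
      \<and> (\<forall>v \<in> {1..n1 + n2}. deg E v = 1 \<or> deg E v = 2)
      \<and> card {v \<in> {1..n1 + n2}. deg E v = 1} = n1
      \<and> card {v \<in> {1..n1 + n2}. deg E v = 2} = n2}"

definition adj_rel :: "nat set set \<Rightarrow> (nat \<times> nat) set" where
  "adj_rel E = {(u, v). {u, v} \<in> E \<and> u \<noteq> v}"

text \<open>Connected components of the graph on vertex set V with edge set E.\<close>
definition components :: "nat set \<Rightarrow> nat set set \<Rightarrow> nat set set" where
  "components V E = {((adj_rel E)\<^sup>*) `` {v} | v. v \<in> V}"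

text \<open>U_j: number of connected components with exactly j vertices.\<close>
definition U :: "nat \<Rightarrow> nat \<Rightarrow> nat set set \<Rightarrow> nat" where
  "U n j E = card {C \<in> components {1..n} E. card C = j}"

section \<open>Uniform probability on a finite set\<close>

definition unif_mean :: "'a set \<Rightarrow> ('a \<Rightarrow> real) \<Rightarrow> real" where
  "unif_mean S X = (\<Sum>x\<in>S. X x) / real (card S)"

definition unif_var :: "'a set \<Rightarrow> ('a \<Rightarrow> real) \<Rightarrow> real" where
  "unif_var S X = unif_mean S (\<lambda>x. (X x - unif_mean S X)\<^sup>2)"

section \<open>Multivariate Gaussian on coordinates I, and convergence in distribution\<close>

text \<open>Standard Gaussian vector indexed by a finite set K (iid N(0,1) coordinates).\<close>
definition std_gauss_vec :: "'i set \<Rightarrow> ('i \<Rightarrow> real) measure" where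
  "std_gauss_vec K = PiM K (\<lambda>_. density lborel std_normal_density)"

text \<open>Expectation of f(Z) for Z = A W, W standard Gaussian on I: Z ~ N(0, A A^T).
  Vectors are functions I \<Rightarrow> real, extended by 0 outside I.\<close>
definition gauss_expect :: "'i set \<Rightarrow> ('i \<Rightarrow> 'i \<Rightarrow> real) \<Rightarrow> (('i \<Rightarrow> real) \<Rightarrow> real) \<Rightarrow> real" where
  "gauss_expect I A f =
     integral\<^sup>L (std_gauss_vec I)
       (\<lambda>w. f (\<lambda>i. if i \<in> I then (\<Sum>k\<in>I. A i k * w k) else 0))"

text \<open>Convergence in distribution of random vectors X m (defined on the uniform finite
  probability space S m, vanishing outside I) to N(0,H): there is A with A A^T = H such
  that E f(X m) \<rightarrow> E f(A W) for every bounded continuous f.\<close>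
definition conv_distr_gauss ::
  "(nat \<Rightarrow> 'a set) \<Rightarrow> (nat \<Rightarrow> 'a \<Rightarrow> 'i \<Rightarrow> real) \<Rightarrow> 'i set \<Rightarrow> ('i \<Rightarrow> 'i \<Rightarrow> real) \<Rightarrow> bool" where
  "conv_distr_gauss S X I H \<longleftrightarrow>
     (\<exists>A. (\<forall>i\<in>I. \<forall>j\<in>I. (\<Sum>k\<in>I. A i k * A j k) = H i j) \<and>
       (\<forall>f :: ('i \<Rightarrow> real) \<Rightarrow> real. continuous_on UNIV f \<and> bounded (range f) \<longrightarrow>
          (\<lambda>m. unif_mean (S m) (\<lambda>x. f (X m x))) \<longlonglongrightarrow> gauss_expect I A f))"

definition psd_on :: "'i set \<Rightarrow> ('i \<Rightarrow> 'i \<Rightarrow> real) \<Rightarrow> bool" where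
  "psd_on I H \<longleftrightarrow> (\<forall>v. (\<Sum>i\<in>I. \<Sum>j\<in>I. v i * H i j * v j) \<ge> 0)"

section \<open>Constants of the theorem\<close>

definition cU :: "real \<Rightarrow> nat \<Rightarrow> real" where
  "cU \<alpha> j = \<alpha> ^ (j - 2) / (1 + \<alpha>) ^ (j - 1)"

definition Hmat :: "real \<Rightarrow> nat \<Rightarrow> nat \<Rightarrow> real" where
  "Hmat \<alpha> i j =
     - (\<alpha> ^ (i + j - 4) / (1 + \<alpha>) ^ (i + j - 2))
         * (1 + (real i - 2 - \<alpha>) * (real j - 2 - \<alpha>) / (\<alpha> * (1 + \<alpha>)))
     + (if i = j then 1 else 0) / (1 + \<alpha>) * (\<alpha> / (1 + \<alpha>)) ^ (i - 2)"

text \<open>Parametrisation: n1 = 2m (m \<rightarrow> \<infinity> runs through even n1), n2 = floor(alpha n1 / 2).\<close>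
definition n2_of :: "real \<Rightarrow> nat \<Rightarrow> nat" where
  "n2_of \<alpha> n1 = nat \<lfloor>\<alpha> * real n1 / 2\<rfloor>"

end

theory Submission
  imports Defs "HOL-Real_Asymp.Real_Asymp"
begin

text \<open>A graph in \<open>graphs12 (2 m) n\<close> consists of \<open>m\<close> paths and some cycles. Deleting pendant edges one
  by one gives a recurrence for the number of graphs weighted by a product over components: up to an
  explicit factor it is the coefficient of \<open>x ^ n\<close> in \<open>P x ^ m * C x\<close>, where \<open>P x\<close> is the power series
  with coefficients \<open>z (k + 2)\<close> and \<open>C\<close> collects the 2-regular graphs. There are at most \<open>k!\<close> of these
  on \<open>k\<close> vertices, so \<open>C\<close> has radius of convergence at least 1. Evaluating the coefficient by a Fourier
  integral on the circle of radius \<open>\<alpha> / (1 + \<alpha>)\<close> with \<open>z j = exp (\<tau> j / sqrt m)\<close> expresses the exponential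
  moments of the normalized counts as a ratio of two integrals. For imaginary \<open>\<tau>\<close> dominated convergence
  yields the Gaussian characteristic function; for real \<open>\<tau>\<close> the dominating function alone bounds
  the second moments, which gives the mean, the variance and tightness. Convergence of
  characteristic functions extends to bounded continuous test functions by Stone-Weierstrass, and a
  factor of the covariance matrix is obtained by Cholesky elimination.\<close>

section \<open>Weighted graphs with all degrees 1 or 2\<close>

text \<open>Behind the analysis is a conditional limit theorem. On the circle of radius \<alpha> /
  (1 + \<alpha>) the untilted coefficients of \<open>P\<close>, normalised to sum 1, are a geometric
  law of mean \<alpha>. Up to the cycles, the coefficient of \<open>x ^ n\<close> thus describes m
  independent path lengths conditioned on their total, and the choice of n2 puts this total within
  distance 1 of its mean. Integrating over the Fourier variable performs the conditioning:
  completing the square replaces the variance of the tilted statistic by its residual variance after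
  regression on the path length. Hence the two rank-one terms subtracted in \<open>Hmat\<close>, one
  from centring the indicators of the lengths and one from the regression. Cycles enter only as one
  extra factor, which tends to a constant and cancels in the ratio with the untilted integral, so a
  crude bound on their number is enough. The obstacle is a bound on an m-th power that is uniform in
  m. Without centring the tilt, the absolute values of the series could sum to 1 plus a term of
  order 1 / sqrt m; and the decay away from the origin has to come from lengths that carry no
  tilt.\<close>

definition edges_on :: "nat set \<Rightarrow> nat set set" where
  "edges_on V = {{u, v} | u v. u \<in> V \<and> v \<in> V \<and> u \<noteq> v}"

text \<open>The vertex set is arbitrary because the recurrence deletes vertices. Each path has two
  ends, so m is the number of paths and the remaining components are cycles.\<close>

definition pc_graphs :: "nat set \<Rightarrow> nat \<Rightarrow> nat set set set" where
  "pc_graphs V m = {E. E \<subseteq> edges_on V \<and> (\<forall>v\<in>V. deg E v = 1 \<or> deg E v = 2)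
     \<and> card {v \<in> V. deg E v = 1} = 2 * m}"

definition component :: "nat set set \<Rightarrow> nat \<Rightarrow> nat set" where
  "component E v = (adj_rel E)\<^sup>* `` {v}"

definition weight :: "(nat \<Rightarrow> complex) \<Rightarrow> nat set \<Rightarrow> nat set set \<Rightarrow> complex" where
  "weight z V E = (\<Prod>C\<in>components V E. z (card C))"

definition total_weight :: "(nat \<Rightarrow> complex) \<Rightarrow> nat set \<Rightarrow> nat \<Rightarrow> complex" where
  "total_weight z V m = (\<Sum>E\<in>pc_graphs V m. weight z V E)"

text \<open>The root v is an end of a path, and that path alone is weighted by a separate function
  \<open>h\<close>. Shortening it by one vertex can then be absorbed by passing from
  \<open>h\<close> to \<open>h \<circ> Suc\<close>.\<close>

definition rooted_weight ::
  "(nat \<Rightarrow> complex) \<Rightarrow> (nat \<Rightarrow> complex) \<Rightarrow> nat set \<Rightarrow> nat \<Rightarrow> nat \<Rightarrow> complex" where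
  "rooted_weight z h V m v = (\<Sum>E | E \<in> pc_graphs V m \<and> deg E v = 1.
     h (card (component E v)) * (\<Prod>C\<in>components V E - {component E v}. z (card C)))"

section \<open>Components and pendant edges\<close>

lemma components_eq: "components V E = component E ` V"
  by (auto simp: components_def component_def)

lemma finite_edges_on: "finite V \<Longrightarrow> finite (edges_on V)"
  by (rule finite_subset[of _ "Pow V"]) (auto simp: edges_on_def)

lemma finite_pc_graphs: "finite V \<Longrightarrow> finite (pc_graphs V m)"
  by (rule finite_subset[of _ "Pow (edges_on V)"]) (auto simp: pc_graphs_def finite_edges_on)

lemma pc_graphs_finite_edges: "finite V \<Longrightarrow> E \<in> pc_graphs V m \<Longrightarrow> finite E"
  using finite_edges_on finite_subset unfolding pc_graphs_def by blast

lemma edges_on_mono: "V \<subseteq> V' \<Longrightarrow> edges_on V \<subseteq> edges_on V'"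
  by (auto simp: edges_on_def)

lemma Union_edges_on: "E \<subseteq> edges_on V \<Longrightarrow> \<Union>E \<subseteq> V"
  by (auto simp: edges_on_def)

lemma sym_adj_rel: "sym (adj_rel E)"
  by (auto simp: adj_rel_def sym_def insert_commute)

lemma component_self [simp]: "v \<in> component E v"
  by (simp add: component_def)

lemma component_sym: "y \<in> component E x \<longleftrightarrow> x \<in> component E y"
  using sym_rtrancl[OF sym_adj_rel[of E]] by (auto simp: component_def sym_def)

lemma component_eqI: "y \<in> component E x \<Longrightarrow> component E y = component E x"
proof -
  assume a: "y \<in> component E x"
  then have b: "x \<in> component E y" using component_sym by blast
  from a b show ?thesis unfolding component_def by (auto intro: rtrancl_trans)
qed

lemma component_subset: "E \<subseteq> edges_on V \<Longrightarrow> v \<in> V \<Longrightarrow> component E v \<subseteq> V"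
proof
  fix y assume E: "E \<subseteq> edges_on V" and v: "v \<in> V" and "y \<in> component E v"
  then have "(v, y) \<in> (adj_rel E)\<^sup>*" by (simp add: component_def)
  then show "y \<in> V" using v Union_edges_on[OF E]
    by (induction rule: rtrancl_induct) (auto simp: adj_rel_def)
qed

lemma component_step: "{x, y} \<in> E \<Longrightarrow> x \<noteq> y \<Longrightarrow> y \<in> component E x"
  by (auto simp: component_def adj_rel_def)

lemma component_isolated: "v \<notin> \<Union>E \<Longrightarrow> component E v = {v}"
proof -
  assume v: "v \<notin> \<Union>E"
  have "y = v" if "(v, y) \<in> (adj_rel E)\<^sup>*" for y
    using that by (induction rule: rtrancl_induct) (use v in \<open>auto simp: adj_rel_def\<close>)
  then show ?thesis by (auto simp: component_def)
qed

lemma component_mono: "E \<subseteq> E' \<Longrightarrow> component E v \<subseteq> component E' v"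
  unfolding component_def by (intro Image_mono rtrancl_mono) (auto simp: adj_rel_def)

text \<open>Since v is isolated in \<open>E\<close>, the new edge attaches v as a leaf and creates
  no connection between old vertices: a walk that enters v has to return to u.\<close>

lemma component_pendant:
  assumes "v \<notin> \<Union>E" "u \<noteq> v" "x \<noteq> v"
  shows "component (insert {u, v} E) x = (if u \<in> component E x then insert v (component E x) else component E x)"
    (is "?L = ?R")
proof
  show "?L \<subseteq> ?R"
  proof
    fix y assume "y \<in> ?L"
    then have "(x, y) \<in> (adj_rel (insert {u, v} E))\<^sup>*" by (simp add: component_def)
    then show "y \<in> ?R"
    proof (induction rule: rtrancl_induct)
      case base
      then show ?case by simp
    next
      case (step y w)
      have vn: "v \<notin> component E x"
        using component_isolated[OF assms(1)] assms(3) component_sym[of v E x] by auto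
      consider "(y, w) \<in> adj_rel E" | "y = u" "w = v" | "y = v" "w = u"
        using step(2) by (auto simp: adj_rel_def doubleton_eq_iff)
      then show ?case
      proof cases
        case 1
        then have "y \<noteq> v" using assms(1) by (auto simp: adj_rel_def)
        then have "y \<in> component E x" using step(3) by (auto split: if_splits)
        then have "w \<in> component E x" using 1 by (auto simp: component_def)
        then show ?thesis by auto
      qed (use step(3) vn in \<open>auto split: if_splits\<close>)
    qed
  qed
next
  have 1: "component E x \<subseteq> ?L" by (rule component_mono) auto
  have 2: "v \<in> ?L" if "u \<in> component E x"
    using component_step[of u v "insert {u,v} E"] assms(2) component_eqI that 1 by blast
  show "?R \<subseteq> ?L" using 1 2 by auto
qed

lemma component_pendant_leaf:
  assumes "v \<notin> \<Union>E" "u \<noteq> v"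
  shows "component (insert {u, v} E) v = insert v (component E u)"
proof -
  have "v \<in> component (insert {u, v} E) u"
    using assms component_step by blast
  then have "component (insert {u, v} E) v = component (insert {u, v} E) u"
    by (rule component_eqI)
  then show ?thesis using component_pendant[OF assms(1,2), of u] assms(2) by simp
qed

text \<open>Only the component of u is altered by the leaf. The product over the components that
  avoid the root in \<open>rooted_weight\<close> therefore carries over unchanged.\<close>

lemma components_pendant:
  assumes "v \<notin> \<Union>E" "u \<in> V" "v \<notin> V"
  shows "components (insert v V) (insert {u, v} E) - {component (insert {u, v} E) v}
    = components V E - {component E u}"
proof -
  have uv: "u \<noteq> v" using assms by auto
  have leaf: "component (insert {u, v} E) v = insert v (component E u)"
    by (rule component_pendant_leaf[OF assms(1) uv])
  have other: "component (insert {u, v} E) x = (if component E x = component E u then insert v (component E u) else component E x)"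
    if "x \<in> V" for x
    using component_pendant[OF assms(1) uv, of x] that assms(3) component_eqI component_self by (metis (full_types))
  have nv: "v \<notin> component E x" if "x \<in> V" for x
    using component_isolated[OF assms(1)] component_sym[of v E x] that assms(3) by auto
  show ?thesis
    unfolding components_eq leaf image_insert
    using other nv by (auto split: if_splits)
qed

section \<open>Degrees when an edge is added or removed\<close>

lemma deg_insert:
  assumes "finite E" "{u, v} \<notin> E"
  shows "deg (insert {u, v} E) x = deg E x + (if x = u \<or> x = v then 1 else 0)"
proof (cases "x = u \<or> x = v")
  case True
  then have "{e \<in> insert {u, v} E. x \<in> e} = insert {u, v} {e \<in> E. x \<in> e}" by auto
  then show ?thesis using assms True by (simp add: deg_def)
next
  case False
  then have "{e \<in> insert {u, v} E. x \<in> e} = {e \<in> E. x \<in> e}" by auto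
  then show ?thesis using False by (simp add: deg_def)
qed

lemma deg_isolated: "v \<notin> \<Union>E \<Longrightarrow> deg E v = 0"
proof -
  assume "v \<notin> \<Union>E"
  then have "{e \<in> E. v \<in> e} = {}" by auto
  then show ?thesis unfolding deg_def by (simp only: card.empty)
qed

lemma isolated_deg: "finite E \<Longrightarrow> deg E v = 0 \<Longrightarrow> v \<notin> \<Union>E"
  by (auto simp: deg_def)

lemma deg_one_edge:
  assumes "E \<subseteq> edges_on V" "deg E v = 1"
  shows "\<exists>!u. u \<in> V - {v} \<and> {u, v} \<in> E"
proof -
  obtain e where e: "{e \<in> E. v \<in> e} = {e}"
    using assms(2) card_1_singletonE unfolding deg_def by blast
  then have eE': "v \<in> e" "e \<in> E" by auto
  then have eE: "e \<in> edges_on V" "v \<in> e" "e \<in> E" using assms(1) by auto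
  then obtain a b where ab: "e = {a, b}" "a \<in> V" "b \<in> V" "a \<noteq> b"
    unfolding edges_on_def by blast
  then obtain u where u: "e = {u, v}" "u \<in> V" "u \<noteq> v"
    using eE(2) by (metis insert_commute insert_iff singletonD)
  show ?thesis
  proof (rule ex1I[of _ u])
    fix w assume "w \<in> V - {v} \<and> {w, v} \<in> E"
    then have "{w, v} \<in> {e \<in> E. v \<in> e}" by simp
    then have "{w, v} = {u, v}" unfolding e u(1) by simp
    then show "w = u" by (auto simp: doubleton_eq_iff)
  qed (use u \<open>e \<in> E\<close> in auto)
qed

lemma edge_in_edges_on: "u \<in> V \<Longrightarrow> v \<in> V \<Longrightarrow> u \<noteq> v \<Longrightarrow> {u, v} \<in> edges_on V"
  by (auto simp: edges_on_def)

lemma edges_on_Diff: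
  assumes "E \<subseteq> edges_on V" "v \<notin> \<Union>E"
  shows "E \<subseteq> edges_on (V - {v})"
proof
  fix e assume e: "e \<in> E"
  then obtain a b where ab: "e = {a, b}" "a \<in> V" "b \<in> V" "a \<noteq> b"
    using assms(1) unfolding edges_on_def by blast
  moreover have "v \<noteq> a" "v \<noteq> b" using assms(2) e ab(1) by auto
  ultimately show "e \<in> edges_on (V - {v})" by (simp add: edge_in_edges_on)
qed

lemma deg_remove:
  assumes "finite E" "{u, v} \<in> E"
  shows "deg (E - {{u, v}}) x = deg E x - (if x = u \<or> x = v then 1 else 0)"
  using deg_insert[of "E - {{u, v}}" u v x] assms by (simp add: insert_absorb)


lemma pc_graphs_card_one: "E \<in> pc_graphs V m \<Longrightarrow> card {v \<in> V. deg E v = 1} = 2 * m"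
  by (simp add: pc_graphs_def)

lemma pc_graphs_deg: "E \<in> pc_graphs V m \<Longrightarrow> v \<in> V \<Longrightarrow> deg E v = 1 \<or> deg E v = 2"
  by (simp add: pc_graphs_def)

lemma pc_graphs_edges: "E \<in> pc_graphs V m \<Longrightarrow> E \<subseteq> edges_on V"
  by (simp add: pc_graphs_def)

text \<open>The case of a path on two vertices: the edge is a whole new component, so the number of
  paths grows by one.\<close>

lemma attach_edge:
  assumes fin: "finite V" and uv: "u \<in> V" "v \<in> V" "u \<noteq> v"
    and E: "E \<in> pc_graphs (V - {u, v}) m"
  shows "insert {u, v} E \<in> pc_graphs V (Suc m)" "deg (insert {u, v} E) v = 1"
    "deg (insert {u, v} E) u = 1"
proof -
  have sub: "E \<subseteq> edges_on (V - {u, v})" using E by (rule pc_graphs_edges)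
  then have UE: "\<Union>E \<subseteq> V - {u, v}" by (rule Union_edges_on)
  have finE: "finite E" using pc_graphs_finite_edges[OF _ E] fin by auto
  have nin: "{u, v} \<notin> E" "u \<notin> \<Union>E" "v \<notin> \<Union>E" using UE by auto
  note d = deg_insert[OF finE nin(1)]
  show 1: "deg (insert {u, v} E) v = 1" "deg (insert {u, v} E) u = 1"
    using d deg_isolated nin by simp_all
  have d': "deg (insert {u, v} E) x = deg E x" if "x \<in> V - {u, v}" for x
    using d that by simp
  have "{x \<in> V. deg (insert {u, v} E) x = 1} = insert u (insert v {x \<in> V - {u, v}. deg E x = 1})"
    using 1 d' uv by auto
  then have "card {x \<in> V. deg (insert {u, v} E) x = 1} = 2 * Suc m"
    using uv fin pc_graphs_card_one[OF E] by simp
  moreover have "insert {u, v} E \<subseteq> edges_on V"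
    using sub edges_on_mono[of "V - {u, v}" V] edge_in_edges_on[OF uv] by blast
  moreover have "deg (insert {u, v} E) x = 1 \<or> deg (insert {u, v} E) x = 2" if "x \<in> V" for x
    using 1 d' pc_graphs_deg[OF E, of x] that by (cases "x \<in> {u, v}") auto
  ultimately show "insert {u, v} E \<in> pc_graphs V (Suc m)"
    by (simp add: pc_graphs_def)
qed

text \<open>The case of a longer path: u stops being an end and v takes its place, so the number of
  paths stays the same.\<close>

lemma attach_pendant:
  assumes fin: "finite V" and uv: "u \<in> V" "v \<in> V" "u \<noteq> v"
    and E: "E \<in> pc_graphs (V - {v}) m" and degu: "deg E u = 1"
  shows "insert {u, v} E \<in> pc_graphs V m" "deg (insert {u, v} E) v = 1"
    "deg (insert {u, v} E) u = 2"
proof -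
  have sub: "E \<subseteq> edges_on (V - {v})" using E by (rule pc_graphs_edges)
  then have UE: "\<Union>E \<subseteq> V - {v}" by (rule Union_edges_on)
  have finE: "finite E" using pc_graphs_finite_edges[OF _ E] fin by auto
  have nin: "{u, v} \<notin> E" "v \<notin> \<Union>E" using UE by auto
  note d = deg_insert[OF finE nin(1)]
  show 1: "deg (insert {u, v} E) v = 1" "deg (insert {u, v} E) u = 2"
    using d deg_isolated nin degu by simp_all
  have d': "deg (insert {u, v} E) x = deg E x" if "x \<in> V - {u, v}" for x
    using d that by simp
  have eq: "{x \<in> V. deg (insert {u, v} E) x = 1} = insert v ({x \<in> V - {v}. deg E x = 1} - {u})"
  proof (rule set_eqI)
    fix x
    show "x \<in> {x \<in> V. deg (insert {u, v} E) x = 1} \<longleftrightarrow>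
      x \<in> insert v ({x \<in> V - {v}. deg E x = 1} - {u})"
      using 1 d'[of x] uv by (cases "x = u"; cases "x = v") auto
  qed
  have u: "u \<in> {x \<in> V - {v}. deg E x = 1}" using uv degu by auto
  have "card {x \<in> V. deg (insert {u, v} E) x = 1} = Suc (card ({x \<in> V - {v}. deg E x = 1} - {u}))"
    unfolding eq using fin by (intro card_insert_disjoint) auto
  also have "\<dots> = card {x \<in> V - {v}. deg E x = 1}"
    using card_Suc_Diff1[OF _ u] fin by simp
  finally have "card {x \<in> V. deg (insert {u, v} E) x = 1} = card {x \<in> V - {v}. deg E x = 1}" .
  then have "card {x \<in> V. deg (insert {u, v} E) x = 1} = 2 * m"
    using pc_graphs_card_one[OF E] by simp
  moreover have "insert {u, v} E \<subseteq> edges_on V"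
    using sub edges_on_mono[of "V - {v}" V] edge_in_edges_on[OF uv] by blast
  moreover have "deg (insert {u, v} E) x = 1 \<or> deg (insert {u, v} E) x = 2" if "x \<in> V" for x
    using 1 d' pc_graphs_deg[OF E, of x] that by (cases "x \<in> {u, v}") auto
  ultimately show "insert {u, v} E \<in> pc_graphs V m"
    by (simp add: pc_graphs_def)
qed

text \<open>The inverse of the two attachments, distinguished by the degree of the neighbour u. The
  truncation in \<open>m - 1\<close> is harmless, since two vertices of degree 1 exclude
  \<open>m = 0\<close>.\<close>

lemma detach:
  assumes fin: "finite V" and uv: "u \<in> V" "v \<in> V" "u \<noteq> v"
    and E: "E \<in> pc_graphs V m" and edge: "{u, v} \<in> E" and degv: "deg E v = 1"
  shows "deg E u = 1 \<Longrightarrow> E - {{u, v}} \<in> pc_graphs (V - {u, v}) (m - 1)"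
    and "deg E u = 2 \<Longrightarrow> E - {{u, v}} \<in> pc_graphs (V - {v}) m"
    and "deg E u = 2 \<Longrightarrow> deg (E - {{u, v}}) u = 1"
proof -
  have sub: "E - {{u, v}} \<subseteq> edges_on V" using pc_graphs_edges[OF E] by auto
  have finE: "finite E" using pc_graphs_finite_edges[OF fin E] .
  note d = deg_remove[OF finE edge]
  have "deg (E - {{u, v}}) v = 0" using d degv by simp
  then have niv: "v \<notin> \<Union>(E - {{u, v}})" using finE isolated_deg by blast
  have d': "deg (E - {{u, v}}) x = deg E x" if "x \<in> V - {u, v}" for x
    using d that by simp
  have subv: "E - {{u, v}} \<subseteq> edges_on (V - {v})"
    using edges_on_Diff[OF sub niv] .
  {
    assume degu: "deg E u = 1"
    then have "deg (E - {{u, v}}) u = 0" using d by simp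
    then have niu: "u \<notin> \<Union>(E - {{u, v}})" using finE isolated_deg by blast
    have "V - {v} - {u} = V - {u, v}" by auto
    then have "E - {{u, v}} \<subseteq> edges_on (V - {u, v})"
      using edges_on_Diff[OF subv niu] by simp
    moreover have "{x \<in> V - {u, v}. deg (E - {{u, v}}) x = 1} = {x \<in> V. deg E x = 1} - {u, v}"
      using d' by auto
    moreover have "{u, v} \<subseteq> {x \<in> V. deg E x = 1}" using uv degu degv by auto
    ultimately show "E - {{u, v}} \<in> pc_graphs (V - {u, v}) (m - 1)"
      using d' pc_graphs_deg[OF E] pc_graphs_card_one[OF E] uv
      by (auto simp: pc_graphs_def card_Diff_subset)
  }
  {
    assume degu: "deg E u = 2"
    then show 1: "deg (E - {{u, v}}) u = 1" using d by simp
    have eq: "{x \<in> V - {v}. deg (E - {{u, v}}) x = 1} = insert u ({x \<in> V. deg E x = 1} - {v})"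
    proof (rule set_eqI)
      fix x
      show "x \<in> {x \<in> V - {v}. deg (E - {{u, v}}) x = 1} \<longleftrightarrow>
        x \<in> insert u ({x \<in> V. deg E x = 1} - {v})"
        using 1 d'[of x] uv degu by (cases "x = u"; cases "x = v") auto
    qed
    have vm: "v \<in> {x \<in> V. deg E x = 1}" using uv degv by auto
    have "card {x \<in> V - {v}. deg (E - {{u, v}}) x = 1} = Suc (card ({x \<in> V. deg E x = 1} - {v}))"
      unfolding eq using fin degu by (intro card_insert_disjoint) auto
    also have "\<dots> = card {x \<in> V. deg E x = 1}"
      using card_Suc_Diff1[OF _ vm] fin by simp
    finally have cards: "card {x \<in> V - {v}. deg (E - {{u, v}}) x = 1} = card {x \<in> V. deg E x = 1}" .
    have dd: "deg (E - {{u, v}}) x = 1 \<or> deg (E - {{u, v}}) x = 2" if "x \<in> V - {v}" for x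
      using that 1 d'[of x] pc_graphs_deg[OF E, of x] by (cases "x = u") auto
    from cards show "E - {{u, v}} \<in> pc_graphs (V - {v}) m"
      using pc_graphs_card_one[OF E] subv dd
      by (auto simp: pc_graphs_def)
  }
qed

text \<open>Split by the unique neighbour u of the root. If u has degree 1, the root path is the
  edge itself, with weight \<open>h 2\<close>. If u has degree 2, deleting v leaves a graph rooted
  at u whose root path is one vertex shorter.\<close>

lemma rooted_weight_rec:
  assumes fin: "finite V" and v: "v \<in> V"
  shows "rooted_weight z h V (Suc m) v = (\<Sum>u\<in>V - {v}. h 2 * total_weight z (V - {u, v}) m
    + rooted_weight z (h \<circ> Suc) (V - {v}) (Suc m) u)"
proof -
  define g where "g E = h (card (component E v)) * (\<Prod>C\<in>components V E - {component E v}. z (card C))" for E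
  define X where "X d u = {E \<in> pc_graphs V (Suc m). deg E v = 1 \<and> {u, v} \<in> E \<and> deg E u = d}" for d :: nat and u
  have nbr: "\<exists>!u. u \<in> V - {v} \<and> {u, v} \<in> E" if "E \<in> pc_graphs V (Suc m)" "deg E v = 1" for E
    using deg_one_edge[OF pc_graphs_edges[OF that(1)] that(2)] .
  have finX: "finite (X d u)" for d u
    unfolding X_def using finite_pc_graphs[OF fin] by auto
  have split: "{E. E \<in> pc_graphs V (Suc m) \<and> deg E v = 1} = (\<Union>u\<in>V - {v}. X 1 u \<union> X 2 u)"
  proof (intro set_eqI iffI)
    fix E assume "E \<in> {E. E \<in> pc_graphs V (Suc m) \<and> deg E v = 1}"
    then have E: "E \<in> pc_graphs V (Suc m)" "deg E v = 1" by auto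
    from nbr[OF E] obtain u where u: "u \<in> V - {v}" "{u, v} \<in> E" by blast
    then show "E \<in> (\<Union>u\<in>V - {v}. X 1 u \<union> X 2 u)"
      using pc_graphs_deg[OF E(1), of u] E by (auto simp: X_def)
  qed (auto simp: X_def)
  have "rooted_weight z h V (Suc m) v = (\<Sum>u\<in>V - {v}. sum g (X 1 u \<union> X 2 u))"
    unfolding rooted_weight_def split g_def[symmetric]
  proof (rule sum.UNION_disjoint)
    show "\<forall>i\<in>V - {v}. \<forall>j\<in>V - {v}. i \<noteq> j \<longrightarrow> (X 1 i \<union> X 2 i) \<inter> (X 1 j \<union> X 2 j) = {}"
    proof (intro ballI impI equals0I)
      fix i j E assume ij: "i \<in> V - {v}" "j \<in> V - {v}" "i \<noteq> j"
        and "E \<in> (X 1 i \<union> X 2 i) \<inter> (X 1 j \<union> X 2 j)"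
      then have E: "E \<in> pc_graphs V (Suc m)" "deg E v = 1" "{i, v} \<in> E" "{j, v} \<in> E"
        by (auto simp: X_def)
      from nbr[OF E(1,2)] ij E(3,4) show False by metis
    qed
  qed (use fin finX in auto)
  also have "\<dots> = (\<Sum>u\<in>V - {v}. sum g (X 1 u) + sum g (X 2 u))"
    by (intro sum.cong refl sum.union_disjoint finX) (auto simp: X_def)
  also have "\<dots> = (\<Sum>u\<in>V - {v}. h 2 * total_weight z (V - {u, v}) m
    + rooted_weight z (h \<circ> Suc) (V - {v}) (Suc m) u)"
  proof (rule sum.cong[OF refl])
    fix u assume u: "u \<in> V - {v}"
    then have uv: "u \<in> V" "v \<in> V" "u \<noteq> v" using v by auto
    have "sum g (X 1 u) = (\<Sum>E\<in>pc_graphs (V - {u, v}) m. h 2 * weight z (V - {u, v}) E)"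
    proof (rule sum.reindex_bij_witness[of _ "insert {u, v}" "\<lambda>E. E - {{u, v}}"])
      fix E assume "E \<in> X 1 u"
      then show "insert {u, v} (E - {{u, v}}) = E" "E - {{u, v}} \<in> pc_graphs (V - {u, v}) m"
        using detach(1)[OF fin uv, of E "Suc m"] by (auto simp: X_def)
    next
      fix E assume E: "E \<in> pc_graphs (V - {u, v}) m"
      have UE: "\<Union>E \<subseteq> V - {u, v}" using E pc_graphs_edges Union_edges_on by blast
      show "insert {u, v} E - {{u, v}} = E" using UE by auto
      show "insert {u, v} E \<in> X 1 u" using attach_edge[OF fin uv E] by (auto simp: X_def)
    next
      fix E assume E: "E \<in> X 1 u"
      define E' where "E' = E - {{u, v}}"
      have E': "E' \<in> pc_graphs (V - {u, v}) m" "E = insert {u, v} E'"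
        using E detach(1)[OF fin uv, of E "Suc m"] by (auto simp: X_def E'_def)
      have UE: "\<Union>E' \<subseteq> V - {u, v}" using E' pc_graphs_edges Union_edges_on by blast
      have n: "v \<notin> \<Union>E'" "u \<notin> \<Union>E'" using UE by auto
      have cu: "component E' u = {u}" by (rule component_isolated[OF n(2)])
      \<comment> \<open>Without v the vertex u is isolated, so dropping u from the vertex set
        removes exactly the component \<open>{u}\<close>.\<close>
      have ncu: "{u} \<notin> components (V - {u, v}) E'"
        using component_subset[OF pc_graphs_edges[OF E'(1)]] unfolding components_eq by fastforce
      have V: "V = insert v (V - {v})" "V - {v} = insert u (V - {u, v})" using uv by auto
      have "components V E - {component E v} = components (V - {v}) E' - {{u}}"
        using components_pendant[OF n(1), of u "V - {v}"] V(1)[symmetric] uv cu by (simp add: E'(2))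
      also have "\<dots> = components (V - {u, v}) E'"
        by (subst V(2)) (use ncu cu in \<open>auto simp: components_eq\<close>)
      finally have 1: "components V E - {component E v} = components (V - {u, v}) E'" .
      have "component E v = {u, v}"
        using component_pendant_leaf[OF n(1) uv(3)] cu by (auto simp: E'(2))
      then show "h 2 * weight z (V - {u, v}) (E - {{u, v}}) = g E"
        unfolding g_def 1 using uv by (simp add: weight_def E'_def numeral_2_eq_2)
    qed
    moreover have "sum g (X 2 u) = rooted_weight z (h \<circ> Suc) (V - {v}) (Suc m) u"
      unfolding rooted_weight_def
    proof (rule sum.reindex_bij_witness[of _ "insert {u, v}" "\<lambda>E. E - {{u, v}}"])
      fix E assume "E \<in> X 2 u"
      then show "insert {u, v} (E - {{u, v}}) = E" 
         "E - {{u, v}} \<in> {E \<in> pc_graphs (V - {v}) (Suc m). deg E u = 1}"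
        using detach(2,3)[OF fin uv] by (auto simp: X_def)
    next
      fix E assume E: "E \<in> {E \<in> pc_graphs (V - {v}) (Suc m). deg E u = 1}"
      then have UE: "\<Union>E \<subseteq> V - {v}" using pc_graphs_edges Union_edges_on by blast
      show "insert {u, v} E - {{u, v}} = E" using UE by auto
      show "insert {u, v} E \<in> X 2 u" using attach_pendant[OF fin uv] E by (auto simp: X_def)
    next
      fix E assume E: "E \<in> X 2 u"
      define E' where "E' = E - {{u, v}}"
      have E': "E' \<in> pc_graphs (V - {v}) (Suc m)" "E = insert {u, v} E'"
        using E detach(2)[OF fin uv] by (auto simp: X_def E'_def)
      have n: "v \<notin> \<Union>E'" using E' pc_graphs_edges Union_edges_on by blast
      have V: "V = insert v (V - {v})" using uv by auto
      have 1: "components V E - {component E v} = components (V - {v}) E' - {component E' u}"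
        using components_pendant[OF n(1), of u "V - {v}"] V[symmetric] uv by (simp add: E'(2))
      have sub: "component E' u \<subseteq> V - {v}"
        using component_subset[OF pc_graphs_edges[OF E'(1)]] uv by auto
      have "component E v = insert v (component E' u)"
        using component_pendant_leaf[OF n(1) uv(3)] by (simp add: E'(2))
      moreover have "finite (component E' u)" "v \<notin> component E' u"
        using sub fin finite_subset by auto
      ultimately have "card (component E v) = Suc (card (component E' u))" by simp
      then show "(h \<circ> Suc) (card (component (E - {{u, v}}) u)) *
         (\<Prod>C\<in>components (V - {v}) (E - {{u, v}}) - {component (E - {{u, v}}) u}. z (card C)) = g E"
        unfolding g_def 1 by (simp add: E'_def)
    qed
    ultimately show "sum g (X 1 u) + sum g (X 2 u) = h 2 * total_weight z (V - {u, v}) m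
      + rooted_weight z (h \<circ> Suc) (V - {v}) (Suc m) u"
      by (simp add: total_weight_def sum_distrib_left)
  qed
  finally show ?thesis .
qed

section \<open>The weight recurrence\<close>

text \<open>Double counting: every graph is rooted once at each of its \<open>2 * m\<close> path
  ends, and with \<open>h = z\<close> the rooted weight is the full weight.\<close>

lemma sum_rooted_weight:
  assumes fin: "finite V"
  shows "(\<Sum>v\<in>V. rooted_weight z z V m v) = of_nat (2 * m) * total_weight z V m"
proof -
  have w: "z (card (component E v)) * (\<Prod>C\<in>components V E - {component E v}. z (card C)) = weight z V E"
    if "v \<in> V" for v E
    unfolding weight_def using fin that
    by (subst prod.remove[of "components V E" "component E v"]) (auto simp: components_eq)
  have "(\<Sum>v\<in>V. rooted_weight z z V m v)
    = (\<Sum>v\<in>V. \<Sum>E\<in>pc_graphs V m. if deg E v = 1 then weight z V E else 0)"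
  proof (rule sum.cong[OF refl])
    fix v assume v: "v \<in> V"
    have "rooted_weight z z V m v = (\<Sum>E\<in>{E \<in> pc_graphs V m. deg E v = 1}. weight z V E)"
      unfolding rooted_weight_def by (intro sum.cong refl w v)
    also have "\<dots> = (\<Sum>E\<in>pc_graphs V m. if deg E v = 1 then weight z V E else 0)"
      by (rule sum.inter_filter[OF finite_pc_graphs[OF fin]])
    finally show "rooted_weight z z V m v = (\<Sum>E\<in>pc_graphs V m. if deg E v = 1 then weight z V E else 0)" .
  qed
  also have "\<dots> = (\<Sum>E\<in>pc_graphs V m. \<Sum>v\<in>V. if deg E v = 1 then weight z V E else 0)"
    by (rule sum.swap)
  also have "\<dots> = (\<Sum>E\<in>pc_graphs V m. of_nat (2 * m) * weight z V E)"
  proof (rule sum.cong[OF refl])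
    fix E assume E: "E \<in> pc_graphs V m"
    have "(\<Sum>v\<in>V. if deg E v = 1 then weight z V E else 0)
      = (\<Sum>v\<in>{v \<in> V. deg E v = 1}. weight z V E)"
      by (rule sum.inter_filter[OF fin, symmetric])
    also have "\<dots> = of_nat (2 * m) * weight z V E"
      using pc_graphs_card_one[OF E] by simp
    finally show "(\<Sum>v\<in>V. if deg E v = 1 then weight z V E else 0) = of_nat (2 * m) * weight z V E" .
  qed
  finally show ?thesis by (simp add: total_weight_def sum_distrib_left)
qed

text \<open>With n vertices there are (n-1)! / (n-j)! ways to continue a path of j vertices from v,
  and the rest contributes (n-j)! times \<open>w\<close>. The product has the factor (n-1)! for
  every j, so the normalised weights obey a plain convolution. The induction needs \<open>h\<close>
  arbitrary because it changes to \<open>h \<circ> Suc\<close>.\<close>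

lemma rooted_weight_closed:
  assumes W: "\<And>V. finite V \<Longrightarrow> total_weight z V m = fact (card V) * w (card V)"
    and "finite V" "v \<in> V"
  shows "rooted_weight z h V (Suc m) v = fact (card V - 1) * (\<Sum>j=2..card V. h j * w (card V - j))"
  using assms(2,3)
proof (induction "card V" arbitrary: V v h)
  case 0
  then show ?case by auto
next
  case (Suc n)
  have cV: "card (V - {v}) = n" using Suc by simp
  show ?case
  proof (cases "n = 0")
    \<comment> \<open>A single vertex leaves no neighbour to choose, and the range from 2 to 1 is
      empty: both sides are 0.\<close>
    case True
    then have e: "V - {v} = {}" using cV Suc.prems(1) by auto
    have "card V = 1" using Suc.hyps(2) True by simp
    then show ?thesis by (simp only: rooted_weight_rec[OF Suc.prems] e sum.empty) simp
  next
    case False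
    have step: "h 2 * total_weight z (V - {u, v}) m + rooted_weight z (h \<circ> Suc) (V - {v}) (Suc m) u
      = fact (n - 1) * (\<Sum>j=2..Suc n. h j * w (Suc n - j))" if u: "u \<in> V - {v}" for u
    proof -
      have "V - {u, v} = V - {v} - {u}" by auto
      then have "card (V - {u, v}) = n - 1" using u cV by simp
      moreover have "rooted_weight z (h \<circ> Suc) (V - {v}) (Suc m) u
        = fact (n - 1) * (\<Sum>j=2..n. h (Suc j) * w (n - j))"
        using Suc.hyps(1)[of "V - {v}" u "h \<circ> Suc"] cV Suc.prems u by simp
      \<comment> \<open>The term \<open>j = 2\<close> is the path that stops at u; the longer paths
        are shifted by one to match \<open>h \<circ> Suc\<close>.\<close>
      moreover have "(\<Sum>j=2..Suc n. h j * w (Suc n - j)) = h 2 * w (n - 1) + (\<Sum>j=2..n. h (Suc j) * w (n - j))"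
      proof -
        have "{2..Suc n} = insert 2 {Suc 2..Suc n}" using False by auto
        then have "(\<Sum>j=2..Suc n. h j * w (Suc n - j)) = h 2 * w (n - 1) + (\<Sum>j=Suc 2..Suc n. h j * w (Suc n - j))"
          by (simp add: numeral_2_eq_2)
        then show ?thesis by (subst (asm) sum.shift_bounds_cl_Suc_ivl) simp
      qed
      ultimately show ?thesis using W[of "V - {u, v}"] Suc.prems by (simp add: algebra_simps)
    qed
    have "rooted_weight z h V (Suc m) v = (\<Sum>u\<in>V - {v}. fact (n - 1) * (\<Sum>j=2..Suc n. h j * w (Suc n - j)))"
      by (subst rooted_weight_rec[OF Suc.prems]) (intro sum.cong refl step)
    also have "\<dots> = fact n * (\<Sum>j=2..Suc n. h j * w (Suc n - j))"
      using cV False by (simp add: fact_reduce[of n])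
    finally show ?thesis unfolding Suc.hyps(2)[symmetric] by simp
  qed
qed

lemma component_image:
  assumes "inj_on f V" "E \<subseteq> edges_on V" "v \<in> V"
  shows "f ` component E v \<subseteq> component ((`) f ` E) (f v)"
proof -
  have "(f v, f y) \<in> (adj_rel ((`) f ` E))\<^sup>*" if "(v, y) \<in> (adj_rel E)\<^sup>*" for y
    using that
  proof (induction rule: rtrancl_induct)
    case (step y w)
    have yw: "{y, w} \<in> E" "y \<noteq> w" using step(2) by (auto simp: adj_rel_def)
    then have "y \<in> V" "w \<in> V" using Union_edges_on[OF assms(2)] by auto
    then have "f y \<noteq> f w" using assms(1) yw(2) by (auto simp: inj_on_def)
    moreover have "{f y, f w} \<in> (`) f ` E" using imageI[OF yw(1), of "(`) f"] by simp
    ultimately have "(f y, f w) \<in> adj_rel ((`) f ` E)" by (simp add: adj_rel_def)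
    then show ?case using step(3) by (rule rtrancl.rtrancl_into_rtrancl[rotated])
  qed simp
  then show ?thesis by (auto simp: component_def)
qed

lemma edges_on_image:
  assumes "inj_on f V" "E \<subseteq> edges_on V"
  shows "(`) f ` E \<subseteq> edges_on (f ` V)"
proof
  fix e assume "e \<in> (`) f ` E"
  then obtain e' where e': "e' \<in> edges_on V" "e = f ` e'" using assms(2) by blast
  then obtain u v where uv: "e' = {u, v}" "u \<in> V" "v \<in> V" "u \<noteq> v"
    unfolding edges_on_def by blast
  then have "f u \<noteq> f v" using assms(1) by (simp add: inj_on_eq_iff)
  then have "{f u, f v} \<in> edges_on (f ` V)" using uv by (intro edge_in_edges_on imageI)
  then show "e \<in> edges_on (f ` V)" using e'(2) uv(1) by simp
qed

lemma image_image_inv: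
  assumes "inj_on f V" "E \<subseteq> edges_on V"
  shows "(`) (inv_into V f) ` ((`) f ` E) = E"
proof -
  have "inv_into V f ` f ` e = e" if "e \<in> E" for e
  proof -
    have "e \<subseteq> V" using Union_edges_on[OF assms(2)] that by auto
    then show ?thesis by (rule inv_into_image_cancel[OF assms(1)])
  qed
  then show ?thesis by (simp add: image_image)
qed

text \<open>The inclusion \<open>component_image\<close>, applied to the inverse relabelling, yields
  the converse inclusion.\<close>

lemma component_image_eq:
  assumes "inj_on f V" "E \<subseteq> edges_on V" "v \<in> V"
  shows "component ((`) f ` E) (f v) = f ` component E v"
proof
  have inj: "inj_on (inv_into V f) (f ` V)" by (simp add: inj_on_inv_into)
  have "inv_into V f ` component ((`) f ` E) (f v) \<subseteq> component E v"
    using component_image[OF inj edges_on_image[OF assms(1,2)], of "f v"] assms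
    by (simp add: image_image_inv)
  moreover have "component ((`) f ` E) (f v) \<subseteq> f ` V"
    using component_subset[OF edges_on_image[OF assms(1,2)], of "f v"] assms(3) by auto
  ultimately show "component ((`) f ` E) (f v) \<subseteq> f ` component E v"
    by (metis image_inv_into_cancel image_mono)
qed (rule component_image[OF assms])

lemma deg_image:
  assumes "inj_on f V" "E \<subseteq> edges_on V" "v \<in> V"
  shows "deg ((`) f ` E) (f v) = deg E v"
proof -
  have sub: "e \<subseteq> V" if "e \<in> E" for e using Union_edges_on[OF assms(2)] that by auto
  have "f v \<in> f ` e \<longleftrightarrow> v \<in> e" if "e \<in> E" for e
    by (rule inj_on_image_mem_iff[OF assms(1,3) sub[OF that]])
  then have "{e \<in> (`) f ` E. f v \<in> e} = (`) f ` {e \<in> E. v \<in> e}" by auto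
  moreover have "inj_on ((`) f) {e \<in> E. v \<in> e}"
    using inj_on_image_Pow[OF assms(1)] by (rule inj_on_subset) (use sub in auto)
  ultimately show ?thesis by (simp add: deg_def card_image)
qed

lemma pc_graphs_image:
  assumes "inj_on f V" "E \<in> pc_graphs V m"
  shows "(`) f ` E \<in> pc_graphs (f ` V) m"
proof -
  have sub: "E \<subseteq> edges_on V" using assms(2) by (rule pc_graphs_edges)
  note d = deg_image[OF assms(1) sub]
  have "{x \<in> f ` V. deg ((`) f ` E) x = 1} = f ` {x \<in> V. deg E x = 1}" using d by auto
  moreover have "inj_on f {x \<in> V. deg E x = 1}" using assms(1) by (rule inj_on_subset) auto
  ultimately have "card {x \<in> f ` V. deg ((`) f ` E) x = 1} = 2 * m"
    using pc_graphs_card_one[OF assms(2)] by (simp add: card_image)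
  then show ?thesis
    using edges_on_image[OF assms(1) sub] d pc_graphs_deg[OF assms(2)]
    by (auto simp: pc_graphs_def)
qed

lemma weight_image:
  assumes "inj_on f V" "E \<subseteq> edges_on V"
  shows "weight z (f ` V) ((`) f ` E) = weight z V E"
proof -
  have sub: "C \<subseteq> V" if "C \<in> components V E" for C
    using component_subset[OF assms(2)] that by (auto simp: components_eq)
  have "components (f ` V) ((`) f ` E) = (`) f ` components V E"
    using component_image_eq[OF assms] by (auto simp: components_eq image_image)
  moreover have "inj_on ((`) f) (components V E)"
    using inj_on_image_Pow[OF assms(1)] by (rule inj_on_subset) (use sub in auto)
  moreover have "card (f ` C) = card C" if "C \<in> components V E" for C
    using sub[OF that] assms(1) by (meson card_image inj_on_subset)
  ultimately show ?thesis by (simp add: weight_def prod.reindex)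
qed

lemma total_weight_image:
  assumes "inj_on f V"
  shows "total_weight z (f ` V) m = total_weight z V m"
proof -
  have inj: "inj_on (inv_into V f) (f ` V)" by (simp add: inj_on_inv_into)
  have VV: "inv_into V f ` f ` V = V" using assms by (simp add: image_image)
  have ff: "(`) f ` (`) (inv_into V f) ` E = E" if "E \<subseteq> edges_on (f ` V)" for E
  proof -
    have "f ` inv_into V f ` e = e" if "e \<in> E" for e
      using Union_edges_on[OF \<open>E \<subseteq> edges_on (f ` V)\<close>] that by (intro image_inv_into_cancel) auto
    then show ?thesis by (simp add: image_image)
  qed
  show ?thesis
    unfolding total_weight_def
  proof (rule sum.reindex_bij_witness[of _ "(`) ((`) f)" "(`) ((`) (inv_into V f))"])
    fix E assume E: "E \<in> pc_graphs (f ` V) m"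
    show "(`) f ` (`) (inv_into V f) ` E = E" by (rule ff[OF pc_graphs_edges[OF E]])
    show "(`) (inv_into V f) ` E \<in> pc_graphs V m"
      using pc_graphs_image[OF inj E] VV by simp
    show "weight z V ((`) (inv_into V f) ` E) = weight z (f ` V) E"
      using weight_image[OF inj pc_graphs_edges[OF E]] VV by simp
  next
    fix E assume E: "E \<in> pc_graphs V m"
    show "(`) (inv_into V f) ` (`) f ` E = E"
      by (rule image_image_inv[OF assms pc_graphs_edges[OF E]])
    show "(`) f ` E \<in> pc_graphs (f ` V) m" by (rule pc_graphs_image[OF assms E])
  qed
qed

text \<open>Deleting vertices leaves arbitrary finite sets, whereas the base case of
  \<open>omega\<close> refers to an initial segment; this identifies the two.\<close>

lemma total_weight_card:
  assumes "finite V"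
  shows "total_weight z V m = total_weight z {1..card V} m"
proof -
  obtain f where "bij_betw f {1..card V} V"
    using assms by (metis card_atLeastAtMost diff_Suc_1 finite_atLeastAtMost finite_same_card_bij)
  then show ?thesis using total_weight_image[of f "{1..card V}" z m] by (auto simp: bij_betw_def)
qed

section \<open>Normalised total weights and 2-regular graphs\<close>

text \<open>Coefficients of the exponential generating function of graphs with m paths. A step adds
  one path; the divisor \<open>2 * Suc m\<close> compensates for the choice of the distinguished
  path and of its end.\<close>

primrec omega :: "(nat \<Rightarrow> complex) \<Rightarrow> nat \<Rightarrow> nat \<Rightarrow> complex" where
  "omega z 0 n = total_weight z {1..n} 0 / fact n"
| "omega z (Suc m) n = (\<Sum>j=2..n. z j * omega z m (n - j)) / of_nat (2 * Suc m)"

lemma total_weight_omega: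
  "finite V \<Longrightarrow> total_weight z V m = fact (card V) * omega z m (card V)"
proof (induction m arbitrary: V)
  case 0
  then show ?case by (simp add: total_weight_card[OF 0, of z 0])
next
  case (Suc m)
  have "of_nat (2 * Suc m) * total_weight z V (Suc m)
    = (\<Sum>v\<in>V. fact (card V - 1) * (\<Sum>j=2..card V. z j * omega z m (card V - j)))"
    unfolding sum_rooted_weight[OF Suc.prems, symmetric]
    by (intro sum.cong refl rooted_weight_closed Suc.IH Suc.prems)
  also have "\<dots> = fact (card V) * (\<Sum>j=2..card V. z j * omega z m (card V - j))"
  proof (cases "card V = 0")
    case False
    then show ?thesis by (simp add: fact_reduce[of "card V"])
  qed simp
  finally show ?case by (simp add: field_simps del: of_nat_mult of_nat_Suc of_nat_add)
qed

lemma pc_graphs_0_deg: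
  assumes "finite V" "E \<in> pc_graphs V 0" "v \<in> V"
  shows "deg E v = 2"
  using assms by (auto simp: pc_graphs_def)

text \<open>Deleting an edge at a fixed vertex turns a 2-regular graph into one with a single path,
  and the deleted edge is recovered as the pair of endpoints of that path.\<close>
lemma card_pc_graphs_0_le_rooted:
  assumes fin: "finite V" and v: "v \<in> V"
  shows "card (pc_graphs V 0) \<le> card {E \<in> pc_graphs V 1. deg E v = 1}"
proof -
  define nb where "nb E = (SOME u. u \<in> V \<and> u \<noteq> v \<and> {u, v} \<in> E)" for E
  define cut where "cut E = E - {{nb E, v}}" for E
  have nb: "nb E \<in> V \<and> nb E \<noteq> v \<and> {nb E, v} \<in> E" if E: "E \<in> pc_graphs V 0" for E
  proof -
    have "card {e \<in> E. v \<in> e} \<noteq> 0" using pc_graphs_0_deg[OF fin E v] by (simp add: deg_def)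
    then have "{e \<in> E. v \<in> e} \<noteq> {}" by (metis card.empty)
    then obtain e where e: "e \<in> E" "v \<in> e" by blast
    then have "e \<in> edges_on V" using pc_graphs_edges[OF E] by blast
    then obtain a b where ab: "e = {a, b}" "a \<in> V" "b \<in> V" "a \<noteq> b" unfolding edges_on_def by blast
    then have "\<exists>u. u \<in> V \<and> u \<noteq> v \<and> {u, v} \<in> E"
      using e by (metis insert_commute insert_iff singletonD)
    then show ?thesis unfolding nb_def by (rule someI_ex)
  qed
  have deg: "deg (cut E) x = (if x = nb E \<or> x = v then 1 else 2)"
    if E: "E \<in> pc_graphs V 0" and "x \<in> V" for E x
    using deg_remove[OF pc_graphs_finite_edges[OF fin E], of "nb E" v x] nb[OF E]
      pc_graphs_0_deg[OF fin E \<open>x \<in> V\<close>] by (simp add: cut_def)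
  have ends: "{x \<in> V. deg (cut E) x = 1} = {nb E, v}" if E: "E \<in> pc_graphs V 0" for E
  proof (rule set_eqI)
    fix x
    show "x \<in> {x \<in> V. deg (cut E) x = 1} \<longleftrightarrow> x \<in> {nb E, v}"
      using deg[OF E, of x] nb[OF E] v by (cases "x = nb E"; cases "x = v") auto
  qed
  have "inj_on cut (pc_graphs V 0)"
  proof (rule inj_on_inverseI)
    fix E assume E: "E \<in> pc_graphs V 0"
    show "insert {x \<in> V. deg (cut E) x = 1} (cut E) = E"
      unfolding ends[OF E] using nb[OF E] by (auto simp: cut_def)
  qed
  moreover have "cut ` pc_graphs V 0 \<subseteq> {E \<in> pc_graphs V 1. deg E v = 1}"
  proof
    fix E' assume "E' \<in> cut ` pc_graphs V 0"
    then obtain E where E: "E \<in> pc_graphs V 0" "E' = cut E" by auto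
    have "card {x \<in> V. deg E' x = 1} = 2" unfolding E(2) ends[OF E(1)] using nb[OF E(1)] by simp
    moreover have "E' \<subseteq> edges_on V" using pc_graphs_edges[OF E(1)] E(2) by (auto simp: cut_def)
    ultimately show "E' \<in> {E \<in> pc_graphs V 1. deg E v = 1}"
      using deg[OF E(1)] E(2) v by (simp add: pc_graphs_def)
  qed
  ultimately show ?thesis
    by (intro card_inj_on_le[of cut]) (use finite_pc_graphs[OF fin] in auto)
qed

lemma total_weight_one: "total_weight (\<lambda>_. 1) V m = of_nat (card (pc_graphs V m))"
  by (simp add: total_weight_def weight_def)

text \<open>With unit weights, \<open>rooted_weight_closed\<close> counts the graphs with one path,
  ending at v, as (n-1)! times a sum of counts of smaller 2-regular graphs, each divided by a
  factorial. By induction every one of the n-1 terms is at most 1, so the total is at most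
  n!.\<close>

lemma card_pc_graphs_0: "finite V \<Longrightarrow> card (pc_graphs V 0) \<le> fact (card V)"
proof (induction "card V" arbitrary: V rule: less_induct)
  case less
  show ?case
  proof (cases "V = {}")
    case True
    have "pc_graphs {} 0 \<subseteq> {{}}" by (auto simp: pc_graphs_def edges_on_def)
    then have "card (pc_graphs {} 0) \<le> card {{} :: nat set set}" by (intro card_mono) auto
    then show ?thesis using True by simp
  next
    case False
    then obtain v where v: "v \<in> V" by auto
    define n where "n = card V"
    have n: "n > 0" using v less.prems by (auto simp: n_def card_gt_0_iff)
    have real_of_nat: "complex_of_nat a = complex_of_real b \<Longrightarrow> real a = b" for a b
      by (metis of_real_eq_iff of_real_of_nat_eq)
    have om: "omega (\<lambda>_. 1) 0 k = of_real (real (card (pc_graphs {1..k} 0)) / fact k)" for k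
      by (simp add: total_weight_one)
    have "of_nat (card {E \<in> pc_graphs V 1. deg E v = 1}) = rooted_weight (\<lambda>_. 1) (\<lambda>_. 1) V (Suc 0) v"
      by (simp add: rooted_weight_def)
    also have "\<dots> = fact (n - 1) * (\<Sum>j=2..n. 1 * omega (\<lambda>_. 1) 0 (n - j))"
      unfolding n_def by (rule rooted_weight_closed[OF total_weight_omega less.prems v])
    also have "\<dots> = of_real (fact (n - 1) * (\<Sum>j=2..n. real (card (pc_graphs {1..n - j} 0)) / fact (n - j)))"
      unfolding om by simp
    finally have "real (card {E \<in> pc_graphs V 1. deg E v = 1})
      = fact (n - 1) * (\<Sum>j=2..n. real (card (pc_graphs {1..n - j} 0)) / fact (n - j))"
      by (rule real_of_nat)
    also have "\<dots> \<le> fact (n - 1) * (\<Sum>j=2..n. 1)"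
    proof (intro mult_left_mono sum_mono)
      fix j assume "j \<in> {2..n}"
      then have "card (pc_graphs {1..n - j} 0) \<le> fact (card {1..n - j})"
        by (intro less.hyps) (auto simp: n_def)
      then have "real (card (pc_graphs {1..n - j} 0)) \<le> fact (n - j)"
        by (metis card_atLeastAtMost diff_Suc_1 of_nat_fact of_nat_le_iff)
      then show "real (card (pc_graphs {1..n - j} 0)) / fact (n - j) \<le> 1" by simp
    qed simp
    also have "\<dots> \<le> fact (n - 1) * real n" by (intro mult_left_mono) auto
    also have "\<dots> = fact n" using n by (simp add: fact_reduce[of n])
    finally have "card {E \<in> pc_graphs V 1. deg E v = 1} \<le> fact n"
      by (metis of_nat_fact of_nat_le_iff)
    then show ?thesis using card_pc_graphs_0_le_rooted[OF less.prems v] by (simp add: n_def)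
  qed
qed

text \<open>There are at most n! graphs with at most n components each; \<open>Z \<ge> 1\<close>
  allows the number of components to be replaced by n.\<close>

lemma omega_0_bound:
  assumes Z: "Z \<ge> 1" "\<And>j. norm (z j) \<le> Z"
  shows "norm (omega z 0 n) \<le> Z ^ n"
proof -
  have "norm (total_weight z {1..n} 0) \<le> (\<Sum>E\<in>pc_graphs {1..n} 0. Z ^ n)"
    unfolding total_weight_def
  proof (rule sum_norm_le)
    fix E assume "E \<in> pc_graphs {1..n} 0"
    have "card (components {1..n} E) \<le> n"
      unfolding components_eq using card_image_le[of "{1..n}" "component E"] by simp
    then have "Z ^ card (components {1..n} E) \<le> Z ^ n" using Z(1) by (intro power_increasing)
    moreover have "norm (weight z {1..n} E) \<le> (\<Prod>C\<in>components {1..n} E. Z)"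
      unfolding weight_def prod_norm[symmetric] using Z(2) by (intro prod_mono) auto
    ultimately show "norm (weight z {1..n} E) \<le> Z ^ n" by simp
  qed
  also have "\<dots> \<le> fact n * Z ^ n"
  proof -
    have "real (card (pc_graphs {1..n} 0)) \<le> real (fact n)"
      using card_pc_graphs_0[of "{1..n}"] by (simp only: of_nat_le_iff) simp
    then show ?thesis using Z(1) by (simp add: mult_right_mono)
  qed
  finally show ?thesis by (simp add: norm_divide divide_le_eq mult.commute)
qed

lemma tendsto_omega_0:
  assumes "\<And>j. ((\<lambda>m. z m j) \<longlongrightarrow> z' j) F"
  shows "((\<lambda>m. omega (z m) 0 n) \<longlongrightarrow> omega z' 0 n) F"
  unfolding omega.simps total_weight_def weight_def
  by (intro tendsto_divide tendsto_sum tendsto_prod assms tendsto_const) auto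

section \<open>From weights to power series coefficients\<close>

lemma omega_eq_0: "n < 2 * m \<Longrightarrow> omega z m n = 0"
  by (induction m arbitrary: n) (auto intro!: sum.neutral)

text \<open>The shift by the \<open>2 * m\<close> path ends makes k the number of vertices of degree
  2, and the prefactor cancels the divisors of \<open>omega\<close>. What remains is the coefficient
  of degree k in the m-th power of the path series times the cycle series.\<close>

definition path_coeff :: "(nat \<Rightarrow> complex) \<Rightarrow> nat \<Rightarrow> nat \<Rightarrow> complex" where
  "path_coeff z m k = 2 ^ m * fact m * omega z m (2 * m + k)"

lemma path_coeff_0: "path_coeff z 0 k = omega z 0 k"
  by (simp add: path_coeff_def)

lemma path_coeff_Suc: "path_coeff z (Suc m) k = (\<Sum>i\<le>k. z (i + 2) * path_coeff z m (k - i))"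
proof -
  define S where "S = (\<Sum>j=2..2*m+2+k. z j * omega z m (2*m+2+k - j))"
  have "(of_nat (2 * Suc m) :: complex) \<noteq> 0" by (simp only: of_nat_eq_0_iff) simp
  moreover have "(2 ^ Suc m * fact (Suc m) :: complex) = 2 ^ m * fact m * of_nat (2 * Suc m)"
    by (simp add: algebra_simps)
  moreover have "path_coeff z (Suc m) k = 2 ^ Suc m * fact (Suc m) * (S / of_nat (2 * Suc m))"
    by (simp add: path_coeff_def S_def)
  ultimately have "path_coeff z (Suc m) k = 2 ^ m * fact m * S"
    by (simp only: times_divide_eq_right) simp
  then have "path_coeff z (Suc m) k = 2 ^ m * fact m * (\<Sum>j=2..2*m+2+k. z j * omega z m (2*m+2+k - j))"
    by (simp add: S_def)
  \<comment> \<open>For \<open>j > k + 2\<close> fewer than \<open>2 * m\<close> vertices would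
    remain for the other m paths, so these terms vanish.\<close>
  also have "(\<Sum>j=2..2*m+2+k. z j * omega z m (2*m+2+k - j)) = (\<Sum>j=2..k+2. z j * omega z m (2*m+2+k - j))"
    by (intro sum.mono_neutral_right) (auto intro!: omega_eq_0)
  also have "\<dots> = (\<Sum>i\<le>k. z (i + 2) * omega z m (2 * m + (k - i)))"
  proof (rule sum.reindex_bij_witness[of _ "\<lambda>i. i + 2" "\<lambda>j. j - 2"])
    fix j assume j: "j \<in> {2..k + 2}"
    then have "2 * m + 2 + k - j = 2 * m + (k - (j - 2))" "j - 2 + 2 = j" by auto
    then show "z (j - 2 + 2) * omega z m (2 * m + (k - (j - 2))) = z j * omega z m (2*m+2+k - j)"
      by simp
  qed auto
  finally show ?thesis
    by (simp add: path_coeff_def sum_distrib_left mult_ac)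
qed

text \<open>The count of vertices of degree 2 follows from the count of degree 1, because no other
  degree occurs.\<close>

lemma graphs12_eq: "graphs12 (2 * m) n = pc_graphs {1..2 * m + n} m"
proof -
  have key: "card {v \<in> {1..2*m+n}. deg E v = 2} = n"
    if "\<forall>v \<in> {1..2*m+n}. deg E v = 1 \<or> deg E v = 2" "card {v \<in> {1..2*m+n}. deg E v = 1} = 2 * m" for E
  proof -
    define A where "A = {v \<in> {1..2*m+n}. deg E v = 1}"
    define B where "B = {v \<in> {1..2*m+n}. deg E v = 2}"
    have AB: "A \<union> B = {1..2*m+n}" "A \<inter> B = {}" "finite A" "finite B"
      using that(1) by (auto simp: A_def B_def)
    then have "card A + card B = 2 * m + n"
      using card_Un_disjoint[of A B] by simp
    then show ?thesis using that(2) unfolding A_def[symmetric] B_def[symmetric] by simp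
  qed
  show ?thesis
    unfolding graphs12_def pc_graphs_def all_edges_def edges_on_def
    by (intro Collect_cong iffI; elim conjE; intro conjI; (assumption | erule (1) key))
qed

lemma sum_graphs12_weight:
  "(\<Sum>E\<in>graphs12 (2 * m) n. weight z {1..2 * m + n} E)
    = fact (2 * m + n) / (2 ^ m * fact m) * path_coeff z m n"
  using total_weight_omega[of "{1..2 * m + n}" z m]
  by (simp add: total_weight_def graphs12_eq path_coeff_def)

text \<open>Grouping components by size turns a multiplicative weight into an exponential of a
  linear form in the counts \<open>U\<close>; this is how weights produce exponential
  moments.\<close>

lemma weight_exp:
  assumes "finite J" "\<And>j. j \<notin> J \<Longrightarrow> g j = 0"
  shows "weight (\<lambda>j. exp (g j)) {1..n} E = exp (\<Sum>j\<in>J. g j * of_nat (U n j E))"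
proof -
  have fin: "finite (components {1..n} E)" by (simp add: components_eq)
  have "(\<Sum>C\<in>components {1..n} E. g (card C)) = (\<Sum>C\<in>components {1..n} E. \<Sum>j\<in>J. if card C = j then g j else 0)"
    using assms by (intro sum.cong refl) (auto simp: sum.delta)
  also have "\<dots> = (\<Sum>j\<in>J. \<Sum>C\<in>components {1..n} E. if card C = j then g j else 0)" by (rule sum.swap)
  also have "\<dots> = (\<Sum>j\<in>J. g j * of_nat (U n j E))"
    unfolding U_def using fin by (intro sum.cong refl) (simp flip: sum.inter_filter)
  finally show ?thesis using fin by (simp add: weight_def flip: exp_sum)
qed

section \<open>Coefficients as Fourier integrals\<close>

lemma integral_iexp_int:
  "(LINT x:{-pi..pi}|lborel. iexp (of_int k * x)) = (if k = 0 then 2 * pi else 0)"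
proof (cases "k = 0")
  case True
  then show ?thesis by (simp add: set_lebesgue_integral_def scaleR_conv_of_real)
next
  case False
  define F where "F x = - (\<i> / of_int k) * iexp (of_int k * x)" for x :: real
  have "(LINT x:{-pi..pi}|lborel. iexp (of_int k * x)) = F pi - F (-pi)"
    unfolding set_lebesgue_integral_def
  proof (rule integral_FTC_atLeastAtMost)
    fix x :: real
    have "((\<lambda>x. iexp (of_int k * x)) has_vector_derivative of_int k *\<^sub>R (\<i> * iexp (of_int k * x))) (at x within {-pi..pi})"
      by (rule vector_diff_chain_within[of "\<lambda>x. of_int k * x" "of_int k" x "{-pi..pi}" "iexp", unfolded o_def])
         (auto intro!: derivative_eq_intros simp: has_vector_derivative_iexp)
    then have "(F has_vector_derivative - (\<i> / of_int k) * (of_int k *\<^sub>R (\<i> * iexp (of_int k * x)))) (at x within {-pi..pi})"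
      unfolding F_def by (rule has_vector_derivative_mult_right)
    then show "(F has_vector_derivative iexp (of_int k * x)) (at x within {-pi..pi})"
      using False by (simp add: scaleR_conv_of_real algebra_simps)
  qed (auto intro!: continuous_intros)
  moreover have "iexp (of_int k * pi) = iexp (of_int k * - pi)"
  proof -
    have "\<i> * complex_of_real (of_int k * pi) = \<i> * complex_of_real (of_int k * - pi) + 2 * of_int k * of_real pi * \<i>"
      by (simp add: algebra_simps)
    then show ?thesis unfolding exp_eq by (intro exI[of _ k]) simp
  qed
  ultimately show ?thesis using False by (simp add: F_def)
qed

text \<open>Absolute summability permits integration term by term, and orthogonality of the
  exponentials leaves a single term.\<close>

lemma set_integral_fourier_coeff:
  fixes b :: "nat \<Rightarrow> complex"
  assumes b: "summable (\<lambda>k. norm (b k))"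
  shows "(LINT x:{-pi..pi}|lborel. (\<Sum>k. b k * iexp (real k * x)) * iexp (- real n * x)) = 2 * pi * b n"
proof -
  define f where "f k x = indicator {-pi..pi} x *\<^sub>R (b k * iexp (of_int (int k - int n) * x))" for k x
  have e: "iexp (real k * x) * iexp (- real n * x) = iexp (of_int (int k - int n) * x)" for k x
    by (simp add: exp_add[symmetric] algebra_simps)
  have bs: "summable (\<lambda>k. b k * iexp (real k * x))" for x
    by (rule summable_norm_cancel) (use b in \<open>simp add: norm_mult\<close>)
  have int: "integrable lborel (f k)" for k
    unfolding f_def set_integrable_def[symmetric]
    by (intro borel_integrable_atLeastAtMost' continuous_intros)
  have nf: "norm (f k x) = indicator {-pi..pi} x * norm (b k)" for k x
    by (simp add: f_def norm_mult)
  have "(LINT x:{-pi..pi}|lborel. (\<Sum>k. b k * iexp (real k * x)) * iexp (- real n * x)) = (LINT x|lborel. (\<Sum>k. f k x))"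
    unfolding set_lebesgue_integral_def
  proof (rule Bochner_Integration.integral_cong[OF refl])
    fix x
    have "(\<Sum>k. b k * iexp (real k * x)) * iexp (- real n * x) = (\<Sum>k. b k * iexp (real k * x) * iexp (- real n * x))"
      by (rule suminf_mult2[OF bs])
    also have "\<dots> = (\<Sum>k. b k * iexp (of_int (int k - int n) * x))"
      unfolding mult.assoc e ..
    finally have "indicator {-pi..pi} x *\<^sub>R ((\<Sum>k. b k * iexp (real k * x)) * iexp (- real n * x)) = indicator {-pi..pi} x *\<^sub>R (\<Sum>k. b k * iexp (of_int (int k - int n) * x))"
      by simp
    also have "\<dots> = (\<Sum>k. f k x)"
      unfolding f_def by (rule suminf_scaleR_right, rule summable_norm_cancel) (use b in \<open>simp add: norm_mult\<close>)
    finally show "indicator {-pi..pi} x *\<^sub>R ((\<Sum>k. b k * iexp (real k * x)) * iexp (- real n * x)) = (\<Sum>k. f k x)" .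
  qed
  also have "\<dots> = (\<Sum>k. LINT x|lborel. f k x)"
  proof (rule integral_suminf[OF int])
    show "AE x in lborel. summable (\<lambda>k. norm (f k x))"
      unfolding nf using b by (intro always_eventually allI summable_mult)
    have "(LINT x|lborel. norm (f k x)) = 2 * pi * norm (b k)" for k
      unfolding nf by simp
    then show "summable (\<lambda>k. LINT x|lborel. norm (f k x))"
      using b by (simp add: summable_mult)
  qed
  also have "\<dots> = (\<Sum>k. if k = n then 2 * pi * b k else 0)"
  proof (rule arg_cong[where f = suminf], rule ext)
    fix k
    have "(LINT x|lborel. f k x) = (LINT x:{-pi..pi}|lborel. b k * iexp (of_int (int k - int n) * x))"
      unfolding f_def set_lebesgue_integral_def by simp
    also have "\<dots> = b k * (if int k - int n = 0 then 2 * pi else 0)"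
      unfolding integral_iexp_int[symmetric] by (rule set_integral_mult_right)
    finally show "(LINT x|lborel. f k x) = (if k = n then 2 * pi * b k else 0)" by auto
  qed
  also have "\<dots> = 2 * pi * b n"
    using sums_single[of n "\<lambda>k. 2 * pi * b k"] by (simp add: sums_iff)
  finally show ?thesis .
qed

text \<open>Iterated Cauchy product: the coefficients of the m-th power of the series of
  \<open>a\<close> times the series of \<open>c\<close>.\<close>

primrec conv_pow :: "(nat \<Rightarrow> complex) \<Rightarrow> (nat \<Rightarrow> complex) \<Rightarrow> nat \<Rightarrow> nat \<Rightarrow> complex" where
  "conv_pow a c 0 = c"
| "conv_pow a c (Suc m) = (\<lambda>k. \<Sum>i\<le>k. a i * conv_pow a c m (k - i))"

lemma summable_conv_pow:
  assumes "summable (\<lambda>k. norm (a k))" "summable (\<lambda>k. norm (c k))"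
  shows "summable (\<lambda>k. norm (conv_pow a c m k))"
proof (induction m)
  case (Suc m)
  have "summable (\<lambda>k. \<Sum>i\<le>k. norm (a i) * norm (conv_pow a c m (k - i)))"
    using assms(1) Suc by (intro sums_summable[OF Cauchy_product_sums]) auto
  moreover have "norm (norm (conv_pow a c (Suc m) k)) \<le> (\<Sum>i\<le>k. norm (a i) * norm (conv_pow a c m (k - i)))" for k
    using norm_sum[of "\<lambda>i. a i * conv_pow a c m (k - i)" "{..k}"] by (simp add: norm_mult)
  ultimately show ?case by (rule summable_comparison_test'[of _ 0])
qed (use assms in simp)

lemma suminf_conv_pow:
  assumes a: "summable (\<lambda>k. norm (a k))" and c: "summable (\<lambda>k. norm (c k))"
  shows "(\<Sum>k. conv_pow a c m k * iexp (real k * x))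
    = (\<Sum>k. a k * iexp (real k * x)) ^ m * (\<Sum>k. c k * iexp (real k * x))"
proof (induction m)
  case (Suc m)
  have "(\<Sum>i\<le>k. (a i * iexp (real i * x)) * (conv_pow a c m (k - i) * iexp (real (k - i) * x)))
    = conv_pow a c (Suc m) k * iexp (real k * x)" for k
  proof -
    have "(a i * iexp (real i * x)) * (conv_pow a c m (k - i) * iexp (real (k - i) * x))
      = a i * conv_pow a c m (k - i) * iexp (real k * x)" if "i \<le> k" for i
    proof -
      have "iexp (real i * x) * iexp (real (k - i) * x) = iexp (real k * x)"
        using that by (simp add: exp_add[symmetric] of_nat_diff algebra_simps)
      then show ?thesis by (simp add: mult_ac)
    qed
    then show ?thesis unfolding conv_pow.simps sum_distrib_right by (intro sum.cong) auto
  qed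
  moreover have "(\<Sum>k. a k * iexp (real k * x)) * (\<Sum>k. conv_pow a c m k * iexp (real k * x))
    = (\<Sum>k. \<Sum>i\<le>k. (a i * iexp (real i * x)) * (conv_pow a c m (k - i) * iexp (real (k - i) * x)))"
    by (rule Cauchy_product) (use a summable_conv_pow[OF a c] in \<open>simp_all add: norm_mult\<close>)
  ultimately show ?case using Suc by (simp add: mult_ac)
qed simp

lemma set_integral_conv_pow:
  assumes "summable (\<lambda>k. norm (a k))" "summable (\<lambda>k. norm (c k))"
  shows "(LINT x:{-pi..pi}|lborel. (\<Sum>k. a k * iexp (real k * x)) ^ m * (\<Sum>k. c k * iexp (real k * x)) * iexp (- real n * x))
    = 2 * pi * conv_pow a c m n"
  using set_integral_fourier_coeff[OF summable_conv_pow[OF assms, of m], of n]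
  unfolding suminf_conv_pow[OF assms] .

text \<open>Rescaling commutes with Cauchy products: each of the m path factors contributes one
  \<beta>, and the powers of \<rho> add up to the degree.\<close>

lemma conv_pow_path_coeff:
  assumes "\<And>k. a k = \<beta> * \<rho> ^ k * z (k + 2)" "\<And>k. c k = \<rho> ^ k * omega z 0 k"
  shows "conv_pow a c m k = \<beta> ^ m * \<rho> ^ k * path_coeff z m k"
proof (induction m arbitrary: k)
  case (Suc m)
  have "a i * conv_pow a c m (k - i) = \<beta> ^ Suc m * \<rho> ^ k * (z (i + 2) * path_coeff z m (k - i))"
    if "i \<le> k" for i
  proof -
    have "\<rho> ^ k = \<rho> ^ i * \<rho> ^ (k - i)" using that by (simp flip: power_add)
    then show ?thesis by (simp add: Suc assms(1) mult_ac)
  qed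
  then show ?case by (simp add: path_coeff_Suc sum_distrib_left)
qed (simp add: assms(2) path_coeff_0)

section \<open>Moments of the geometric distribution\<close>

text \<open>One more factor k is dominated by the formal derivative of the preceding series, which
  has the same domain of convergence.\<close>

lemma summable_power_mult_geometric:
  fixes x :: real
  assumes "norm x < 1"
  shows "summable (\<lambda>k. real k ^ p * x ^ k)"
  using assms
proof (induction p arbitrary: x)
  case (Suc p)
  have "norm \<bar>x\<bar> < 1" using Suc.prems by simp
  then have "summable (\<lambda>k. diffs (\<lambda>k. real k ^ p) k * \<bar>x\<bar> ^ k)"
    by (rule termdiff_converges) (rule Suc.IH)
  moreover have "norm (real k ^ Suc p * x ^ k) \<le> diffs (\<lambda>k. real k ^ p) k * \<bar>x\<bar> ^ k" for k
  proof -
    have "real k ^ Suc p \<le> real (Suc k) ^ Suc p" by (intro power_mono) auto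
    then show ?thesis
      by (simp add: diffs_def abs_mult power_abs mult_right_mono)
  qed
  ultimately show ?case by (rule summable_comparison_test'[of _ 0])
qed (simp add: summable_geometric)

text \<open>Shifting the summation index gives a linear equation for each moment in terms of the
  lower ones.\<close>

lemma geometric_moments:
  fixes r :: real
  assumes "0 < r" "r < 1"
  shows "(\<lambda>k. (1 - r) * r ^ k) sums 1"
    and "(\<lambda>k. (1 - r) * r ^ k * real k) sums (r / (1 - r))"
    and "(\<lambda>k. (1 - r) * r ^ k * (real k)\<^sup>2) sums (r * (1 + r) / (1 - r)\<^sup>2)"
proof -
  have s: "summable (\<lambda>k. real k ^ p * r ^ k)" for p
    using summable_power_mult_geometric assms by simp
  define S where "S p = (\<Sum>k. real k ^ p * r ^ k)" for p
  have S0: "S 0 = 1 / (1 - r)" using assms by (simp add: S_def suminf_geometric)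
  have shift: "S p = (\<Sum>k. real (Suc k) ^ p * r ^ Suc k)" if "p > 0" for p
    using suminf_split_head[OF s[of p]] that by (simp add: S_def)
  have "S 1 = (\<Sum>k. r * (real k ^ 1 * r ^ k) + r * (real k ^ 0 * r ^ k))"
    by (subst shift) (simp_all add: algebra_simps)
  also have "\<dots> = r * S 1 + r * S 0"
    unfolding S_def using s[of 1] s[of 0] by (simp add: suminf_add[symmetric] suminf_mult summable_mult)
  finally have "(1 - r) * S 1 = r * S 0" by (simp add: algebra_simps)
  then have "(1 - r) * ((1 - r) * S 1) = r" using assms unfolding S0 by simp
  then have "(1 - r)\<^sup>2 * S 1 = r" by (simp only: power2_eq_square mult.assoc)
  then have S1: "S 1 = r / (1 - r)\<^sup>2" using assms by (simp add: field_simps)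
  have "S 2 = (\<Sum>k. r * (real k ^ 2 * r ^ k) + (2 * r * (real k ^ 1 * r ^ k) + r * (real k ^ 0 * r ^ k)))"
    by (subst shift) (simp_all add: algebra_simps power2_eq_square)
  also have "\<dots> = r * S 2 + (2 * r * S 1 + r * S 0)"
    unfolding S_def using s[of 2] s[of 1] s[of 0]
    by (simp add: suminf_add[symmetric] suminf_mult summable_mult summable_add)
  finally have e: "(1 - r) * S 2 = 2 * r * S 1 + r * S 0" by (simp add: algebra_simps)
  have "(1 - r) * S 2 * (1 - r)\<^sup>2 = 2 * r * ((1 - r)\<^sup>2 * S 1) + r * (1 - r) * ((1 - r) * S 0)"
    unfolding e by (simp add: algebra_simps power2_eq_square)
  also have "\<dots> = r * (1 + r)"
    using assms unfolding S1 S0 by (simp add: algebra_simps)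
  finally have "(1 - r) * S 2 * (1 - r)\<^sup>2 = r * (1 + r)" .
  then have S2: "(1 - r) * S 2 = r * (1 + r) / (1 - r)\<^sup>2" using assms by (simp add: field_simps)
  show "(\<lambda>k. (1 - r) * r ^ k) sums 1"
    using sums_mult[OF summable_sums[OF s[of 0]], of "1 - r"] S0 assms by (simp add: S_def)
  show "(\<lambda>k. (1 - r) * r ^ k * real k) sums (r / (1 - r))"
    using sums_mult[OF summable_sums[OF s[of 1]], of "1 - r"] S1 assms
    by (simp add: S_def mult_ac power2_eq_square)
  show "(\<lambda>k. (1 - r) * r ^ k * (real k)\<^sup>2) sums (r * (1 + r) / (1 - r)\<^sup>2)"
    using sums_mult[OF summable_sums[OF s[of 2]], of "1 - r"] S2 by (simp add: S_def mult_ac)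
qed

section \<open>Exponentially tilted path lengths\<close>

text \<open>For negative x, the product of 1 + x + x^2 and 1 - x is 1 - x^3, hence at least 1, and 1
  - x is at most exp (-x). The linear term has to be exact so that centring can cancel it
  later.\<close>

lemma exp_le_quadratic:
  fixes x :: real
  assumes "x \<le> 1"
  shows "exp x \<le> 1 + x + x\<^sup>2"
proof (cases "0 \<le> x")
  case True
  then show ?thesis using exp_bound[of x] assms by simp
next
  case False
  have "1 \<le> (1 + x + x\<^sup>2) * (1 - x)"
  proof -
    have "x * x\<^sup>2 \<le> 0" using False by (intro mult_nonpos_nonneg) auto
    then show ?thesis by (simp add: algebra_simps power2_eq_square)
  qed
  also have "\<dots> \<le> (1 + x + x\<^sup>2) * exp (- x)"
  proof (rule mult_left_mono)
    show "1 - x \<le> exp (- x)" using exp_ge_add_one_self[of "-x"] by simp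
    have "0 \<le> 3 / 4 + (x + 1/2)\<^sup>2" by simp
    also have "\<dots> = 1 + x + x\<^sup>2" by (simp add: power2_eq_square algebra_simps)
    finally show "0 \<le> 1 + x + x\<^sup>2" .
  qed
  finally have "1 * exp x \<le> (1 + x + x\<^sup>2) * exp (- x) * exp x" by (intro mult_right_mono) auto
  then show ?thesis by (simp add: mult.assoc flip: exp_add)
qed

text \<open>The Maclaurin expansion to fourth order and x^2 <= 10 on the interval give 1/2 - 10/24 =
  1/12.\<close>

lemma one_minus_cos_ge:
  fixes x :: real
  assumes "\<bar>x\<bar> \<le> pi"
  shows "x\<^sup>2 / 12 \<le> 1 - cos x"
proof -
  obtain t where t: "cos x = (\<Sum>m<4. cos_coeff m * x ^ m) + (cos (t + 1/2 * real 4 * pi) / fact 4) * x ^ 4"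
    using Maclaurin_cos_expansion[of x 4] by auto
  have "{..<4::nat} = {0, 1, 2, 3}" by auto
  then have "(\<Sum>m<4. cos_coeff m * x ^ m) = 1 - x\<^sup>2 / 2"
    by (simp add: cos_coeff_def fact_numeral)
  moreover have "(cos (t + 1/2 * real 4 * pi) / fact 4) * x ^ 4 \<le> 1 / 24 * x ^ 4"
    by (intro mult_right_mono) (auto simp: fact_numeral)
  ultimately have "cos x \<le> 1 - x\<^sup>2 / 2 + x ^ 4 / 24" using t by simp
  moreover have "x ^ 4 \<le> 10 * x\<^sup>2"
  proof -
    have "\<bar>x\<bar> ^ 2 \<le> 3.15 ^ 2" using assms pi_approx by (intro power_mono) auto
    then have "x\<^sup>2 \<le> 10" by (simp add: power2_eq_square)
    then have "x\<^sup>2 * x\<^sup>2 \<le> 10 * x\<^sup>2" by (intro mult_right_mono) auto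
    then show ?thesis by (simp add: power2_eq_square power4_eq_xxxx mult.assoc)
  qed
  ultimately show ?thesis by simp
qed

text \<open>The squared modulus is (1 + r)^2 - 2 r (1 - cos x). Completing the square with 1 + r <=
  2 halves the constant 1/12 to 1/24. The right-hand side must be nonnegative before the square root
  is taken.\<close>

lemma norm_one_plus_iexp_le:
  assumes "0 < r" "r < 1" "\<bar>x\<bar> \<le> pi"
  shows "norm (1 + complex_of_real r * iexp x) \<le> 1 + r - r / 24 * x\<^sup>2"
proof (rule power2_le_imp_le)
  have "(norm (1 + complex_of_real r * iexp x))\<^sup>2 = (1 + r * cos x)\<^sup>2 + (r * sin x)\<^sup>2"
    by (simp add: cmod_power2 Re_exp Im_exp)
  also have "\<dots> = 1 + 2 * r * cos x + r\<^sup>2 * ((sin x)\<^sup>2 + (cos x)\<^sup>2)"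
    by (simp add: power2_eq_square algebra_simps del: sin_cos_squared_add sin_cos_squared_add2 sin_cos_squared_add3)
  also have "\<dots> = (1 + r)\<^sup>2 - 2 * r * (1 - cos x)"
    by (simp only: sin_cos_squared_add) (simp add: power2_eq_square algebra_simps)
  also have "\<dots> \<le> (1 + r)\<^sup>2 - 2 * r * (x\<^sup>2 / 12)"
    using one_minus_cos_ge[OF assms(3)] assms by simp
  also have "\<dots> \<le> (1 + r)\<^sup>2 - 2 * (1 + r) * (r / 24 * x\<^sup>2)"
  proof -
    have "r * x\<^sup>2 * r \<le> r * x\<^sup>2 * 1" using assms by (intro mult_left_mono) auto
    then show ?thesis by (simp add: algebra_simps)
  qed
  also have "\<dots> \<le> (1 + r - r / 24 * x\<^sup>2)\<^sup>2"
    unfolding power2_diff[of "1 + r" "r / 24 * x\<^sup>2"] by simp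
  finally show "(norm (1 + complex_of_real r * iexp x))\<^sup>2 \<le> (1 + r - r / 24 * x\<^sup>2)\<^sup>2" .
  have "\<bar>x\<bar> ^ 2 \<le> 3.15 ^ 2" using assms pi_approx by (intro power_mono) auto
  then have "x\<^sup>2 \<le> 10" by (simp add: power2_eq_square)
  then have "r * x\<^sup>2 \<le> 1 * 10" using assms by (intro mult_mono) auto
  then show "0 \<le> 1 + r - r / 24 * x\<^sup>2" using assms by simp
qed

lemma norm_iexp_minus_linear: "norm (iexp x - 1 - \<i> * x) \<le> x\<^sup>2 / 2"
  using iexp_approx1[of x 1] by (simp add: algebra_simps power2_eq_square)

lemma norm_iexp_minus_quadratic: "norm (iexp x - 1 - \<i> * x + x\<^sup>2 / 2) \<le> \<bar>x\<bar> ^ 3 / 6"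
proof -
  have "(\<Sum>k\<le>2. (\<i> * x) ^ k / fact k) = 1 + \<i> * x - x\<^sup>2 / 2"
    by (simp add: numeral_2_eq_2 power_mult_distrib)
  moreover have "fact (Suc 2) = (6 :: real)" "Suc 2 = 3" by (simp_all add: fact_numeral)
  ultimately have "norm (iexp x - (1 + \<i> * x - x\<^sup>2 / 2)) \<le> \<bar>x\<bar> ^ 3 / 6"
    using iexp_approx1[of x 2] by metis
  moreover have "iexp x - (1 + \<i> * x - x\<^sup>2 / 2) = iexp x - 1 - \<i> * x + x\<^sup>2 / 2" by simp
  ultimately show ?thesis by metis
qed

text \<open>The number of interior vertices of a path is modelled by a geometric variable of mean
  \<open>\<alpha>\<close>; \<open>\<tau> k\<close> is the exponential tilt of paths with \<open>k\<close> interior vertices, scaled by \<open>1 / sqrt m\<close>.\<close>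
locale tilted_paths =
  fixes \<alpha> :: real and K :: nat and \<tau> :: "nat \<Rightarrow> complex"
  assumes \<alpha>: "\<alpha> > 0" and \<tau>: "\<And>k. k \<ge> K \<Longrightarrow> \<tau> k = 0"
begin

definition r where "r = \<alpha> / (1 + \<alpha>)"
definition w where "w k = (1 - r) * r ^ k" for k :: nat
definition mean_tilt where "mean_tilt = (\<Sum>k<K. of_real (w k) * \<tau> k)"
text \<open>Centred under \<open>w\<close>: otherwise the series would deviate from 1 by order 1 /
  sqrt m and its m-th power need not stay bounded.\<close>

definition y where "y k = \<tau> k - mean_tilt" for k
text \<open>The value 1 below 2 is a placeholder that avoids the truncated \<open>j - 2\<close>;
  every component here has at least two vertices.\<close>

definition z where "z m j = (if j < 2 then 1 else exp (\<tau> (j - 2) / of_real (sqrt (real m))))" for m j :: nat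
definition a where "a m k = of_real (w k) * exp (y k / of_real (sqrt (real m)))" for m k :: nat
definition c where "c m k = of_real r ^ k * omega (z m) 0 k" for m k :: nat
definition A where "A m x = (\<Sum>k. a m k * iexp (real k * x))" for m x
definition C where "C m x = (\<Sum>k. c m k * iexp (real k * x))" for m x

lemma r: "0 < r" "r < 1"
  using \<alpha> by (auto simp: r_def)

lemma one_minus_r: "1 - r = 1 / (1 + \<alpha>)"
  using \<alpha> by (simp add: r_def field_simps)

lemma w_pos: "w k > 0"
  using r by (simp add: w_def)

lemma w_sums: "w sums 1" "(\<lambda>k. w k * real k) sums \<alpha>" "(\<lambda>k. w k * (real k)\<^sup>2) sums (\<alpha> * (1 + \<alpha>) + \<alpha>\<^sup>2)"
proof -
  have "r / (1 - r) = \<alpha>" using \<alpha> unfolding one_minus_r by (simp add: r_def)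
  moreover have "r * (1 + r) / (1 - r)\<^sup>2 = \<alpha> * (1 + \<alpha>) + \<alpha>\<^sup>2"
  proof -
    have "r * (1 + r) / (1 - r)\<^sup>2 = (r * (1 + \<alpha>)) * ((1 + r) * (1 + \<alpha>))"
      unfolding one_minus_r by (simp add: power2_eq_square field_simps)
    also have "r * (1 + \<alpha>) = \<alpha>" using \<alpha> by (simp add: r_def)
    also have "(1 + r) * (1 + \<alpha>) = 1 + 2 * \<alpha>" using \<alpha> by (simp add: r_def field_simps)
    finally show ?thesis by (simp add: algebra_simps power2_eq_square)
  qed
  ultimately show "w sums 1" "(\<lambda>k. w k * real k) sums \<alpha>" "(\<lambda>k. w k * (real k)\<^sup>2) sums (\<alpha> * (1 + \<alpha>) + \<alpha>\<^sup>2)"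
    using geometric_moments[OF r] by (simp_all add: w_def[abs_def])
qed

lemma y_sums: "(\<lambda>k. of_real (w k) * y k) sums 0"
proof -
  have "(\<lambda>k. of_real (w k) * \<tau> k) sums mean_tilt"
    unfolding mean_tilt_def by (rule sums_finite) (use \<tau> in auto)
  moreover have "(\<lambda>k. of_real (w k) * mean_tilt) sums (of_real 1 * mean_tilt)"
    by (intro sums_mult2 sums_of_real w_sums)
  ultimately have "(\<lambda>k. of_real (w k) * \<tau> k - of_real (w k) * mean_tilt) sums (mean_tilt - of_real 1 * mean_tilt)"
    by (rule sums_diff)
  then show ?thesis by (simp add: y_def algebra_simps)
qed

lemma tilt_bounded: "\<exists>T>0. (\<forall>k. norm (\<tau> k) \<le> T) \<and> (\<forall>k. norm (y k) \<le> T)"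
proof (intro exI conjI allI)
  let ?T = "1 + (\<Sum>k<K. norm (\<tau> k)) + norm mean_tilt"
  have n: "0 \<le> (\<Sum>k<K. norm (\<tau> k))" by (intro sum_nonneg) auto
  then show "?T > 0" by (simp add: add_pos_nonneg)
  have 1: "norm (\<tau> k) \<le> (\<Sum>k<K. norm (\<tau> k))" for k
  proof (cases "k < K")
    case True
    then show ?thesis by (intro member_le_sum) auto
  qed (use \<tau> n in auto)
  have 2: "0 \<le> norm mean_tilt" by simp
  show "norm (\<tau> k) \<le> ?T" for k using 1[of k] 2 by linarith
  show "norm (y k) \<le> ?T" for k
    using 1[of k] norm_triangle_ineq4[of "\<tau> k" mean_tilt] unfolding y_def by linarith
qed

lemma norm_a: "norm (a m k) = w k * exp (Re (y k) / sqrt (real m))"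
  using w_pos[of k] by (simp add: a_def norm_mult Re_divide_of_real)

lemma summable_norm_a: "summable (\<lambda>k. norm (a m k))"
proof -
  obtain T where T: "T > 0" "\<And>k. norm (\<tau> k) \<le> T" "\<And>k. norm (y k) \<le> T" using tilt_bounded by auto
  have le: "norm (a m k) \<le> w k * exp (T / sqrt (real m))" for k
    unfolding norm_a using w_pos[of k] T(3)[of k] complex_Re_le_cmod[of "y k"]
    by (intro mult_left_mono) (auto intro!: divide_right_mono)
  have "summable (\<lambda>k. w k * exp (T / sqrt (real m)))"
    by (rule summable_mult2[OF sums_summable[OF w_sums(1)]])
  then show ?thesis by (rule summable_comparison_test'[of _ 0]) (use le in simp)
qed

text \<open>Centring removes the first-order term from the sum of the moduli, leaving an excess of
  order 1 / m. The decay in x comes from the adjacent indices \<open>K\<close> and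
  \<open>Suc K\<close>: both have zero tilt, so their terms are in ratio r times a phase and partly
  cancel. Every other term is bounded by its modulus.\<close>

lemma norm_A_le:
  "\<exists>B \<kappa> M. \<kappa> > 0 \<and> (\<forall>m\<ge>M. \<forall>x. \<bar>x\<bar> \<le> pi \<longrightarrow> norm (A m x) \<le> exp (B / real m - \<kappa> * x\<^sup>2))"
proof -
  obtain T where T: "T > 0" "\<And>k. norm (\<tau> k) \<le> T" "\<And>k. norm (y k) \<le> T" using tilt_bounded by auto
  \<comment> \<open>\<open>w K * exp (- 1)\<close> bounds the modulus of the term at
    \<open>K\<close> from below once the scaled tilt is at least -1; \<open>r / 24\<close> comes
    from \<open>norm_one_plus_iexp_le\<close>.\<close>
  define \<kappa> where "\<kappa> = w K * exp (- 1) * (r / 24)"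
  \<comment> \<open>Makes T at most sqrt m, so that the scaled tilts \<open>u\<close> lie in the
    range of \<open>exp_le_quadratic\<close>, and m positive.\<close>
  define M where "M = nat \<lceil>T\<^sup>2\<rceil> + 1"
  show ?thesis
  proof (intro exI conjI allI impI)
    show "\<kappa> > 0" using w_pos r by (simp add: \<kappa>_def)
    fix m x assume m: "m \<ge> M" and x: "\<bar>x :: real\<bar> \<le> pi"
    have mp: "real m > 0" using m by (simp add: M_def)
    have "T\<^sup>2 \<le> real m" using m unfolding M_def by linarith
    then have Tm: "T \<le> sqrt (real m)" using T(1) real_le_rsqrt by blast
    define u where "u k = Re (y k) / sqrt (real m)" for k
    have u1: "\<bar>u k\<bar> \<le> 1" for k
    proof -
      have "\<bar>Re (y k)\<bar> \<le> sqrt (real m)"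
        using abs_Re_le_cmod[of "y k"] T(3)[of k] Tm by linarith
      then show ?thesis using mp by (simp add: u_def abs_divide)
    qed
    have u2: "(u k)\<^sup>2 \<le> T\<^sup>2 / real m" for k
    proof -
      have "(Re (y k))\<^sup>2 \<le> T\<^sup>2"
        using abs_Re_le_cmod[of "y k"] T(3)[of k] by (intro power2_le_iff_abs_le[THEN iffD2]) (use T(1) in auto)
      then show ?thesis using mp by (simp add: u_def power_divide divide_right_mono)
    qed
    have "(\<lambda>k. Re (of_real (w k) * y k)) sums Re 0"
      by (intro sums_Re y_sums)
    then have us: "(\<lambda>k. w k * u k) sums 0"
      using sums_divide[of "\<lambda>k. w k * Re (y k)" 0 "sqrt (real m)"] by (simp add: u_def)
    have sA: "(\<Sum>k. norm (a m k)) \<le> 1 + T\<^sup>2 / real m"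
    proof -
      have "norm (a m k) \<le> w k + w k * u k + w k * (T\<^sup>2 / real m)" for k
      proof -
        have "exp (u k) \<le> 1 + u k + T\<^sup>2 / real m"
          using exp_le_quadratic[of "u k"] u1[of k] u2[of k] by linarith
        then have "w k * exp (u k) \<le> w k * (1 + u k + T\<^sup>2 / real m)"
          using w_pos[of k] by (intro mult_left_mono) auto
        then show ?thesis by (simp add: norm_a u_def algebra_simps)
      qed
      moreover have "(\<lambda>k. w k + w k * u k + w k * (T\<^sup>2 / real m)) sums (1 + 0 + 1 * (T\<^sup>2 / real m))"
        by (intro sums_add w_sums us sums_mult2)
      ultimately have "(\<Sum>k. norm (a m k)) \<le> 1 + 0 + 1 * (T\<^sup>2 / real m)"
        by (rule sums_le[OF _ summable_sums[OF summable_norm_a]])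
      then show ?thesis by simp
    qed
    define f where "f k = a m k * iexp (real k * x)" for k
    have nf: "norm (f k) = norm (a m k)" for k by (simp add: f_def norm_mult)
    have sf: "summable (\<lambda>k. norm (f k))" using summable_norm_a nf by simp
    define S where "S = {K, Suc K}"
    have S: "(\<lambda>k. if k \<in> S then f k else 0) sums (\<Sum>k\<in>S. f k)"
      "(\<lambda>k. if k \<in> S then norm (f k) else 0) sums (\<Sum>k\<in>S. norm (f k))"
      by (rule sums_If_finite_set; simp add: S_def)+
    define g where "g k = (if k \<in> S then 0 else f k)" for k
    have "(\<lambda>k. f k - (if k \<in> S then f k else 0)) sums (A m x - (\<Sum>k\<in>S. f k))"
      using summable_sums[OF summable_norm_cancel[OF sf]] S(1)
      by (intro sums_diff) (simp_all add: A_def f_def)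
    then have g1: "g sums (A m x - (\<Sum>k\<in>S. f k))"
      by (rule back_subst[where P = "\<lambda>h. h sums _"]) (auto simp: g_def)
    have "(\<lambda>k. norm (f k) - (if k \<in> S then norm (f k) else 0)) sums ((\<Sum>k. norm (a m k)) - (\<Sum>k\<in>S. norm (f k)))"
      using summable_sums[OF sf] S(2) by (intro sums_diff) (simp_all add: nf)
    then have g2: "(\<lambda>k. norm (g k)) sums ((\<Sum>k. norm (a m k)) - (\<Sum>k\<in>S. norm (f k)))"
      by (rule back_subst[where P = "\<lambda>h. h sums _"]) (auto simp: g_def)
    have "norm (A m x - (\<Sum>k\<in>S. f k)) \<le> (\<Sum>k. norm (a m k)) - (\<Sum>k\<in>S. norm (f k))"
      using summable_norm[of g] g1 g2 by (simp add: sums_iff)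
    moreover have "norm (A m x) \<le> norm (A m x - (\<Sum>k\<in>S. f k)) + norm (\<Sum>k\<in>S. f k)"
      using norm_triangle_ineq[of "A m x - (\<Sum>k\<in>S. f k)" "\<Sum>k\<in>S. f k"] by simp
    ultimately have n1: "norm (A m x) \<le> 1 + T\<^sup>2 / real m - (\<Sum>k\<in>S. norm (f k)) + norm (\<Sum>k\<in>S. f k)"
      using sA by linarith
    \<comment> \<open>From index \<open>K\<close> on, \<open>y\<close> is the constant
      \<open>- mean_tilt\<close>, so consecutive coefficients differ only by the geometric
      ratio.\<close>
    have aK: "a m (Suc K) = of_real r * a m K"
      by (simp add: a_def w_def y_def \<tau>)
    have "f (Suc K) = f K * (of_real r * iexp x)"
      unfolding f_def aK by (simp add: algebra_simps exp_add)
    then have sum1: "(\<Sum>k\<in>S. f k) = f K * (1 + of_real r * iexp x)"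
      and sum2: "(\<Sum>k\<in>S. norm (f k)) = norm (f K) * (1 + r)"
      using r by (simp_all add: S_def algebra_simps norm_mult)
    have "norm (\<Sum>k\<in>S. f k) \<le> norm (f K) * (1 + r - r / 24 * x\<^sup>2)"
      unfolding sum1 norm_mult by (intro mult_left_mono norm_one_plus_iexp_le r x) auto
    then have n2: "norm (A m x) \<le> 1 + T\<^sup>2 / real m - norm (f K) * (r / 24 * x\<^sup>2)"
      using n1 unfolding sum2 by (simp add: algebra_simps)
    have "w K * exp (- 1) \<le> norm (f K)"
    proof -
      have "- 1 \<le> u K" using u1[of K] by linarith
      then show ?thesis unfolding nf norm_a u_def[symmetric] using w_pos[of K] by simp
    qed
    then have "w K * exp (- 1) * (r / 24 * x\<^sup>2) \<le> norm (f K) * (r / 24 * x\<^sup>2)"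
      using r by (intro mult_right_mono) auto
    then have "norm (A m x) \<le> 1 + (T\<^sup>2 / real m - \<kappa> * x\<^sup>2)"
      using n2 by (simp add: \<kappa>_def)
    also have "\<dots> \<le> exp (T\<^sup>2 / real m - \<kappa> * x\<^sup>2)" by (rule exp_ge_add_one_self)
    finally show "norm (A m x) \<le> exp (T\<^sup>2 / real m - \<kappa> * x\<^sup>2)" .
  qed
qed

text \<open>The tilt per component tends to 1, whereas r is strictly below the guaranteed radius 1,
  so for large m the tilt fits into the gap.\<close>

lemma cycle_tilt_bound:
  "\<exists>\<rho> M. 0 < \<rho> \<and> \<rho> < 1 \<and> (\<forall>m\<ge>M. \<forall>k. norm (c m k) \<le> \<rho> ^ k)"
proof -
  obtain T where T: "T > 0" "\<And>k. norm (\<tau> k) \<le> T" "\<And>k. norm (y k) \<le> T" using tilt_bounded by auto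
  \<comment> \<open>Chosen so that \<open>Z > 1\<close> while \<open>r * Z\<close> is the midpoint
    of r and 1.\<close>
  define Z where "Z = (1 + r) / (2 * r)"
  have Z: "Z > 1" "r * Z = (1 + r) / 2" using r by (simp_all add: Z_def field_simps)
  have "(\<lambda>m. exp (T / sqrt (real m))) \<longlonglongrightarrow> exp 0"
    by (intro tendsto_exp real_tendsto_divide_at_top[OF tendsto_const]
        filterlim_compose[OF sqrt_at_top filterlim_real_sequentially])
  then have "eventually (\<lambda>m. exp (T / sqrt (real m)) < Z) sequentially"
    using Z(1) by (intro order_tendstoD(2)) auto
  then obtain M where M: "\<And>m. m \<ge> M \<Longrightarrow> exp (T / sqrt (real m)) < Z"
    by (auto simp: eventually_sequentially)
  show ?thesis
  proof (intro exI conjI allI impI)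
    show "0 < r * Z" "r * Z < 1" using Z r by auto
    fix m k assume m: "m \<ge> M"
    have "norm (z m j) \<le> Z" for j
    proof (cases "j < 2")
      case False
      have "norm (z m j) = exp (Re (\<tau> (j - 2)) / sqrt (real m))"
        using False by (simp add: z_def Re_divide_of_real)
      also have "\<dots> \<le> exp (T / sqrt (real m))"
        using T(2)[of "j - 2"] complex_Re_le_cmod[of "\<tau> (j - 2)"] by (auto intro!: divide_right_mono)
      finally show ?thesis using M[OF m] by simp
    qed (use Z in \<open>simp add: z_def\<close>)
    then have "norm (omega (z m) 0 k) \<le> Z ^ k"
      using Z(1) by (intro omega_0_bound) auto
    then show "norm (c m k) \<le> (r * Z) ^ k"
      using r by (simp add: c_def norm_mult norm_power power_mult_distrib mult_left_mono del: omega.simps)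
  qed
qed

end

section \<open>Asymptotics of the Fourier integral\<close>

lemma iexp_power: "iexp x ^ m = iexp (real m * x)"
  by (simp flip: exp_of_nat_mult add: mult_ac)

lemma sqrt_at_top_sequentially: "filterlim (\<lambda>m. sqrt (real m)) at_top sequentially"
  by (rule filterlim_compose[OF sqrt_at_top filterlim_real_sequentially])

lemma divide_sqrt_tendsto_0: "(\<lambda>m. x / sqrt (real m)) \<longlonglongrightarrow> 0"
  by (rule real_tendsto_divide_at_top[OF tendsto_const sqrt_at_top_sequentially])

text \<open>A central limit theorem for a discrete law of mean 0 and variance V. The quantity
  \<open>of_nat m * (\<psi> m - 1)\<close> converges termwise, dominated by
  \<open>w k * (D k)\<^sup>2\<close>; the linear term in \<open>e\<close> may be subtracted because
  it sums to 0. The same limit holds for \<xi>, whose m-th power is eventually exact, and m-th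
  powers of numbers of modulus at most 1 differ by at most m times the difference.\<close>

lemma char_power_limit:
  fixes w D :: "nat \<Rightarrow> real"
  assumes w: "\<And>k. w k \<ge> 0" "w sums 1" and wD: "(\<lambda>k. w k * D k) sums 0"
    and wV: "(\<lambda>k. w k * (D k)\<^sup>2) sums V"
  shows "(\<lambda>m. (\<Sum>k. of_real (w k) * iexp (D k / sqrt (real m))) ^ m) \<longlonglongrightarrow> of_real (exp (- V / 2))"
proof -
  define \<psi> where "\<psi> m = (\<Sum>k. of_real (w k) * iexp (D k / sqrt (real m)))" for m
  define \<xi> where "\<xi> m = complex_of_real (exp (- V / 2 / real m))" for m
  define e where "e k m = of_real (w k) * (of_nat m * (iexp (D k / sqrt (real m)) - 1 - \<i> * of_real (D k / sqrt (real m))))" for k m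
  have wsum: "summable w" using w(2) by (rule sums_summable)
  have sumn: "summable (\<lambda>k. norm (of_real (w k) * iexp (D k / sqrt (real m))))" for m
    using wsum w(1) by (simp add: norm_mult)
  have \<psi>s: "(\<lambda>k. of_real (w k) * iexp (D k / sqrt (real m))) sums \<psi> m" for m
    unfolding \<psi>_def by (rule summable_sums[OF summable_norm_cancel[OF sumn]])
  have V: "V \<ge> 0" using sums_le[OF _ sums_zero wV] w(1) by simp
  have \<psi>1: "norm (\<psi> m) \<le> 1" for m
  proof -
    have "norm (\<psi> m) \<le> (\<Sum>k. norm (of_real (w k) * iexp (D k / sqrt (real m))))"
      unfolding \<psi>_def by (rule summable_norm[OF sumn])
    also have "\<dots> = 1" using w by (simp add: norm_mult sums_iff)
    finally show ?thesis .
  qed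
  have \<xi>1: "norm (\<xi> m) \<le> 1" for m using V by (simp add: \<xi>_def divide_nonneg_nonneg)
  have es: "(\<lambda>k. e k m) sums (of_nat m * (\<psi> m - 1))" for m
  proof -
    have "(\<lambda>k. \<i> / of_real (sqrt (real m)) * of_real (w k * D k)) sums (\<i> / of_real (sqrt (real m)) * of_real 0)"
      by (intro sums_mult sums_of_real wD)
    moreover have "(\<lambda>k. of_real (w k) :: complex) sums of_real 1" by (intro sums_of_real w(2))
    ultimately have "(\<lambda>k. of_nat m * (of_real (w k) * iexp (D k / sqrt (real m)) - of_real (w k)
        - \<i> / of_real (sqrt (real m)) * of_real (w k * D k)))
      sums (of_nat m * (\<psi> m - of_real 1 - \<i> / of_real (sqrt (real m)) * of_real 0))"
      by (intro sums_mult[of _ _ "of_nat m"] sums_diff \<psi>s)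
    then show ?thesis by (simp add: e_def algebra_simps)
  qed
  have e_lim: "(\<lambda>m. e k m) \<longlonglongrightarrow> of_real (w k) * - (of_real ((D k)\<^sup>2) / 2)" for k
    unfolding e_def
  proof (intro tendsto_mult tendsto_const)
    have "(\<lambda>m. of_nat m * (iexp (D k / sqrt (real m)) - 1 - \<i> * of_real (D k / sqrt (real m)))
        - - (of_real ((D k)\<^sup>2) / 2) :: complex) \<longlonglongrightarrow> 0"
    proof (rule Lim_null_comparison)
      show "eventually (\<lambda>m. norm (of_nat m * (iexp (D k / sqrt (real m)) - 1 - \<i> * of_real (D k / sqrt (real m)))
        - - (of_real ((D k)\<^sup>2) / 2)) \<le> (\<bar>D k\<bar> ^ 3 / 6) / sqrt (real m)) sequentially"
        using eventually_gt_at_top[of 0]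
      proof eventually_elim
        case (elim m)
        define x where "x = D k / sqrt (real m)"
        have x2: "real m * x\<^sup>2 = (D k)\<^sup>2" using elim by (simp add: x_def power_divide)
        have x3: "real m * \<bar>x\<bar> ^ 3 = \<bar>D k\<bar> ^ 3 / sqrt (real m)"
        proof -
          have "real m = sqrt (real m) * sqrt (real m)" by simp
          then show ?thesis
            using elim by (simp add: x_def abs_divide power_divide power3_eq_cube field_simps)
        qed
        have "of_nat m * (iexp x - 1 - \<i> * x) - - (of_real ((D k)\<^sup>2) / 2)
          = of_nat m * (iexp x - 1 - \<i> * x + x\<^sup>2 / 2)"
          unfolding x2[symmetric] by (simp add: algebra_simps)
        then have "norm (of_nat m * (iexp x - 1 - \<i> * x) - - (of_real ((D k)\<^sup>2) / 2))
          = real m * norm (iexp x - 1 - \<i> * x + x\<^sup>2 / 2)"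
          by (simp add: norm_mult)
        also have "\<dots> \<le> real m * (\<bar>x\<bar> ^ 3 / 6)"
          by (intro mult_left_mono norm_iexp_minus_quadratic) auto
        also have "\<dots> = (\<bar>D k\<bar> ^ 3 / 6) / sqrt (real m)" using x3 by simp
        finally show ?case unfolding x_def .
      qed
    qed (rule divide_sqrt_tendsto_0)
    then show "(\<lambda>m. of_nat m * (iexp (D k / sqrt (real m)) - 1 - \<i> * of_real (D k / sqrt (real m))))
      \<longlonglongrightarrow> - (of_real ((D k)\<^sup>2) / 2)"
      by (rule LIM_zero_cancel)
  qed
  have e_bound: "norm (e k m) \<le> w k * (D k)\<^sup>2" for k m
  proof -
    have "real m * norm (iexp (D k / sqrt (real m)) - 1 - \<i> * of_real (D k / sqrt (real m)))
      \<le> real m * ((D k / sqrt (real m))\<^sup>2 / 2)"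
      by (intro mult_left_mono norm_iexp_minus_linear) auto
    also have "\<dots> \<le> (D k)\<^sup>2" by (cases "m = 0") (auto simp: power_divide)
    finally have "w k * (real m * norm (iexp (D k / sqrt (real m)) - 1 - \<i> * of_real (D k / sqrt (real m))))
      \<le> w k * (D k)\<^sup>2" using w(1) by (rule mult_left_mono)
    then show ?thesis using w(1)[of k] by (simp only: e_def norm_mult norm_of_real norm_of_nat abs_of_nonneg)
  qed
  have "(\<lambda>m. \<Sum>k. e k m) \<longlonglongrightarrow> (\<Sum>k. of_real (w k) * - (of_real ((D k)\<^sup>2) / 2))"
    by (rule tannerys_theorem[THEN conjunct2, THEN conjunct2, of _ _ _ "\<lambda>k. w k * (D k)\<^sup>2"])
       (use e_lim e_bound sums_summable[OF wV] in \<open>auto simp: always_eventually\<close>)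
  moreover have "(\<Sum>k. of_real (w k) * - (of_real ((D k)\<^sup>2) / 2) :: complex) = of_real (- V / 2)"
  proof -
    have "(\<lambda>k. of_real (- (1/2) * (w k * (D k)\<^sup>2)) :: complex) sums of_real (- (1/2) * V)"
      by (intro sums_of_real sums_mult wV)
    then show ?thesis by (simp add: sums_iff algebra_simps)
  qed
  ultimately have lim1: "(\<lambda>m. of_nat m * (\<psi> m - 1)) \<longlonglongrightarrow> of_real (- V / 2)"
    using es by (simp add: sums_iff)
  have "(\<lambda>m. real m * (exp (- V / 2 / real m) - 1)) \<longlonglongrightarrow> - V / 2"
    by real_asymp
  then have "(\<lambda>m. complex_of_real (real m * (exp (- V / 2 / real m) - 1))) \<longlonglongrightarrow> of_real (- V / 2)"
    by (rule tendsto_of_real)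
  then have lim2: "(\<lambda>m. of_nat m * (\<xi> m - 1)) \<longlonglongrightarrow> of_real (- V / 2)"
    by (simp add: \<xi>_def)
  have "(\<lambda>m. of_nat m * (\<psi> m - 1) - of_nat m * (\<xi> m - 1)) \<longlonglongrightarrow> of_real (- V / 2) - of_real (- V / 2)"
    by (rule tendsto_diff[OF lim1 lim2])
  then have d0: "(\<lambda>m. norm (of_nat m * (\<psi> m - 1) - of_nat m * (\<xi> m - 1))) \<longlonglongrightarrow> 0"
    by (simp add: tendsto_norm_zero)
  have "(\<lambda>m. \<psi> m ^ m - \<xi> m ^ m) \<longlonglongrightarrow> 0"
  proof (rule Lim_null_comparison[OF _ d0], rule always_eventually, rule allI)
    fix m
    have "norm (\<psi> m ^ m - \<xi> m ^ m) \<le> real m * norm (\<psi> m - \<xi> m)"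
      by (rule norm_power_diff[OF \<psi>1 \<xi>1])
    also have "\<dots> = norm (of_nat m * (\<psi> m - 1) - of_nat m * (\<xi> m - 1))"
      by (simp add: norm_mult flip: right_diff_distrib)
    finally show "norm (\<psi> m ^ m - \<xi> m ^ m) \<le> norm (of_nat m * (\<psi> m - 1) - of_nat m * (\<xi> m - 1))" .
  qed
  moreover have "(\<lambda>m. \<xi> m ^ m) \<longlonglongrightarrow> of_real (exp (- V / 2))"
  proof (rule tendsto_eventually)
    show "eventually (\<lambda>m. \<xi> m ^ m = of_real (exp (- V / 2))) sequentially"
      using eventually_gt_at_top[of 0]
    proof eventually_elim
      case (elim m)
      have "exp (- V / 2 / real m) ^ m = exp (real m * (- V / 2 / real m))"
        by (rule exp_of_nat_mult[symmetric])
      then show ?case using elim by (simp add: \<xi>_def flip: of_real_power)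
    qed
  qed
  ultimately have "(\<lambda>m. (\<psi> m ^ m - \<xi> m ^ m) + \<xi> m ^ m) \<longlonglongrightarrow> 0 + of_real (exp (- V / 2))"
    by (rule tendsto_add)
  then show ?thesis by (simp add: \<psi>_def)
qed

text \<open>Completing the square. The reduction of Q by b^2 / v becomes the regression term in
  \<open>Hmat\<close>.\<close>

lemma has_bochner_integral_gaussian:
  fixes Q b v :: real
  assumes "v > 0"
  shows "has_bochner_integral lborel (\<lambda>s. exp (- (Q + 2 * b * s + v * s\<^sup>2) / 2))
    (sqrt (2 * pi / v) * exp (- (Q - b\<^sup>2 / v) / 2))"
proof -
  define k where "k = sqrt (2 * pi / v) * exp (- (Q - b\<^sup>2 / v) / 2)"
  have "exp (- (Q + 2 * b * s + v * s\<^sup>2) / 2) = k * normal_density (- b / v) (1 / sqrt v) s" for s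
  proof -
    have "Q + 2 * b * s + v * s\<^sup>2 = (Q - b\<^sup>2 / v) + v * (s + b / v)\<^sup>2"
      using assms by (simp add: power2_eq_square field_simps)
    then have "exp (- (Q + 2 * b * s + v * s\<^sup>2) / 2) = exp (- (Q - b\<^sup>2 / v) / 2) * exp (- (v * (s + b / v)\<^sup>2) / 2)"
      by (simp add: exp_add[symmetric] add_divide_distrib diff_divide_distrib)
    moreover have "normal_density (- b / v) (1 / sqrt v) s = 1 / sqrt (2 * pi / v) * exp (- (v * (s + b / v)\<^sup>2) / 2)"
      using assms by (simp add: normal_density_def power_divide)
    ultimately show ?thesis using assms by (simp add: k_def)
  qed
  moreover have "has_bochner_integral lborel (\<lambda>s. k * normal_density (- b / v) (1 / sqrt v) s) (k * 1)"
    using assms by (intro has_bochner_integral_mult_right) (simp_all add: has_bochner_integral_iff)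
  ultimately show ?thesis by (simp add: k_def)
qed

lemma integrable_gaussian:
  assumes "\<kappa> > 0"
  shows "integrable lborel (\<lambda>s. exp (B - \<kappa> * s\<^sup>2) :: real)"
proof -
  have "integrable lborel (\<lambda>s. exp (- (- 2 * B + 2 * 0 * s + 2 * \<kappa> * s\<^sup>2) / 2))"
    using has_bochner_integral_gaussian[of "2 * \<kappa>" "- 2 * B" 0] assms
    by (simp only: has_bochner_integral_iff)
  moreover have "- (- 2 * B + 2 * 0 * s + 2 * \<kappa> * s\<^sup>2) / 2 = B - \<kappa> * s\<^sup>2" for s
    by (simp add: field_simps)
  ultimately show ?thesis by (simp only:)
qed

section \<open>Domination of the rescaled integral\<close>

context tilted_paths
begin

text \<open>The Fourier integrand under x = s / sqrt m, the scale on which its limit is Gaussian;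
  the indicator is the image of the full period.\<close>

definition scaled_integrand :: "nat \<Rightarrow> nat \<Rightarrow> real \<Rightarrow> complex" where
  "scaled_integrand m n s = indicator {- (pi * sqrt (real m))..pi * sqrt (real m)} s *\<^sub>R
     (A m (s / sqrt (real m)) ^ m * C m (s / sqrt (real m)) * iexp (- real n * (s / sqrt (real m))))"

text \<open>The factor sqrt m compensates for the Jacobian and 2 * pi for the period, so that this
  equals the integral of \<open>scaled_integrand\<close> without further constants.\<close>

definition scaled_coeff :: "nat \<Rightarrow> nat \<Rightarrow> complex" where
  "scaled_coeff m n = of_real (sqrt (real m)) * (2 * pi * conv_pow (a m) (c m) m n)"

lemma conv_pow_a_c:
  "conv_pow (a m) (c m) m n =
    (of_real (1 - r) * exp (- mean_tilt / of_real (sqrt (real m)))) ^ m * of_real r ^ n * path_coeff (z m) m n"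
proof (rule conv_pow_path_coeff)
  fix k
  have "y k / of_real (sqrt (real m)) = - mean_tilt / of_real (sqrt (real m)) + \<tau> k / of_real (sqrt (real m))"
    by (simp add: y_def diff_divide_distrib)
  then have "exp (y k / of_real (sqrt (real m))) = exp (- mean_tilt / of_real (sqrt (real m))) * z m (k + 2)"
    by (simp only: exp_add) (simp add: z_def)
  then show "a m k = of_real (1 - r) * exp (- mean_tilt / of_real (sqrt (real m))) * of_real r ^ k * z m (k + 2)"
    by (simp add: a_def w_def)
qed (simp add: c_def)

lemma summable_norm_c: "\<exists>M. \<forall>m\<ge>M. summable (\<lambda>k. norm (c m k))"
proof -
  obtain \<rho> M where \<rho>: "0 < \<rho>" "\<rho> < 1" and M: "\<forall>m\<ge>M. \<forall>k. norm (c m k) \<le> \<rho> ^ k"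
    using cycle_tilt_bound by auto
  have g: "summable (\<lambda>k. \<rho> ^ k)" using \<rho> by (simp add: summable_geometric)
  have "summable (\<lambda>k. norm (c m k))" if "m \<ge> M" for m
    by (rule summable_comparison_test'[OF g, of 0]) (use M that in simp)
  then show ?thesis by blast
qed

lemma integral_scaled_integrand:
  assumes "m > 0" "summable (\<lambda>k. norm (c m k))"
  shows "(LINT s|lborel. scaled_integrand m n s) = scaled_coeff m n"
proof -
  define f where "f x = indicator {-pi..pi} x *\<^sub>R (A m x ^ m * C m x * iexp (- real n * x))" for x
  have mp: "sqrt (real m) > 0" using assms(1) by simp
  have "f (0 + 1 / sqrt (real m) * s) = scaled_integrand m n s" for s
  proof -
    have "s / sqrt (real m) \<in> {-pi..pi} \<longleftrightarrow> s \<in> {- (pi * sqrt (real m))..pi * sqrt (real m)}"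
      using mp by (simp add: field_simps)
    then have "indicator {-pi..pi} (s / sqrt (real m)) = (indicator {- (pi * sqrt (real m))..pi * sqrt (real m)} s :: real)"
      by (simp only: indicator_def)
    then show ?thesis by (simp only: f_def scaled_integrand_def) simp
  qed
  then have "(LINT x|lborel. f x) = \<bar>1 / sqrt (real m)\<bar> *\<^sub>R (LINT s|lborel. scaled_integrand m n s)"
    using lborel_integral_real_affine[of "1 / sqrt (real m)" f 0] mp by simp
  moreover have "(LINT x|lborel. f x) = 2 * pi * conv_pow (a m) (c m) m n"
    using set_integral_conv_pow[OF summable_norm_a[of m] assms(2), of m n]
    by (simp add: f_def A_def C_def set_lebesgue_integral_def)
  ultimately have e: "2 * pi * conv_pow (a m) (c m) m n = of_real (1 / sqrt (real m)) * (LINT s|lborel. scaled_integrand m n s)"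
    using mp by (simp add: scaleR_conv_of_real)
  show ?thesis unfolding scaled_coeff_def e using mp by simp
qed

lemma A_measurable [measurable]: "(\<lambda>s. A m (s / x)) \<in> borel_measurable borel"
  unfolding A_def by measurable

lemma C_measurable [measurable]: "(\<lambda>s. C m (s / x)) \<in> borel_measurable borel"
  unfolding C_def by measurable

lemma scaled_integrand_measurable [measurable]: "scaled_integrand m n \<in> borel_measurable lborel"
  unfolding scaled_integrand_def[abs_def] by measurable

text \<open>The coefficient index n occurs only in a factor of modulus 1, so one dominating function
  serves all n. Raising \<open>norm_A_le\<close> to the power m gives the Gaussian, and the
  geometric bound on cycles gives a constant.\<close>

lemma scaled_integrand_bound:
  "\<exists>g M. integrable lborel g \<and> (\<forall>m\<ge>M. \<forall>n s. norm (scaled_integrand m n s) \<le> (g s :: real))"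
proof -
  obtain \<rho> M1 where \<rho>: "0 < \<rho>" "\<rho> < 1" and M1: "\<forall>m\<ge>M1. \<forall>k. norm (c m k) \<le> \<rho> ^ k"
    using cycle_tilt_bound by auto
  obtain B \<kappa> M2 where \<kappa>: "\<kappa> > 0"
    and M2: "\<forall>m\<ge>M2. \<forall>x. \<bar>x\<bar> \<le> pi \<longrightarrow> norm (A m x) \<le> exp (B / real m - \<kappa> * x\<^sup>2)"
    using norm_A_le by auto
  define g where "g s = exp (B - \<kappa> * s\<^sup>2) * (1 / (1 - \<rho>))" for s
  have "norm (scaled_integrand m n s) \<le> g s" if m: "m \<ge> Suc (max M1 M2)" for m n s
  proof (cases "s \<in> {- (pi * sqrt (real m))..pi * sqrt (real m)}")
    case False
    then show ?thesis using \<rho> by (simp add: scaled_integrand_def g_def)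
  next
    case True
    define x where "x = s / sqrt (real m)"
    have mp: "real m > 0" using m by simp
    have "\<bar>s\<bar> \<le> pi * sqrt (real m)" using True by auto
    then have x: "\<bar>x\<bar> \<le> pi" using mp by (simp add: x_def abs_divide divide_le_eq)
    have "norm (A m x) ^ m \<le> exp (B / real m - \<kappa> * x\<^sup>2) ^ m"
      using M2 m x by (intro power_mono) auto
    also have "\<dots> = exp (real m * (B / real m - \<kappa> * x\<^sup>2))" by (rule exp_of_nat_mult[symmetric])
    also have "real m * (B / real m - \<kappa> * x\<^sup>2) = B - \<kappa> * s\<^sup>2"
      using mp by (simp add: x_def power_divide algebra_simps)
    finally have 1: "norm (A m x) ^ m \<le> exp (B - \<kappa> * s\<^sup>2)" .
    have g: "summable (\<lambda>k. \<rho> ^ k)" using \<rho> by (simp add: summable_geometric)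
    have le: "norm (c m k * iexp (real k * x)) \<le> \<rho> ^ k" for k
      using M1 m by (simp add: norm_mult)
    have sm: "summable (\<lambda>k. norm (c m k * iexp (real k * x)))"
      by (rule summable_comparison_test'[OF g, of 0]) (use le in simp)
    have "norm (C m x) \<le> (\<Sum>k. norm (c m k * iexp (real k * x)))"
      unfolding C_def by (rule summable_norm[OF sm])
    also have "\<dots> \<le> (\<Sum>k. \<rho> ^ k)" by (rule suminf_le[OF le sm g])
    also have "\<dots> = 1 / (1 - \<rho>)" using \<rho> by (simp add: suminf_geometric)
    finally have 2: "norm (C m x) \<le> 1 / (1 - \<rho>)" .
    have "norm (scaled_integrand m n s) = norm (A m x) ^ m * norm (C m x)"
      using True by (simp add: scaled_integrand_def x_def norm_mult norm_power)
    also have "\<dots> \<le> g s" unfolding g_def using 1 2 by (intro mult_mono) auto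
    finally show ?thesis .
  qed
  moreover have "integrable lborel g"
    unfolding g_def by (intro integrable_mult_left integrable_gaussian \<kappa>)
  ultimately show ?thesis by blast
qed

text \<open>Holds for every complex tilt. For real tilts this upper bound replaces a limit and is
  what the second moments rest on.\<close>

lemma scaled_coeff_bounded: "\<exists>B M. \<forall>m\<ge>M. \<forall>n. norm (scaled_coeff m n) \<le> B"
proof -
  obtain g M1 where g: "integrable lborel (g :: real \<Rightarrow> real)" and M1: "\<forall>m\<ge>M1. \<forall>n s. norm (scaled_integrand m n s) \<le> g s"
    using scaled_integrand_bound by auto
  obtain M2 where M2: "\<forall>m\<ge>M2. summable (\<lambda>k. norm (c m k))" using summable_norm_c by auto
  have "norm (scaled_coeff m n) \<le> (LINT s|lborel. g s)" if m: "m \<ge> Suc (max M1 M2)" for m n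
  proof -
    have "norm (scaled_integrand m n s) \<le> norm (g s)" for s
    proof -
      have "M1 \<le> m" using m by simp
      from M1[rule_format, OF this, of n s] abs_ge_self[of "g s"] show ?thesis by simp
    qed
    then have int: "integrable lborel (scaled_integrand m n)"
      by (intro Bochner_Integration.integrable_bound[OF g]) auto
    have "scaled_coeff m n = (LINT s|lborel. scaled_integrand m n s)"
      using M2 m by (intro integral_scaled_integrand[symmetric]) auto
    also have "norm \<dots> \<le> (LINT s|lborel. norm (scaled_integrand m n s))"
      by (rule integral_norm_bound)
    also have "\<dots> \<le> (LINT s|lborel. g s)"
      using M1 m by (intro integral_mono integrable_norm int g) auto
    finally show ?thesis .
  qed
  then show ?thesis by blast
qed

text \<open>The exponential generating function of 2-regular graphs, evaluated at r.\<close>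

definition C_limit :: real where
  "C_limit = (\<Sum>k. r ^ k * (real (card (pc_graphs {1..k} 0)) / fact k))"

lemma C_limit_sums: "(\<lambda>k. r ^ k * (real (card (pc_graphs {1..k} 0)) / fact k)) sums C_limit"
proof -
  have g: "summable (\<lambda>k. r ^ k)" using r by (simp add: summable_geometric)
  have "norm (r ^ k * (real (card (pc_graphs {1..k} 0)) / fact k)) \<le> r ^ k" for k
  proof -
    have "real (card (pc_graphs {1..k} 0)) \<le> real (fact k)"
      using card_pc_graphs_0[of "{1..k}"] by (simp only: of_nat_le_iff) simp
    then have "r ^ k * (real (card (pc_graphs {1..k} 0)) / fact k) \<le> r ^ k * 1"
      using r by (intro mult_left_mono) auto
    then show ?thesis using r by (simp add: abs_mult)
  qed
  then show ?thesis
    unfolding C_limit_def by (intro summable_sums summable_comparison_test'[OF g, of 0]) auto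
qed

text \<open>All terms are nonnegative and the empty graph contributes 1.\<close>

lemma C_limit_pos: "C_limit > 0"
proof -
  have "{..<1::nat} = {0}" by auto
  moreover have "pc_graphs {1..0} 0 = {{}}" by (auto simp: pc_graphs_def edges_on_def)
  ultimately have "(\<Sum>k<1. r ^ k * (real (card (pc_graphs {1..k} 0)) / fact k)) = 1" by simp
  moreover have "(\<Sum>k<1. r ^ k * (real (card (pc_graphs {1..k} 0)) / fact k)) \<le> C_limit"
    unfolding C_limit_def using C_limit_sums r by (intro sum_le_suminf) (auto simp: sums_iff)
  ultimately show ?thesis by simp
qed

text \<open>For each fixed k both the tilt and the phase tend to 1; the geometric bound allows the
  limit to pass through the series.\<close>

lemma C_tendsto: "(\<lambda>m. C m (s / sqrt (real m))) \<longlonglongrightarrow> of_real C_limit"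
proof -
  obtain \<rho> M where \<rho>: "0 < \<rho>" "\<rho> < 1" and M: "\<forall>m\<ge>M. \<forall>k. norm (c m k) \<le> \<rho> ^ k"
    using cycle_tilt_bound by auto
  have z_lim: "(\<lambda>m. z m j) \<longlonglongrightarrow> 1" for j
  proof (cases "j < 2")
    case False
    have "(\<lambda>m. \<tau> (j - 2) * of_real (1 / sqrt (real m))) \<longlonglongrightarrow> \<tau> (j - 2) * of_real 0"
      by (intro tendsto_mult tendsto_const tendsto_of_real divide_sqrt_tendsto_0)
    then have "(\<lambda>m. exp (\<tau> (j - 2) * of_real (1 / sqrt (real m)))) \<longlonglongrightarrow> exp 0"
      by (intro tendsto_exp) simp
    then show ?thesis using False by (simp add: z_def)
  qed (simp add: z_def)
  have om: "omega (\<lambda>_. 1) 0 k = of_real (real (card (pc_graphs {1..k} 0)) / fact k)" for k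
    by (simp add: total_weight_one)
  have i_lim: "(\<lambda>m. iexp (real k * (s / sqrt (real m)))) \<longlonglongrightarrow> iexp (real k * 0)" for k
    by (intro tendsto_intros divide_sqrt_tendsto_0)
  have lim: "(\<lambda>m. c m k * iexp (real k * (s / sqrt (real m)))) \<longlonglongrightarrow> of_real r ^ k * omega (\<lambda>_. 1) 0 k * iexp (real k * 0)" for k
    unfolding c_def by (intro tendsto_mult tendsto_const tendsto_omega_0 z_lim i_lim)
  have ev: "eventually (\<lambda>(k, m). norm (c m k * iexp (real k * (s / sqrt (real m)))) \<le> \<rho> ^ k) (at_top \<times>\<^sub>F sequentially)"
    unfolding case_prod_unfold
    by (rule eventually_mono[OF eventually_prodI[OF eventually_True eventually_ge_at_top[of M]]])
       (use M in \<open>auto simp: norm_mult\<close>)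
  have "(\<lambda>m. C m (s / sqrt (real m))) \<longlonglongrightarrow> (\<Sum>k. of_real r ^ k * omega (\<lambda>_. 1) 0 k * iexp (real k * 0))"
    unfolding C_def
    by (rule tannerys_theorem[THEN conjunct2, THEN conjunct2, OF lim ev])
       (use \<rho> in \<open>auto simp: summable_geometric\<close>)
  also have "(\<Sum>k. of_real r ^ k * omega (\<lambda>_. 1) 0 k * iexp (real k * 0)) = of_real C_limit"
  proof -
    have "(\<lambda>k. of_real (r ^ k * (real (card (pc_graphs {1..k} 0)) / fact k)) :: complex) sums of_real C_limit"
      by (intro sums_of_real C_limit_sums)
    then show ?thesis unfolding om by (simp add: sums_iff)
  qed
  finally show ?thesis .
qed

end

section \<open>Limit for imaginary tilts\<close>

locale imaginary_tilt = tilted_paths \<alpha> K "\<lambda>k. \<i> * of_real (t k)" for \<alpha> K and t :: "nat \<Rightarrow> real"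
begin

definition mean_t where "mean_t = (\<Sum>k<K. w k * t k)"
text \<open>For a geometric variable X with law \<open>w\<close>, \<open>Q\<close> is the variance
  of \<open>t\<close> at X, and \<open>b\<close> is its covariance with X.\<close>

definition Q where "Q = (\<Sum>k<K. w k * (t k)\<^sup>2) - mean_t\<^sup>2"
definition b where "b = (\<Sum>k<K. w k * t k * (real k - \<alpha>))"

lemma t_0: "k \<ge> K \<Longrightarrow> t k = 0"
  using \<tau> by auto

lemma y_eq: "y k = \<i> * of_real (t k - mean_t)"
proof -
  have "mean_tilt = \<i> * of_real mean_t"
    unfolding mean_tilt_def mean_t_def of_real_sum sum_distrib_left by (intro sum.cong) auto
  then show ?thesis by (simp add: y_def algebra_simps)
qed

text \<open>\<open>D\<close> is the centred combination of \<open>t\<close> and s times the path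
  length. Its variance is quadratic in s, with leading coefficient \<alpha> * (1 + \<alpha>), the
  variance of the geometric law.\<close>

lemma deviation_sums:
  fixes s :: real
  defines "D \<equiv> \<lambda>k. t k - mean_t + s * (real k - \<alpha>)"
  shows "(\<lambda>k. w k * D k) sums 0"
    and "(\<lambda>k. w k * (D k)\<^sup>2) sums (Q + 2 * b * s + \<alpha> * (1 + \<alpha>) * s\<^sup>2)"
proof -
  have fin: "(\<lambda>k. w k * t k * h k) sums (\<Sum>k<K. w k * t k * h k)" for h :: "nat \<Rightarrow> real"
    by (rule sums_finite) (use t_0 in auto)
  have "(\<lambda>k. w k * t k * 1 - w k * mean_t + (w k * real k * s - w k * (\<alpha> * s)))
    sums ((\<Sum>k<K. w k * t k * 1) - 1 * mean_t + (\<alpha> * s - 1 * (\<alpha> * s)))"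
    by (intro sums_add sums_diff fin sums_mult2 w_sums)
  then show "(\<lambda>k. w k * D k) sums 0"
    by (simp add: D_def mean_t_def algebra_simps)
  have e: "(\<Sum>k<K. w k * t k * (t k - 2 * mean_t + 2 * s * (real k - \<alpha>))) = Q - mean_t\<^sup>2 + 2 * b * s"
  proof -
    have "(\<Sum>k<K. w k * t k * (t k - 2 * mean_t + 2 * s * (real k - \<alpha>)))
      = (\<Sum>k<K. w k * (t k)\<^sup>2 - 2 * mean_t * (w k * t k) + 2 * s * (w k * t k * (real k - \<alpha>)))"
      by (intro sum.cong) (auto simp: algebra_simps power2_eq_square)
    also have "\<dots> = (\<Sum>k<K. w k * (t k)\<^sup>2) - 2 * mean_t * mean_t + 2 * s * b"
      by (simp add: sum.distrib sum_subtractf mean_t_def b_def flip: sum_distrib_left)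
    finally show ?thesis by (simp add: Q_def power2_eq_square)
  qed
  have "(\<lambda>k. w k * t k * (t k - 2 * mean_t + 2 * s * (real k - \<alpha>))
      + (w k * (mean_t\<^sup>2 + 2 * mean_t * s * \<alpha> + s\<^sup>2 * \<alpha>\<^sup>2) + w k * real k * (- 2 * mean_t * s - 2 * s\<^sup>2 * \<alpha>) + w k * (real k)\<^sup>2 * s\<^sup>2))
    sums ((\<Sum>k<K. w k * t k * (t k - 2 * mean_t + 2 * s * (real k - \<alpha>)))
      + (1 * (mean_t\<^sup>2 + 2 * mean_t * s * \<alpha> + s\<^sup>2 * \<alpha>\<^sup>2) + \<alpha> * (- 2 * mean_t * s - 2 * s\<^sup>2 * \<alpha>) + (\<alpha> * (1 + \<alpha>) + \<alpha>\<^sup>2) * s\<^sup>2))"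
    by (intro sums_add fin sums_mult2 w_sums)
  moreover have "w k * t k * (t k - 2 * mean_t + 2 * s * (real k - \<alpha>))
      + (w k * (mean_t\<^sup>2 + 2 * mean_t * s * \<alpha> + s\<^sup>2 * \<alpha>\<^sup>2) + w k * real k * (- 2 * mean_t * s - 2 * s\<^sup>2 * \<alpha>) + w k * (real k)\<^sup>2 * s\<^sup>2)
    = w k * (D k)\<^sup>2" for k
    by (simp add: D_def power2_eq_square algebra_simps)
  moreover have "(\<Sum>k<K. w k * t k * (t k - 2 * mean_t + 2 * s * (real k - \<alpha>)))
      + (1 * (mean_t\<^sup>2 + 2 * mean_t * s * \<alpha> + s\<^sup>2 * \<alpha>\<^sup>2) + \<alpha> * (- 2 * mean_t * s - 2 * s\<^sup>2 * \<alpha>) + (\<alpha> * (1 + \<alpha>) + \<alpha>\<^sup>2) * s\<^sup>2)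
    = Q + 2 * b * s + \<alpha> * (1 + \<alpha>) * s\<^sup>2"
    unfolding e by (simp add: power2_eq_square algebra_simps)
  ultimately show "(\<lambda>k. w k * (D k)\<^sup>2) sums (Q + 2 * b * s + \<alpha> * (1 + \<alpha>) * s\<^sup>2)" by (simp only:)
qed

text \<open>The factor with n is split into m equal phases that centre the path lengths at \<alpha>
  and a remainder with \<alpha> * m - n. The remainder tends to 1 because that difference is
  bounded, and \<open>char_power_limit\<close> handles the centred power.\<close>

lemma scaled_integrand_tendsto:
  assumes n: "\<And>m. \<bar>\<alpha> * real m - real (n m)\<bar> \<le> 1"
  shows "(\<lambda>m. scaled_integrand m (n m) s)
    \<longlonglongrightarrow> of_real (C_limit * exp (- (Q + 2 * b * s + \<alpha> * (1 + \<alpha>) * s\<^sup>2) / 2))"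
proof -
  define D where "D k = t k - mean_t + s * (real k - \<alpha>)" for k
  define \<psi> where "\<psi> m = (\<Sum>k. of_real (w k) * iexp (D k / sqrt (real m)))" for m
  have \<psi>: "A m (s / sqrt (real m)) * iexp (- \<alpha> * s / sqrt (real m)) = \<psi> m" for m
  proof -
    have sm: "summable (\<lambda>k. a m k * iexp (real k * (s / sqrt (real m))))"
      by (rule summable_norm_cancel) (use summable_norm_a[of m] in \<open>simp add: norm_mult\<close>)
    have "A m (s / sqrt (real m)) * iexp (- \<alpha> * s / sqrt (real m))
      = (\<Sum>k. a m k * iexp (real k * (s / sqrt (real m))) * iexp (- \<alpha> * s / sqrt (real m)))"
      unfolding A_def by (rule suminf_mult2[OF sm])
    also have "\<dots> = \<psi> m"
      unfolding \<psi>_def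
    proof (rule arg_cong[where f = suminf], rule ext)
      fix k
      have "iexp (D k / sqrt (real m)) = exp (y k / of_real (sqrt (real m)) + \<i> * of_real (real k * (s / sqrt (real m))) + \<i> * of_real (- \<alpha> * s / sqrt (real m)))"
        by (rule arg_cong[where f = exp]) (simp add: D_def y_eq algebra_simps add_divide_distrib diff_divide_distrib)
      then show "a m k * iexp (real k * (s / sqrt (real m))) * iexp (- \<alpha> * s / sqrt (real m)) = of_real (w k) * iexp (D k / sqrt (real m))"
        by (simp only: exp_add a_def mult.assoc)
    qed
    finally show ?thesis .
  qed
  define f where "f m = \<psi> m ^ m * C m (s / sqrt (real m)) * iexp ((\<alpha> * real m - real (n m)) * s / sqrt (real m))" for m
  have f_lim: "f \<longlonglongrightarrow> of_real (exp (- (Q + 2 * b * s + \<alpha> * (1 + \<alpha>) * s\<^sup>2) / 2)) * of_real C_limit * iexp 0"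
    unfolding f_def
  proof (intro tendsto_mult C_tendsto)
    show "(\<lambda>m. \<psi> m ^ m) \<longlonglongrightarrow> of_real (exp (- (Q + 2 * b * s + \<alpha> * (1 + \<alpha>) * s\<^sup>2) / 2))"
      unfolding \<psi>_def using deviation_sums[of s] w_pos w_sums(1)
      by (intro char_power_limit) (auto simp: D_def less_imp_le)
    have "(\<lambda>m. (\<alpha> * real m - real (n m)) * s / sqrt (real m)) \<longlonglongrightarrow> 0"
    proof (rule Lim_null_comparison[OF _ divide_sqrt_tendsto_0[of "\<bar>s\<bar>"]], rule always_eventually, rule allI)
      fix m
      have "\<bar>\<alpha> * real m - real (n m)\<bar> * \<bar>s\<bar> \<le> 1 * \<bar>s\<bar>" by (intro mult_right_mono n) auto
      then show "norm ((\<alpha> * real m - real (n m)) * s / sqrt (real m)) \<le> \<bar>s\<bar> / sqrt (real m)"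
        by (simp add: abs_mult divide_right_mono)
    qed
    then show "(\<lambda>m. iexp ((\<alpha> * real m - real (n m)) * s / sqrt (real m))) \<longlonglongrightarrow> iexp 0"
      by (intro tendsto_intros)
  qed
  have f_eq: "f m = A m (s / sqrt (real m)) ^ m * C m (s / sqrt (real m)) * iexp (- real (n m) * (s / sqrt (real m)))" for m
  proof -
    have "iexp (- \<alpha> * s / sqrt (real m)) ^ m * iexp ((\<alpha> * real m - real (n m)) * s / sqrt (real m))
      = iexp (- real (n m) * (s / sqrt (real m)))"
      unfolding iexp_power by (simp add: exp_add[symmetric] algebra_simps diff_divide_distrib add_divide_distrib)
    moreover have "f m = A m (s / sqrt (real m)) ^ m * C m (s / sqrt (real m)) *
      (iexp (- \<alpha> * s / sqrt (real m)) ^ m * iexp ((\<alpha> * real m - real (n m)) * s / sqrt (real m)))"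
      unfolding f_def \<psi>[symmetric] power_mult_distrib by (simp only: mult_ac)
    ultimately show ?thesis by (simp only:)
  qed
  have "eventually (\<lambda>m. \<bar>s\<bar> \<le> sqrt (real m)) sequentially"
    using sqrt_at_top_sequentially by (simp add: filterlim_at_top)
  then have "eventually (\<lambda>m. f m = scaled_integrand m (n m) s) sequentially"
  proof eventually_elim
    case (elim m)
    have "1 * sqrt (real m) \<le> pi * sqrt (real m)" using pi_gt3 by (intro mult_right_mono) auto
    then have "s \<in> {- (pi * sqrt (real m))..pi * sqrt (real m)}" using elim by (auto simp: abs_le_iff)
    then show ?case by (simp add: f_eq scaled_integrand_def)
  qed
  from Lim_transform_eventually[OF f_lim this] show ?thesis by (simp add: mult_ac)
qed

lemma scaled_coeff_tendsto:
  assumes n: "\<And>m. \<bar>\<alpha> * real m - real (n m)\<bar> \<le> 1"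
  shows "(\<lambda>m. scaled_coeff m (n m))
    \<longlonglongrightarrow> of_real (C_limit * sqrt (2 * pi / (\<alpha> * (1 + \<alpha>))) * exp (- (Q - b\<^sup>2 / (\<alpha> * (1 + \<alpha>))) / 2))"
proof -
  obtain g M1 where g: "integrable lborel (g :: real \<Rightarrow> real)" and M1: "\<forall>m\<ge>M1. \<forall>n s. norm (scaled_integrand m n s) \<le> g s"
    using scaled_integrand_bound by auto
  obtain M2 where M2: "\<forall>m\<ge>M2. summable (\<lambda>k. norm (c m k))" using summable_norm_c by auto
  define L where "L s = C_limit * exp (- (Q + 2 * b * s + \<alpha> * (1 + \<alpha>) * s\<^sup>2) / 2)" for s
  \<comment> \<open>The dominating function and the Fourier formula hold only from some index on, so
    dominated convergence is applied to the shifted sequence.\<close>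
  define M where "M = Suc (max M1 M2)"
  have "(\<lambda>m. LINT s|lborel. scaled_integrand (m + M) (n (m + M)) s) \<longlonglongrightarrow> (LINT s|lborel. complex_of_real (L s))"
  proof (rule integral_dominated_convergence[OF _ _ g])
    show "AE s in lborel. (\<lambda>m. scaled_integrand (m + M) (n (m + M)) s) \<longlonglongrightarrow> complex_of_real (L s)"
      using scaled_integrand_tendsto[OF n] unfolding L_def
      by (intro always_eventually allI LIMSEQ_ignore_initial_segment)
    show "AE s in lborel. norm (scaled_integrand (m + M) (n (m + M)) s) \<le> g s" for m
      using M1 by (intro always_eventually allI) (auto simp: M_def)
    show "(\<lambda>s. complex_of_real (L s)) \<in> borel_measurable lborel"
      unfolding L_def by measurable
  qed measurable
  moreover have "(LINT s|lborel. scaled_integrand (m + M) (n (m + M)) s) = scaled_coeff (m + M) (n (m + M))" for m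
    using M2 by (intro integral_scaled_integrand) (auto simp: M_def)
  ultimately have "(\<lambda>m. scaled_coeff (m + M) (n (m + M))) \<longlonglongrightarrow> (LINT s|lborel. complex_of_real (L s))"
    by simp
  then have "(\<lambda>m. scaled_coeff m (n m)) \<longlonglongrightarrow> (LINT s|lborel. complex_of_real (L s))"
    by (rule LIMSEQ_offset)
  also have "(LINT s|lborel. complex_of_real (L s)) = of_real (LINT s|lborel. L s)"
    by simp
  also have "(LINT s|lborel. L s) = C_limit * (LINT s|lborel. exp (- (Q + 2 * b * s + \<alpha> * (1 + \<alpha>) * s\<^sup>2) / 2))"
    unfolding L_def by simp
  also have "(LINT s|lborel. exp (- (Q + 2 * b * s + \<alpha> * (1 + \<alpha>) * s\<^sup>2) / 2))
    = sqrt (2 * pi / (\<alpha> * (1 + \<alpha>))) * exp (- (Q - b\<^sup>2 / (\<alpha> * (1 + \<alpha>))) / 2)"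
    using has_bochner_integral_gaussian[of "\<alpha> * (1 + \<alpha>)" Q b] \<alpha>
    by (intro has_bochner_integral_integral_eq) simp
  finally show ?thesis by (simp add: mult.assoc)
qed

end

section \<open>Exponential moments of the component counts\<close>

lemma Suc_Suc_diff_two: "2 \<le> k \<Longrightarrow> Suc (Suc (k - 2)) = k"
  by simp

context tilted_paths
begin

text \<open>Free of the tilt, so it cancels in every ratio with the untilted sum.\<close>

definition graph_const :: "nat \<Rightarrow> nat \<Rightarrow> real" where
  "graph_const m n = fact (2 * m + n) / (2 ^ m * fact m) / ((1 - r) ^ m * r ^ n * (sqrt (real m) * (2 * pi)))"

text \<open>Centring the tilt inside each of the m path factors amounts to centring the count of
  size k + 2 at \<open>w k * real m\<close>.\<close>

lemma sum_graphs_exp: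
  assumes "m > 0"
  shows "(\<Sum>E\<in>graphs12 (2 * m) n.
      exp (\<Sum>k<K. \<tau> k * of_real ((real (U (2 * m + n) (k + 2) E) - w k * real m) / sqrt (real m))))
    = of_real (graph_const m n) * scaled_coeff m n"
proof -
  define N where "N = 2 * m + n"
  \<comment> \<open>One factor for each path: \<open>e ^ m\<close> is the exponential of all the
    subtracted means.\<close>
  define e where "e = exp (- mean_tilt / of_real (sqrt (real m)))"
  define g where "g j = (if j < 2 \<or> K + 2 \<le> j then 0 else \<tau> (j - 2) / of_real (sqrt (real m)))" for j
  have mp: "sqrt (real m) > 0" using assms by simp
  have mm: "real m / sqrt (real m) = sqrt (real m)" by (simp add: real_div_sqrt)
  have z: "z m = (\<lambda>j. exp (g j))"
    by (auto simp: z_def g_def \<tau> fun_eq_iff)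
  have wtE: "exp (\<Sum>k<K. \<tau> k * of_real ((real (U N (k + 2) E) - w k * real m) / sqrt (real m)))
    = e ^ m * weight (z m) {1..N} E" for E
  proof -
    have "(\<Sum>j\<in>{2..<K+2}. g j * of_nat (U N j E)) = (\<Sum>k<K. g (k + 2) * of_nat (U N (k + 2) E))"
      by (rule sum.reindex_bij_witness[of _ "\<lambda>k. k + 2" "\<lambda>j. j - 2"])
        (auto simp: Suc_Suc_diff_two)
    moreover have "weight (z m) {1..N} E = exp (\<Sum>j\<in>{2..<K+2}. g j * of_nat (U N j E))"
      unfolding z by (rule weight_exp) (auto simp: g_def)
    ultimately have wt: "weight (z m) {1..N} E = exp (\<Sum>k<K. \<tau> k / of_real (sqrt (real m)) * of_nat (U N (k + 2) E))"
      by (simp add: g_def)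
    have "e ^ m = exp (of_nat m * (- mean_tilt / of_real (sqrt (real m))))"
      unfolding e_def by (rule exp_of_nat_mult[symmetric])
    also have "of_nat m * (- mean_tilt / of_real (sqrt (real m))) = (\<Sum>k<K. - (\<tau> k * of_real (w k * real m / sqrt (real m))))"
      unfolding mean_tilt_def sum_negf sum_distrib_left sum_divide_distrib minus_divide_left[symmetric] mult_minus_right
      by (simp add: mult_ac)
    finally have em: "e ^ m = exp (\<Sum>k<K. - (\<tau> k * of_real (w k * real m / sqrt (real m))))" .
    show ?thesis
      unfolding em wt exp_add[symmetric] sum.distrib[symmetric]
      by (intro arg_cong[where f = exp] sum.cong refl) (simp add: diff_divide_distrib right_diff_distrib)
  qed
  have "(\<Sum>E\<in>graphs12 (2 * m) n.
      exp (\<Sum>k<K. \<tau> k * of_real ((real (U N (k + 2) E) - w k * real m) / sqrt (real m))))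
    = (\<Sum>E\<in>graphs12 (2 * m) n. e ^ m * weight (z m) {1..N} E)"
    by (intro sum.cong refl wtE)
  also have "\<dots> = e ^ m * (fact N / (2 ^ m * fact m) * path_coeff (z m) m n)"
    unfolding N_def sum_distrib_left[symmetric] sum_graphs12_weight ..
  also have "\<dots> = of_real (graph_const m n) * scaled_coeff m n"
  proof -
    have "of_real (1 - r) \<noteq> (0::complex)" "of_real r \<noteq> (0::complex)" "of_real (sqrt (real m)) \<noteq> (0::complex)"
      using r mp by (simp_all del: of_real_diff)
    then show ?thesis
      unfolding scaled_coeff_def conv_pow_a_c e_def[symmetric] graph_const_def N_def
      by (simp add: power_mult_distrib field_simps del: of_real_diff)
  qed
  finally show ?thesis by (simp add: N_def)
qed

end

section \<open>Ratios of exponential moments over the random graphs\<close>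

lemma n2_of_approx:
  assumes "\<alpha> > 0"
  shows "\<bar>\<alpha> * real m - real (n2_of \<alpha> (2 * m))\<bar> \<le> 1"
proof -
  have "n2_of \<alpha> (2 * m) = nat \<lfloor>\<alpha> * real m\<rfloor>" by (simp add: n2_of_def)
  moreover have "0 \<le> \<alpha> * real m" using assms by simp
  ultimately have "real (n2_of \<alpha> (2 * m)) = of_int \<lfloor>\<alpha> * real m\<rfloor>" by simp
  then show ?thesis by linarith
qed

lemma finite_graphs12: "finite (graphs12 (2 * m) n)"
  unfolding graphs12_eq by (rule finite_pc_graphs) simp

definition random_graphs :: "real \<Rightarrow> nat \<Rightarrow> nat set set set" where
  "random_graphs \<alpha> m = graphs12 (2 * m) (n2_of \<alpha> (2 * m))"

definition normalized_count :: "real \<Rightarrow> nat \<Rightarrow> nat set set \<Rightarrow> nat \<Rightarrow> real" where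
  "normalized_count \<alpha> m E j = (real (U (2 * m + n2_of \<alpha> (2 * m)) j E) - cU \<alpha> j * real m) / sqrt (real m)"

lemma finite_random_graphs: "finite (random_graphs \<alpha> m)"
  by (simp add: random_graphs_def finite_graphs12)

text \<open>Identifies the constant of the theorem as the probability that a path has k interior
  vertices, that is, k + 2 vertices in all.\<close>

lemma (in tilted_paths) w_eq_cU: "w k = cU \<alpha> (k + 2)"
  by (simp add: w_def one_minus_r) (simp add: r_def cU_def power_divide)

lemma (in tilted_paths) sum_random_graphs_exp:
  assumes "m > 0"
  shows "(\<Sum>E\<in>random_graphs \<alpha> m. exp (\<Sum>k<K. \<tau> k * of_real (normalized_count \<alpha> m E (k + 2))))
    = of_real (graph_const m (n2_of \<alpha> (2 * m))) * scaled_coeff m (n2_of \<alpha> (2 * m))"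
  using sum_graphs_exp[OF assms, of "n2_of \<alpha> (2 * m)"]
  by (simp add: random_graphs_def normalized_count_def w_eq_cU)

lemma (in tilted_paths) graph_const_pos: "m > 0 \<Longrightarrow> graph_const m n > 0"
  using r by (simp add: graph_const_def)

text \<open>The denominator of all ratios. The zero tilt is written as a product with \<i> so that
  it is literally an instance of \<open>imaginary_tilt\<close>.\<close>

definition base_coeff :: "real \<Rightarrow> nat \<Rightarrow> nat \<Rightarrow> complex" where
  "base_coeff \<alpha> K m = tilted_paths.scaled_coeff \<alpha> K (\<lambda>k. \<i> * of_real 0) m (n2_of \<alpha> (2 * m))"

definition base_limit :: "real \<Rightarrow> real" where
  "base_limit \<alpha> = tilted_paths.C_limit \<alpha> * sqrt (2 * pi / (\<alpha> * (1 + \<alpha>)))"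

lemma base_limit_pos:
  assumes "\<alpha> > 0"
  shows "base_limit \<alpha> > 0"
proof -
  interpret Z: tilted_paths \<alpha> 0 "\<lambda>_. 0" using assms by unfold_locales auto
  show ?thesis using Z.C_limit_pos assms by (simp add: base_limit_def)
qed

lemma base_coeff_tendsto:
  assumes "\<alpha> > 0"
  shows "base_coeff \<alpha> K \<longlonglongrightarrow> of_real (base_limit \<alpha>)"
proof -
  interpret Z: imaginary_tilt \<alpha> K "\<lambda>_. 0" using assms by unfold_locales auto
  have "Z.Q = 0" "Z.b = 0" by (simp_all add: Z.Q_def Z.mean_t_def Z.b_def)
  then have "of_real (Z.C_limit * sqrt (2 * pi / (\<alpha> * (1 + \<alpha>))) * exp (- (Z.Q - Z.b\<^sup>2 / (\<alpha> * (1 + \<alpha>))) / 2))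
    = complex_of_real (base_limit \<alpha>)"
    by (simp add: base_limit_def)
  then show ?thesis
    using Z.scaled_coeff_tendsto[OF n2_of_approx[OF assms]] unfolding base_coeff_def[abs_def] by (simp only:)
qed

text \<open>With zero tilt the sum counts the graphs, so dividing by the cardinality cancels
  \<open>graph_const\<close>. For large m the denominator is nonzero because its limit is positive,
  and this also shows that graphs of this kind exist.\<close>

lemma random_graphs_exp:
  fixes \<tau> :: "nat \<Rightarrow> complex"
  assumes \<alpha>: "\<alpha> > 0" and \<tau>: "\<And>k. k \<ge> K \<Longrightarrow> \<tau> k = 0"
  shows "\<exists>M. \<forall>m\<ge>M. random_graphs \<alpha> m \<noteq> {} \<and>
    (\<Sum>E\<in>random_graphs \<alpha> m. exp (\<Sum>k<K. \<tau> k * of_real (normalized_count \<alpha> m E (k + 2)))) / of_nat (card (random_graphs \<alpha> m))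
    = tilted_paths.scaled_coeff \<alpha> K \<tau> m (n2_of \<alpha> (2 * m)) / base_coeff \<alpha> K m"
proof -
  interpret T: tilted_paths \<alpha> K \<tau> using assms by unfold_locales
  interpret Z: imaginary_tilt \<alpha> K "\<lambda>_. 0" using assms by unfold_locales auto
  have "complex_of_real (base_limit \<alpha>) \<noteq> 0" using base_limit_pos[OF \<alpha>] by simp
  then have "eventually (\<lambda>m. base_coeff \<alpha> K m \<noteq> 0) sequentially"
    by (rule tendsto_imp_eventually_ne[OF base_coeff_tendsto[OF \<alpha>]])
  then obtain M where M: "\<And>m. m \<ge> M \<Longrightarrow> base_coeff \<alpha> K m \<noteq> 0"
    by (auto simp: eventually_sequentially)
  show ?thesis
  proof (intro exI[of _ "Suc M"] allI impI conjI)
    fix m assume m: "m \<ge> Suc M"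
    then have mp: "m > 0" by simp
    define g where "g = complex_of_real (T.graph_const m (n2_of \<alpha> (2 * m)))"
    have g: "g \<noteq> 0" using T.graph_const_pos[OF mp, of "n2_of \<alpha> (2 * m)"] by (simp add: g_def)
    have gZ: "complex_of_real (Z.graph_const m (n2_of \<alpha> (2 * m))) = g"
      by (simp only: g_def Z.graph_const_def T.graph_const_def)
    have "(\<Sum>E\<in>random_graphs \<alpha> m. exp (\<Sum>k<K. \<i> * of_real 0 * of_real (normalized_count \<alpha> m E (k + 2))))
      = of_nat (card (random_graphs \<alpha> m))" by simp
    then have card: "of_nat (card (random_graphs \<alpha> m)) = g * base_coeff \<alpha> K m"
      using Z.sum_random_graphs_exp[OF mp] unfolding gZ base_coeff_def by (simp only:)
    have "(of_nat (card (random_graphs \<alpha> m)) :: complex) \<noteq> 0"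
      unfolding card using g M m by simp
    then show "random_graphs \<alpha> m \<noteq> {}" by auto
    show "(\<Sum>E\<in>random_graphs \<alpha> m. exp (\<Sum>k<K. \<tau> k * of_real (normalized_count \<alpha> m E (k + 2)))) / of_nat (card (random_graphs \<alpha> m))
      = T.scaled_coeff m (n2_of \<alpha> (2 * m)) / base_coeff \<alpha> K m"
      unfolding T.sum_random_graphs_exp[OF mp] card g_def[symmetric]
      by (rule mult_divide_mult_cancel_left[OF g])
  qed
qed

lemma Hmat_eq:
  assumes "\<alpha> > 0" "i \<ge> 2" "j \<ge> 2"
  shows "Hmat \<alpha> i j = - cU \<alpha> i * cU \<alpha> j * (1 + (real i - 2 - \<alpha>) * (real j - 2 - \<alpha>) / (\<alpha> * (1 + \<alpha>)))
    + (if i = j then cU \<alpha> i else 0)"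
proof -
  obtain i' j' where ij: "i = i' + 2" "j = j' + 2"
    using assms(2,3) by (metis add.commute le_Suc_ex)
  show ?thesis
    unfolding ij Hmat_def cU_def by (simp add: power_add power_divide)
qed

text \<open>A diagonal matrix minus two outer products: the form is a variance minus a squared
  covariance divided by the variance of the path length, which is the exponent left by the Gaussian
  integral.\<close>

lemma quadratic_form_Hmat:
  fixes s :: "nat \<Rightarrow> real"
  assumes "\<alpha> > 0"
  shows "(\<Sum>i=2..q. \<Sum>j=2..q. s i * Hmat \<alpha> i j * s j) =
    (\<Sum>i=2..q. cU \<alpha> i * (s i)\<^sup>2) - (\<Sum>i=2..q. cU \<alpha> i * s i)\<^sup>2
      - (\<Sum>i=2..q. cU \<alpha> i * s i * (real i - 2 - \<alpha>))\<^sup>2 / (\<alpha> * (1 + \<alpha>))"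
proof -
  define p where "p i = cU \<alpha> i * s i" for i
  define g where "g i = p i * (real i - 2 - \<alpha>)" for i
  have "s i * Hmat \<alpha> i j * s j = (if i = j then cU \<alpha> i * (s i)\<^sup>2 else 0) - p i * p j - g i * g j / (\<alpha> * (1 + \<alpha>))"
    if "i \<in> {2..q}" "j \<in> {2..q}" for i j
    using that assms unfolding p_def g_def
    by (subst Hmat_eq) (auto simp: algebra_simps power2_eq_square add_divide_distrib diff_divide_distrib)
  then have "(\<Sum>i=2..q. \<Sum>j=2..q. s i * Hmat \<alpha> i j * s j)
    = (\<Sum>i=2..q. \<Sum>j=2..q. (if i = j then cU \<alpha> i * (s i)\<^sup>2 else 0) - p i * p j - g i * g j / (\<alpha> * (1 + \<alpha>)))"
    by (intro sum.cong refl)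
  also have "\<dots> = (\<Sum>i=2..q. cU \<alpha> i * (s i)\<^sup>2) - (\<Sum>i=2..q. p i)\<^sup>2 - (\<Sum>i=2..q. g i)\<^sup>2 / (\<alpha> * (1 + \<alpha>))"
    by (simp add: sum_subtractf power2_eq_square sum_product sum_divide_distrib)
  finally show ?thesis by (simp add: p_def g_def)
qed

lemma random_graphs_char_tendsto:
  fixes s :: "nat \<Rightarrow> real"
  assumes \<alpha>: "\<alpha> > 0"
  shows "(\<lambda>m. (\<Sum>E\<in>random_graphs \<alpha> m. iexp (\<Sum>j=2..q. s j * normalized_count \<alpha> m E j)) / of_nat (card (random_graphs \<alpha> m)))
    \<longlonglongrightarrow> of_real (exp (- (\<Sum>i=2..q. \<Sum>j=2..q. s i * Hmat \<alpha> i j * s j) / 2))"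
proof -
  \<comment> \<open>Sizes 2 to q correspond to k + 2 with \<open>k < K\<close>; for
    \<open>q \<le> 1\<close> both ranges are empty.\<close>
  define K where "K = q - 1"
  define t where "t k = (if k < K then s (k + 2) else 0)" for k
  have re: "(\<Sum>j=2..q. f j) = (\<Sum>k<K. f (k + 2))" for f :: "nat \<Rightarrow> real"
    by (rule sum.reindex_bij_witness[of _ "\<lambda>k. k + 2" "\<lambda>j. j - 2"])
      (auto simp: K_def Suc_Suc_diff_two)
  interpret T: imaginary_tilt \<alpha> K t using assms by unfold_locales (auto simp: t_def)
  have "T.mean_t = (\<Sum>j=2..q. cU \<alpha> j * s j)"
    unfolding T.mean_t_def re by (intro sum.cong) (auto simp: T.w_eq_cU t_def)
  moreover have "(\<Sum>k<K. T.w k * (t k)\<^sup>2) = (\<Sum>j=2..q. cU \<alpha> j * (s j)\<^sup>2)"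
    unfolding re by (intro sum.cong) (auto simp: T.w_eq_cU t_def)
  moreover have "T.b = (\<Sum>j=2..q. cU \<alpha> j * s j * (real j - 2 - \<alpha>))"
    unfolding T.b_def re by (intro sum.cong) (auto simp: T.w_eq_cU t_def)
  ultimately have quad: "T.Q - T.b\<^sup>2 / (\<alpha> * (1 + \<alpha>)) = (\<Sum>i=2..q. \<Sum>j=2..q. s i * Hmat \<alpha> i j * s j)"
    unfolding quadratic_form_Hmat[OF \<alpha>] by (simp add: T.Q_def)
  define R where "R = (\<Sum>i=2..q. \<Sum>j=2..q. s i * Hmat \<alpha> i j * s j)"
  have L: "complex_of_real (base_limit \<alpha>) \<noteq> 0" using base_limit_pos[OF \<alpha>] by simp
  have "(\<lambda>m. T.scaled_coeff m (n2_of \<alpha> (2 * m))) \<longlonglongrightarrow> of_real (base_limit \<alpha> * exp (- R / 2))"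
    using T.scaled_coeff_tendsto[OF n2_of_approx[OF \<alpha>]] unfolding quad base_limit_def R_def .
  then have "(\<lambda>m. T.scaled_coeff m (n2_of \<alpha> (2 * m)) / base_coeff \<alpha> K m)
    \<longlonglongrightarrow> of_real (base_limit \<alpha> * exp (- R / 2)) / of_real (base_limit \<alpha>)"
    by (rule tendsto_divide[OF _ base_coeff_tendsto[OF \<alpha>] L])
  also have "of_real (base_limit \<alpha> * exp (- R / 2)) / of_real (base_limit \<alpha>) = complex_of_real (exp (- R / 2))"
    using L by simp
  finally have lim: "(\<lambda>m. T.scaled_coeff m (n2_of \<alpha> (2 * m)) / base_coeff \<alpha> K m)
    \<longlonglongrightarrow> complex_of_real (exp (- R / 2))" .
  obtain M where M: "\<forall>m\<ge>M. random_graphs \<alpha> m \<noteq> {} \<and>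
    (\<Sum>E\<in>random_graphs \<alpha> m. exp (\<Sum>k<K. \<i> * of_real (t k) * of_real (normalized_count \<alpha> m E (k + 2)))) / of_nat (card (random_graphs \<alpha> m))
    = T.scaled_coeff m (n2_of \<alpha> (2 * m)) / base_coeff \<alpha> K m"
    using random_graphs_exp[OF \<alpha>, of K "\<lambda>k. \<i> * of_real (t k)"] T.\<tau> by auto
  have ex: "exp (\<Sum>k<K. \<i> * of_real (t k) * of_real (normalized_count \<alpha> m E (k + 2)))
    = iexp (\<Sum>j=2..q. s j * normalized_count \<alpha> m E j)" for m E
    unfolding re of_real_sum sum_distrib_left
    by (intro arg_cong[where f = exp] sum.cong) (auto simp: t_def)
  show ?thesis
    unfolding R_def[symmetric]
  proof (rule Lim_transform_eventually[OF lim])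
    show "eventually (\<lambda>m. T.scaled_coeff m (n2_of \<alpha> (2 * m)) / base_coeff \<alpha> K m
      = (\<Sum>E\<in>random_graphs \<alpha> m. iexp (\<Sum>j=2..q. s j * normalized_count \<alpha> m E j)) / of_nat (card (random_graphs \<alpha> m))) sequentially"
      using eventually_ge_at_top[of M] by eventually_elim (use M in \<open>simp only: ex\<close>)
  qed
qed

section \<open>Second moments\<close>

text \<open>From (1 - y/4)^2 >= 0 follows y <= (1 + y/4)^2; squaring gives a fourth power, which exp
  y dominates.\<close>

lemma square_le_exp:
  fixes y :: real
  assumes "y \<ge> 0"
  shows "y\<^sup>2 \<le> exp y"
proof -
  have "0 \<le> (1 - y / 4)\<^sup>2" by simp
  then have "y \<le> (1 + y / 4)\<^sup>2" by (simp add: power2_eq_square algebra_simps)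
  then have "y\<^sup>2 \<le> ((1 + y / 4)\<^sup>2)\<^sup>2" using assms by (intro power_mono)
  also have "\<dots> = (1 + y / 4) ^ 4" by simp
  also have "\<dots> \<le> exp (y / 4) ^ 4"
    using assms exp_ge_add_one_self[of "y / 4"] by (intro power_mono) auto
  also have "\<dots> = exp y" by (simp flip: exp_of_nat_mult)
  finally show ?thesis .
qed

lemma square_le_exp_add_exp:
  fixes x :: real
  shows "x\<^sup>2 \<le> exp x + exp (- x)"
  using square_le_exp[of x] square_le_exp[of "- x"] exp_gt_zero[of x] exp_gt_zero[of "- x"]
  by (cases "x \<ge> 0") (simp_all add: add_increasing add_increasing2)

text \<open>A square is at most the sum of the exponentials with both signs, so real tilts 1 and -1
  at the single size j suffice. The numerator is bounded, and the denominator eventually exceeds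
  half its positive limit.\<close>

lemma random_graphs_second_moment:
  assumes \<alpha>: "\<alpha> > 0" and j: "j \<ge> 2"
  shows "\<exists>B M. \<forall>m\<ge>M. random_graphs \<alpha> m \<noteq> {} \<and>
    unif_mean (random_graphs \<alpha> m) (\<lambda>E. (normalized_count \<alpha> m E j)\<^sup>2) \<le> B"
proof -
  define K where "K = j - 1"
  have exp_bounded: "\<exists>B M. \<forall>m\<ge>M. random_graphs \<alpha> m \<noteq> {} \<and>
    unif_mean (random_graphs \<alpha> m) (\<lambda>E. exp (\<epsilon> * normalized_count \<alpha> m E j)) \<le> B" for \<epsilon> :: real
  proof -
    define \<tau> where "\<tau> k = (if k = j - 2 then complex_of_real \<epsilon> else 0)" for k
    interpret T: tilted_paths \<alpha> K \<tau> using \<alpha> j by unfold_locales (auto simp: \<tau>_def K_def)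
    define L where "L = base_limit \<alpha>"
    have L: "L > 0" using base_limit_pos[OF \<alpha>] by (simp add: L_def)
    have "(\<lambda>m. norm (base_coeff \<alpha> K m)) \<longlonglongrightarrow> norm (complex_of_real L)"
      unfolding L_def by (intro tendsto_norm base_coeff_tendsto \<alpha>)
    then have "eventually (\<lambda>m. L / 2 < norm (base_coeff \<alpha> K m)) sequentially"
      using L by (intro order_tendstoD(1)) auto
    then obtain M1 where M1: "\<And>m. m \<ge> M1 \<Longrightarrow> L / 2 < norm (base_coeff \<alpha> K m)"
      by (auto simp: eventually_sequentially)
    obtain B M2 where M2: "\<forall>m\<ge>M2. \<forall>n. norm (T.scaled_coeff m n) \<le> B" using T.scaled_coeff_bounded by auto
    obtain M3 where M3: "\<forall>m\<ge>M3. random_graphs \<alpha> m \<noteq> {} \<and>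
      (\<Sum>E\<in>random_graphs \<alpha> m. exp (\<Sum>k<K. \<tau> k * of_real (normalized_count \<alpha> m E (k + 2)))) / of_nat (card (random_graphs \<alpha> m))
      = T.scaled_coeff m (n2_of \<alpha> (2 * m)) / base_coeff \<alpha> K m"
      using random_graphs_exp[OF \<alpha>, of K \<tau>] T.\<tau> by auto
    show ?thesis
    proof (intro exI[of _ "B / (L / 2)"] exI[of _ "max M1 (max M2 M3)"] allI impI conjI)
      fix m assume m: "m \<ge> max M1 (max M2 M3)"
      then show "random_graphs \<alpha> m \<noteq> {}" using M3 by auto
      have ex: "exp (\<Sum>k<K. \<tau> k * of_real (normalized_count \<alpha> m E (k + 2))) = of_real (exp (\<epsilon> * normalized_count \<alpha> m E j))" for E
      proof -
        have "(\<Sum>k<K. \<tau> k * of_real (normalized_count \<alpha> m E (k + 2)))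
          = (\<Sum>k<K. if k = j - 2 then of_real (\<epsilon> * normalized_count \<alpha> m E j) else 0)"
          using j by (intro sum.cong) (auto simp: \<tau>_def Suc_Suc_diff_two)
        also have "\<dots> = of_real (\<epsilon> * normalized_count \<alpha> m E j)"
          using j by (simp add: K_def)
        finally show ?thesis by (simp only: exp_of_real)
      qed
      have "complex_of_real (unif_mean (random_graphs \<alpha> m) (\<lambda>E. exp (\<epsilon> * normalized_count \<alpha> m E j)))
        = T.scaled_coeff m (n2_of \<alpha> (2 * m)) / base_coeff \<alpha> K m"
      proof -
        have "complex_of_real (unif_mean (random_graphs \<alpha> m) (\<lambda>E. exp (\<epsilon> * normalized_count \<alpha> m E j)))
          = (\<Sum>E\<in>random_graphs \<alpha> m. of_real (exp (\<epsilon> * normalized_count \<alpha> m E j))) / of_nat (card (random_graphs \<alpha> m))"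
          unfolding unif_mean_def of_real_divide of_real_sum by simp
        moreover have M3m: "M3 \<le> m" using m by simp
        ultimately show ?thesis using M3[rule_format, OF M3m, THEN conjunct2, unfolded ex] by (simp only:)
      qed
      then have "\<bar>unif_mean (random_graphs \<alpha> m) (\<lambda>E. exp (\<epsilon> * normalized_count \<alpha> m E j))\<bar>
        = norm (T.scaled_coeff m (n2_of \<alpha> (2 * m))) / norm (base_coeff \<alpha> K m)"
        by (metis norm_divide norm_of_real)
      also have "\<dots> \<le> B / (L / 2)"
      proof (rule frac_le)
        show "norm (T.scaled_coeff m (n2_of \<alpha> (2 * m))) \<le> B" using M2 m by simp
        then show "0 \<le> B" using norm_ge_zero order_trans by blast
        show "0 < L / 2" "L / 2 \<le> norm (base_coeff \<alpha> K m)" using L M1[of m] m by simp_all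
      qed
      finally show "unif_mean (random_graphs \<alpha> m) (\<lambda>E. exp (\<epsilon> * normalized_count \<alpha> m E j)) \<le> B / (L / 2)"
        by linarith
    qed
  qed
  obtain B1 M1 where 1: "\<forall>m\<ge>M1. random_graphs \<alpha> m \<noteq> {} \<and>
    unif_mean (random_graphs \<alpha> m) (\<lambda>E. exp (1 * normalized_count \<alpha> m E j)) \<le> B1"
    using exp_bounded by blast
  obtain B2 M2 where 2: "\<forall>m\<ge>M2. random_graphs \<alpha> m \<noteq> {} \<and>
    unif_mean (random_graphs \<alpha> m) (\<lambda>E. exp ((-1) * normalized_count \<alpha> m E j)) \<le> B2"
    using exp_bounded by blast
  show ?thesis
  proof (intro exI[of _ "B1 + B2"] exI[of _ "max M1 M2"] allI impI conjI)
    fix m assume m: "m \<ge> max M1 M2"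
    then show "random_graphs \<alpha> m \<noteq> {}" using 1 by auto
    have "unif_mean (random_graphs \<alpha> m) (\<lambda>E. (normalized_count \<alpha> m E j)\<^sup>2)
      \<le> unif_mean (random_graphs \<alpha> m) (\<lambda>E. exp (1 * normalized_count \<alpha> m E j) + exp ((-1) * normalized_count \<alpha> m E j))"
      unfolding unif_mean_def using square_le_exp_add_exp
      by (intro divide_right_mono sum_mono) auto
    also have "\<dots> = unif_mean (random_graphs \<alpha> m) (\<lambda>E. exp (1 * normalized_count \<alpha> m E j))
      + unif_mean (random_graphs \<alpha> m) (\<lambda>E. exp ((-1) * normalized_count \<alpha> m E j))"
      by (simp add: unif_mean_def sum.distrib add_divide_distrib)
    also have "\<dots> \<le> B1 + B2" using 1 2 m by (intro add_mono) auto
    finally show "unif_mean (random_graphs \<alpha> m) (\<lambda>E. (normalized_count \<alpha> m E j)\<^sup>2) \<le> B1 + B2" .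
  qed
qed

section \<open>Gaussian limits from characteristic functions\<close>

text \<open>The real functions whose expectations are determined linearly by the characteristic
  function; zero frequency gives the constants.\<close>

inductive trig_poly :: "'i set \<Rightarrow> (('i \<Rightarrow> real) \<Rightarrow> real) \<Rightarrow> bool" for I where
  cos: "trig_poly I (\<lambda>x. c * cos (\<Sum>i\<in>I. s i * x i))"
| sin: "trig_poly I (\<lambda>x. c * sin (\<Sum>i\<in>I. s i * x i))"
| add: "trig_poly I f \<Longrightarrow> trig_poly I g \<Longrightarrow> trig_poly I (\<lambda>x. f x + g x)"

lemma trig_poly_const: "trig_poly I (\<lambda>_. c)"
  using trig_poly.cos[of I c "\<lambda>_. 0"] by simp

text \<open>Product-to-sum formulas; the remaining mixed order follows by commutativity.\<close>

lemma trig_poly_mult_basic: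
  fixes s t :: "'i \<Rightarrow> real" and I :: "'i set"
  defines "p \<equiv> \<lambda>s x. \<Sum>i\<in>I. s i * x i"
  shows "trig_poly I (\<lambda>x. (c * cos (p s x)) * (d * cos (p t x)))"
    and "trig_poly I (\<lambda>x. (c * cos (p s x)) * (d * sin (p t x)))"
    and "trig_poly I (\<lambda>x. (c * sin (p s x)) * (d * sin (p t x)))"
proof -
  have pp: "p s x + p t x = p (\<lambda>i. s i + t i) x" "p s x - p t x = p (\<lambda>i. s i - t i) x"
    for s t :: "'i \<Rightarrow> real" and x
    by (simp_all add: p_def sum.distrib sum_subtractf algebra_simps)
  have "(\<lambda>x. (c * cos (p s x)) * (d * cos (p t x)))
    = (\<lambda>x. (c * d / 2) * cos (p (\<lambda>i. s i - t i) x) + (c * d / 2) * cos (p (\<lambda>i. s i + t i) x))"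
    unfolding pp[symmetric] by (simp add: fun_eq_iff cos_add cos_diff field_simps)
  then show "trig_poly I (\<lambda>x. (c * cos (p s x)) * (d * cos (p t x)))"
    unfolding p_def by (simp only:) (intro trig_poly.intros)
  have "(\<lambda>x. (c * cos (p s x)) * (d * sin (p t x)))
    = (\<lambda>x. (c * d / 2) * sin (p (\<lambda>i. s i + t i) x) + (- c * d / 2) * sin (p (\<lambda>i. s i - t i) x))"
    unfolding pp[symmetric] by (simp add: fun_eq_iff sin_add sin_diff field_simps)
  then show "trig_poly I (\<lambda>x. (c * cos (p s x)) * (d * sin (p t x)))"
    unfolding p_def by (simp only:) (intro trig_poly.intros)
  have "(\<lambda>x. (c * sin (p s x)) * (d * sin (p t x)))
    = (\<lambda>x. (c * d / 2) * cos (p (\<lambda>i. s i - t i) x) + (- c * d / 2) * cos (p (\<lambda>i. s i + t i) x))"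
    unfolding pp[symmetric] by (simp add: fun_eq_iff cos_add cos_diff field_simps)
  then show "trig_poly I (\<lambda>x. (c * sin (p s x)) * (d * sin (p t x)))"
    unfolding p_def by (simp only:) (intro trig_poly.intros)
qed

lemma trig_poly_mult:
  assumes "trig_poly I f" "trig_poly I g"
  shows "trig_poly I (\<lambda>x. f x * g x)"
  using assms(1)
proof induction
  case (cos c s)
  show ?case
    using assms(2)
  proof induction
    case (add f g)
    then show ?case using trig_poly.add[OF add.IH] by (simp add: distrib_left)
  qed (rule trig_poly_mult_basic)+
next
  case (sin c s)
  show ?case
    using assms(2)
  proof induction
    case (cos d t)
    then show ?case using trig_poly_mult_basic(2)[of I d t c s] by (simp only: mult_ac)
  next
    case (add f g)
    then show ?case using trig_poly.add[OF add.IH] by (simp add: distrib_left)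
  qed (rule trig_poly_mult_basic)
next
  case (add f g)
  then show ?case using trig_poly.add[OF add.IH] by (simp add: distrib_right)
qed

text \<open>Vectors are functions on the whole index type, so coordinates outside \<open>I\<close>
  are pinned to 0 to obtain a product of compact sets.\<close>

lemma compact_cube:
  "compact {v :: 'i \<Rightarrow> real. \<forall>i. v i \<in> (if i \<in> I then {-1..1} else {0})}"
proof -
  have "compactin (product_topology (\<lambda>_. euclidean) UNIV) (PiE UNIV (\<lambda>i::'i. if i \<in> I then {-1..1::real} else {0}))"
    by (subst compactin_PiE) (auto simp: compactin_euclidean_iff)
  moreover have "PiE UNIV (\<lambda>i::'i. if i \<in> I then {-1..1::real} else {0})
    = {v :: 'i \<Rightarrow> real. \<forall>i. v i \<in> (if i \<in> I then {-1..1} else {0})}"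
    by (auto simp: PiE_def Pi_def split: if_splits)
  ultimately show ?thesis
    by (simp only: euclidean_product_topology compactin_euclidean_iff)
qed

text \<open>Continuous functions on a large cube are functions of the \<open>sin (x i / \<rho>)\<close>; polynomials in these
  sines are trigonometric polynomials and, unlike ordinary polynomials, stay bounded off the cube.\<close>
lemma trig_poly_approx:
  fixes f :: "('i::countable \<Rightarrow> real) \<Rightarrow> real"
  assumes I: "finite I" and f: "continuous_on UNIV f" and B: "\<And>x. \<bar>f x\<bar> \<le> B"
    and \<rho>: "\<rho> > 0" and \<epsilon>: "\<epsilon> > 0"
  shows "\<exists>g. trig_poly I g \<and> (\<forall>x. (\<forall>i. i \<notin> I \<longrightarrow> x i = 0) \<longrightarrow>
    \<bar>f x - g x\<bar> \<le> \<epsilon> + 2 * B * min 1 (\<Sum>i\<in>I. (x i / \<rho>)\<^sup>2))"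
proof -
  define Q where "Q = {v :: 'i \<Rightarrow> real. \<forall>i. v i \<in> (if i \<in> I then {-1..1} else {0})}"
  define \<phi> where "\<phi> x = (\<lambda>i. if i \<in> I then sin (x i / \<rho>) else 0)" for x :: "'i \<Rightarrow> real"
  \<comment> \<open>The algebra for Stone-Weierstrass: functions on the cube that become
    trigonometric polynomials when the sines are substituted. Coordinates belong to it and separate
    points.\<close>
  define R where "R = {F. continuous_on Q F \<and> trig_poly I (\<lambda>x. F (\<phi> x))}"
  have Q\<phi>: "\<phi> x \<in> Q" for x by (simp add: Q_def \<phi>_def)
  interpret function_ring_on R Q
  proof
    show "compact Q" unfolding Q_def by (rule compact_cube)
    fix f g assume "f \<in> R" "g \<in> R"
    then show "(\<lambda>x. f x + g x) \<in> R" "(\<lambda>x. f x * g x) \<in> R"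
      by (auto simp: R_def intro: continuous_intros trig_poly.add trig_poly_mult)
  next
    fix x y assume xy: "x \<in> Q" "y \<in> Q" "x \<noteq> y"
    then obtain i where i: "x i \<noteq> y i" by auto
    have "x i \<in> (if i \<in> I then {-1..1} else {0})" "y i \<in> (if i \<in> I then {-1..1} else {0})"
      using xy unfolding Q_def by blast+
    then have iI: "i \<in> I" using i by (cases "i \<in> I") auto
    have "(\<lambda>x. 1 * sin (\<Sum>j\<in>I. (if j = i then 1 / \<rho> else 0) * x j)) = (\<lambda>x. \<phi> x i)"
      using I iI by (simp add: \<phi>_def if_distrib[of "\<lambda>c. c * _"] cong: if_cong)
    then have "trig_poly I (\<lambda>x. \<phi> x i)" using trig_poly.sin[of I 1] by metis
    then have "(\<lambda>v. v i) \<in> R"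
      by (auto simp: R_def intro!: continuous_on_subset[OF continuous_on_product_coordinates])
    then show "\<exists>f\<in>R. f x \<noteq> f y" by (rule bexI[rotated]) (rule i)
  qed (auto simp: R_def trig_poly_const)
  \<comment> \<open>Undoes the substitution by sines, so that \<open>F\<close> composed with \<phi>
    agrees with f wherever all coordinates are at most \<rho> * pi / 2 in modulus.\<close>
  define F where "F v = f (\<lambda>i. if i \<in> I then \<rho> * arcsin (v i) else 0)" for v
  have "continuous_on Q F"
    unfolding F_def
  proof (rule continuous_on_compose2[OF f])
    show "continuous_on Q (\<lambda>v i. if i \<in> I then \<rho> * arcsin (v i) else 0)"
    proof (rule continuous_on_coordinatewise_then_product)
      fix i
      show "continuous_on Q (\<lambda>v. if i \<in> I then \<rho> * arcsin (v i) else 0)"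
      proof (cases "i \<in> I")
        case True
        have "continuous_on Q (\<lambda>v. arcsin (v i))"
          by (rule continuous_on_arcsin)
             (use True in \<open>auto simp: Q_def intro: continuous_on_subset[OF continuous_on_product_coordinates] split: if_splits\<close>)
        then show ?thesis using True by (auto intro: continuous_intros)
      qed auto
    qed
  qed auto
  from Stone_Weierstrass_basic[OF this \<epsilon>] obtain G where G: "G \<in> R" "\<And>v. v \<in> Q \<Longrightarrow> \<bar>F v - G v\<bar> < \<epsilon>"
    by auto
  show ?thesis
  proof (intro exI[of _ "\<lambda>x. G (\<phi> x)"] conjI allI impI)
    show "trig_poly I (\<lambda>x. G (\<phi> x))" using G(1) by (simp add: R_def)
    fix x :: "'i \<Rightarrow> real" assume x: "\<forall>i. i \<notin> I \<longrightarrow> x i = 0"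
    have FG: "\<bar>F (\<phi> x) - G (\<phi> x)\<bar> \<le> \<epsilon>" using G(2)[OF Q\<phi>[of x]] by simp
    have "\<bar>f x - F (\<phi> x)\<bar> \<le> 2 * B * min 1 (\<Sum>i\<in>I. (x i / \<rho>)\<^sup>2)"
    proof (cases "\<forall>i\<in>I. \<bar>x i / \<rho>\<bar> \<le> pi / 2")
      case True
      have "\<rho> * arcsin (sin (x i / \<rho>)) = x i" if "i \<in> I" for i
      proof -
        have "\<bar>x i / \<rho>\<bar> \<le> pi / 2" using True that by blast
        then have "arcsin (sin (x i / \<rho>)) = x i / \<rho>" by (intro arcsin_sin) linarith+
        then show ?thesis using \<rho> by simp
      qed
      then have "(\<lambda>i. if i \<in> I then \<rho> * arcsin (\<phi> x i) else 0) = x"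
        using x by (auto simp: \<phi>_def fun_eq_iff)
      then have "F (\<phi> x) = f x" by (simp add: F_def)
      moreover have "0 \<le> B" using B[of x] by linarith
      ultimately show ?thesis by (simp add: sum_nonneg)
    next
      \<comment> \<open>Some coordinate exceeds pi / 2 > 1 after scaling, so the minimum is 1 and
        the trivial bound 2 * B suffices.\<close>
      case False
      then obtain i where i: "i \<in> I" "\<bar>x i / \<rho>\<bar> > pi / 2" by auto
      then have "1 \<le> \<bar>x i / \<rho>\<bar>" using pi_gt3 by linarith
      then have "1 \<le> \<bar>x i / \<rho>\<bar>\<^sup>2" by (rule one_le_power)
      also have "\<dots> = (x i / \<rho>)\<^sup>2" by (rule power2_abs)
      also have "\<dots> \<le> (\<Sum>i\<in>I. (x i / \<rho>)\<^sup>2)"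
        using i(1) I by (intro member_le_sum) auto
      finally have "min 1 (\<Sum>i\<in>I. (x i / \<rho>)\<^sup>2) = 1" by simp
      moreover have "\<bar>F (\<phi> x)\<bar> \<le> B" unfolding F_def by (rule B)
      ultimately show ?thesis using B[of x] by (simp add: abs_le_iff)
    qed
    then show "\<bar>f x - G (\<phi> x)\<bar> \<le> \<epsilon> + 2 * B * min 1 (\<Sum>i\<in>I. (x i / \<rho>)\<^sup>2)"
      using FG by linarith
  qed
qed

section \<open>The Gaussian vector and its covariance factor\<close>

definition gauss_map :: "'i set \<Rightarrow> ('i \<Rightarrow> 'i \<Rightarrow> real) \<Rightarrow> ('i \<Rightarrow> real) \<Rightarrow> 'i \<Rightarrow> real" where
  "gauss_map I A w = (\<lambda>i. if i \<in> I then (\<Sum>k\<in>I. A i k * w k) else 0)"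

lemma gauss_expect_eq: "gauss_expect I A f = (LINT w|std_gauss_vec I. f (gauss_map I A w))"
  by (simp add: gauss_expect_def gauss_map_def)

lemma sets_std_gauss_vec [measurable_cong]: "sets (std_gauss_vec I) = sets (PiM I (\<lambda>_. borel))"
  unfolding std_gauss_vec_def by (intro sets_PiM_cong) auto

lemma prob_space_std_gauss_vec: "prob_space (std_gauss_vec I)"
  unfolding std_gauss_vec_def
  by (intro prob_space_PiM prob_space_normal_density) simp

lemma gauss_map_coordinate_measurable [measurable]:
  "(\<lambda>w. gauss_map I A w i) \<in> borel_measurable (PiM I (\<lambda>_. borel))"
  unfolding gauss_map_def by (cases "i \<in> I") (auto intro!: borel_measurable_sum borel_measurable_times)

lemma gauss_map_measurable [measurable]:
  fixes I :: "'i::countable set"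
  assumes [simp]: "finite I"
  shows "gauss_map I A \<in> borel_measurable (std_gauss_vec I)"
proof (rule measurable_coordinatewise_then_product)
  fix i
  show "(\<lambda>w. gauss_map I A w i) \<in> borel_measurable (std_gauss_vec I)"
    by measurable
qed

lemma std_gauss_char:
  assumes I: "finite I"
  shows "(LINT w|std_gauss_vec I. iexp (\<Sum>k\<in>I. u k * w k)) = of_real (exp (- (\<Sum>k\<in>I. (u k)\<^sup>2) / 2))"
proof -
  have sf: "sigma_finite_measure std_normal_distribution"
    by (intro prob_space_imp_sigma_finite prob_space_normal_density) simp
  interpret product_sigma_finite "\<lambda>_. std_normal_distribution"
    using sf by (simp add: product_sigma_finite_def)
  interpret N: prob_space std_normal_distribution by (intro prob_space_normal_density) simp
  have "iexp (\<Sum>k\<in>I. u k * w k) = (\<Prod>k\<in>I. iexp (u k * w k))" for w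
    unfolding of_real_sum sum_distrib_left using I by (rule exp_sum)
  then have "(LINT w|std_gauss_vec I. iexp (\<Sum>k\<in>I. u k * w k)) = (LINT w|std_gauss_vec I. (\<Prod>k\<in>I. iexp (u k * w k)))"
    by (simp only:)
  also have "\<dots> = (\<Prod>k\<in>I. LINT x|std_normal_distribution. iexp (u k * x))"
    unfolding std_gauss_vec_def by (rule product_integral_prod[OF I]) (rule N.integrable_iexp, auto simp del: of_real_mult)
  also have "\<dots> = (\<Prod>k\<in>I. of_real (exp (- (u k)\<^sup>2 / 2)))"
    using char_std_normal_distribution by (simp add: char_def fun_eq_iff)
  also have "\<dots> = of_real (exp (- (\<Sum>k\<in>I. (u k)\<^sup>2) / 2))"
    using I by (simp add: exp_sum[symmetric] sum_negf sum_divide_distrib flip: of_real_prod)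
  finally show ?thesis .
qed

text \<open>Moving the matrix to the other side of the pairing gives frequencies \<open>u\<close>,
  the transpose applied to s, whose squared length is the quadratic form of
  \<open>H\<close>.\<close>

lemma gauss_map_char:
  assumes I: "finite I" and A: "\<And>i j. i \<in> I \<Longrightarrow> j \<in> I \<Longrightarrow> (\<Sum>k\<in>I. A i k * A j k) = H i j"
  shows "(LINT w|std_gauss_vec I. iexp (\<Sum>i\<in>I. s i * gauss_map I A w i))
    = of_real (exp (- (\<Sum>i\<in>I. \<Sum>j\<in>I. s i * H i j * s j) / 2))"
proof -
  define u where "u k = (\<Sum>i\<in>I. s i * A i k)" for k
  have "(\<Sum>i\<in>I. s i * gauss_map I A w i) = (\<Sum>k\<in>I. u k * w k)" for w
  proof -
    have "(\<Sum>i\<in>I. s i * gauss_map I A w i) = (\<Sum>i\<in>I. \<Sum>k\<in>I. s i * A i k * w k)"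
      by (simp add: gauss_map_def sum_distrib_left mult.assoc)
    also have "\<dots> = (\<Sum>k\<in>I. \<Sum>i\<in>I. s i * A i k * w k)" by (rule sum.swap)
    finally show ?thesis by (simp add: u_def sum_distrib_right)
  qed
  moreover have "(\<Sum>k\<in>I. (u k)\<^sup>2) = (\<Sum>i\<in>I. \<Sum>j\<in>I. s i * H i j * s j)"
  proof -
    have "(\<Sum>k\<in>I. (u k)\<^sup>2) = (\<Sum>k\<in>I. \<Sum>i\<in>I. \<Sum>j\<in>I. s i * s j * (A i k * A j k))"
      by (simp add: u_def power2_eq_square sum_product mult_ac)
    also have "\<dots> = (\<Sum>i\<in>I. \<Sum>k\<in>I. \<Sum>j\<in>I. s i * s j * (A i k * A j k))" by (rule sum.swap)
    also have "\<dots> = (\<Sum>i\<in>I. \<Sum>j\<in>I. \<Sum>k\<in>I. s i * s j * (A i k * A j k))"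
      by (intro sum.cong refl sum.swap)
    also have "\<dots> = (\<Sum>i\<in>I. \<Sum>j\<in>I. s i * H i j * s j)"
      by (intro sum.cong refl) (simp add: A sum_distrib_left[symmetric])
    finally show ?thesis .
  qed
  ultimately show ?thesis using std_gauss_char[OF I, of u] by simp
qed

text \<open>Induction removes one index and passes to the Schur complement. If the pivot is 0,
  semidefiniteness forces its whole column to vanish, so the degenerate case fits the same formulas
  with division by zero read as 0.\<close>

lemma psd_factorization:
  assumes "finite I" "\<And>i j. i \<in> I \<Longrightarrow> j \<in> I \<Longrightarrow> H i j = H j i" "psd_on I H"
  shows "\<exists>A. \<forall>i\<in>I. \<forall>j\<in>I. (\<Sum>k\<in>I. A i k * A j k) = (H i j :: real)"
  using assms
proof (induction I arbitrary: H rule: finite_induct)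
  case (insert a I)
  define L where "L v = (\<Sum>i\<in>I. v i * H i a)" for v
  define q where "q v = (\<Sum>i\<in>I. \<Sum>j\<in>I. v i * H i j * v j)" for v
  \<comment> \<open>Giving the new coordinate the value x makes the form a quadratic polynomial in x
    that is never negative.\<close>
  have expand: "0 \<le> q v + 2 * x * L v + x\<^sup>2 * H a a" for v x
  proof -
    define u where "u = v(a := x)"
    have u: "u i = v i" if "i \<in> I" for i using that insert.hyps by (auto simp: u_def)
    have 1: "(\<Sum>i\<in>I. \<Sum>j\<in>I. u i * H i j * u j) = q v" unfolding q_def by (intro sum.cong refl) (simp add: u)
    have 2: "(\<Sum>i\<in>I. u i * H i a * u a) = x * L v"
      unfolding L_def sum_distrib_left by (intro sum.cong refl) (simp add: u u_def[THEN fun_cong, of a])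
    have 3: "(\<Sum>j\<in>I. u a * H a j * u j) = x * L v"
      unfolding L_def sum_distrib_left
      by (intro sum.cong refl) (simp add: u u_def[THEN fun_cong, of a] insert.prems(1)[of a])
    have "0 \<le> (\<Sum>i\<in>insert a I. \<Sum>j\<in>insert a I. u i * H i j * u j)"
      using insert.prems(2) by (simp add: psd_on_def)
    also have "\<dots> = u a * H a a * u a + (\<Sum>j\<in>I. u a * H a j * u j) + ((\<Sum>i\<in>I. u i * H i a * u a) + (\<Sum>i\<in>I. \<Sum>j\<in>I. u i * H i j * u j))"
      using insert.hyps by (simp add: sum.distrib)
    also have "\<dots> = q v + 2 * x * L v + x\<^sup>2 * H a a"
      unfolding 1 2 3 by (simp add: u_def power2_eq_square)
    finally show ?thesis .
  qed
  have Haa: "H a a \<ge> 0" using expand[of "\<lambda>_. 0" 1] by (simp add: q_def L_def)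
  have L0: "L v = 0" if "H a a = 0" for v
  proof (rule ccontr)
    assume n: "L v \<noteq> 0"
    \<comment> \<open>With a zero pivot this choice of x would give the value -1.\<close>
    have "2 * (- (q v + 1) / (2 * L v)) * L v = - (q v + 1)" using n by simp
    then show False using expand[of v "- (q v + 1) / (2 * L v)"] that by simp
  qed
  have Hia: "H i a = 0" if "H a a = 0" "i \<in> I" for i
  proof -
    have "L (\<lambda>j. if j = i then 1 else 0) = H i a"
      using insert.hyps that(2) by (simp add: L_def if_distrib[of "\<lambda>c. c * _"] cong: if_cong)
    then show ?thesis using L0[OF that(1)] by metis
  qed
  define H' where "H' i j = H i j - H i a * H j a / H a a" for i j
  have "psd_on I H'"
    unfolding psd_on_def
  proof
    fix v
    have "(\<Sum>i\<in>I. \<Sum>j\<in>I. v i * H' i j * v j) = q v - (L v)\<^sup>2 / H a a"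
      by (simp add: q_def L_def H'_def algebra_simps sum_subtractf sum_product power2_eq_square sum_divide_distrib)
    moreover have "0 \<le> q v - (L v)\<^sup>2 / H a a"
    proof (cases "H a a = 0")
      case True
      then show ?thesis using expand[of v 0] by simp
    next
      case False
      \<comment> \<open>The minimiser in x turns nonnegativity into that of the Schur
        complement.\<close>
      then show ?thesis using expand[of v "- L v / H a a"] by (simp add: power2_eq_square field_simps)
    qed
    ultimately show "0 \<le> (\<Sum>i\<in>I. \<Sum>j\<in>I. v i * H' i j * v j)" by simp
  qed
  moreover have "H' i j = H' j i" if "i \<in> I" "j \<in> I" for i j
    using insert.prems(1)[of i j] that by (simp add: H'_def mult.commute)
  ultimately obtain A' where A': "\<forall>i\<in>I. \<forall>j\<in>I. (\<Sum>k\<in>I. A' i k * A' j k) = H' i j"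
    using insert.IH by blast
  define A where "A i k = (if i = a then (if k = a then sqrt (H a a) else 0)
    else if k = a then H i a / sqrt (H a a) else A' i k)" for i k
  have Aa: "(\<Sum>k\<in>insert a I. A i k * A j k) = A i a * A j a + (\<Sum>k\<in>I. A i k * A j k)" for i j
    using insert.hyps by simp
  have sq: "sqrt (H a a) * sqrt (H a a) = H a a" using Haa by simp
  have "(\<Sum>k\<in>insert a I. A i k * A j k) = H i j" if ij: "i \<in> insert a I" "j \<in> insert a I" for i j
  proof -
    have z: "(\<Sum>k\<in>I. A i k * A j k) = 0" if "i = a \<or> j = a"
      using that insert.hyps by (intro sum.neutral) (auto simp: A_def)
    have e: "sqrt (H a a) * (H i a / sqrt (H a a)) = H i a" if "i \<in> I" for i
      using Hia[OF _ that] by (cases "H a a = 0") auto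
    consider "i = a" "j = a" | "i = a" "j \<in> I" "j \<noteq> a" | "i \<in> I" "i \<noteq> a" "j = a" | "i \<in> I" "j \<in> I" "i \<noteq> a" "j \<noteq> a"
      using ij insert.hyps by auto
    then show ?thesis
    proof cases
      case 1
      then show ?thesis unfolding Aa using z sq by (simp add: A_def)
    next
      case 2
      then show ?thesis unfolding Aa using z e[of j] insert.prems(1)[of a j] by (simp add: A_def)
    next
      case 3
      then show ?thesis unfolding Aa using z e[of i] by (simp add: A_def mult.commute)
    next
      case 4
      have "(\<Sum>k\<in>I. A i k * A j k) = (\<Sum>k\<in>I. A' i k * A' j k)"
        using 4 insert.hyps by (intro sum.cong) (auto simp: A_def)
      moreover have "A i a * A j a = H i a * H j a / H a a"
        using 4 sq by (simp add: A_def)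
      ultimately show ?thesis unfolding Aa using A' 4 by (simp add: H'_def)
    qed
  qed
  then show ?case by blast
qed auto


section \<open>From characteristic functions to bounded continuous functions\<close>

lemma trig_poly_bounded: "trig_poly I g \<Longrightarrow> \<exists>B. \<forall>x. \<bar>g x\<bar> \<le> B"
proof (induction rule: trig_poly.induct)
  case (cos c s)
  have "\<bar>c * cos (\<Sum>i\<in>I. s i * x i)\<bar> \<le> \<bar>c\<bar>" for x
    unfolding abs_mult by (intro mult_left_le) auto
  then show ?case by blast
next
  case (sin c s)
  have "\<bar>c * sin (\<Sum>i\<in>I. s i * x i)\<bar> \<le> \<bar>c\<bar>" for x
    unfolding abs_mult by (intro mult_left_le) auto
  then show ?case by blast
next
  case (add f g)
  then obtain B B' where "\<forall>x. \<bar>f x\<bar> \<le> B" "\<forall>x. \<bar>g x\<bar> \<le> B'" by blast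
  then have "\<forall>x. \<bar>f x + g x\<bar> \<le> B + B'" by (meson abs_triangle_ineq add_mono order_trans)
  then show ?case by blast
qed

lemma trig_poly_continuous:
  fixes I :: "'i::countable set"
  assumes "trig_poly I g"
  shows "continuous_on UNIV g"
  using assms
proof (induction rule: trig_poly.induct)
  case (cos c s)
  show ?case
    by (intro continuous_on_mult continuous_on_const continuous_on_cos continuous_on_sum
        continuous_on_product_coordinates)
next
  case (sin c s)
  show ?case
    by (intro continuous_on_mult continuous_on_const continuous_on_sin continuous_on_sum
        continuous_on_product_coordinates)
qed (rule continuous_on_add)

lemma integrable_gauss_map:
  fixes I :: "'i::countable set" and f :: "('i \<Rightarrow> real) \<Rightarrow> real"
  assumes I: "finite I" and f: "continuous_on UNIV f" "\<And>x. \<bar>f x\<bar> \<le> B"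
  shows "integrable (std_gauss_vec I) (\<lambda>w. f (gauss_map I A w))"
proof -
  interpret P: prob_space "std_gauss_vec I" by (rule prob_space_std_gauss_vec)
  have "(\<lambda>w. f (gauss_map I A w)) \<in> borel_measurable (std_gauss_vec I)"
    by (rule measurable_compose[OF gauss_map_measurable[OF I] borel_measurable_continuous_onI[OF f(1)]])
  then show ?thesis by (intro P.integrable_const_bound[of _ B]) (use f in auto)
qed

text \<open>By linearity it is enough to treat cosines and sines, the real and imaginary parts of
  the characteristic functions.\<close>

lemma trig_poly_tendsto:
  fixes I :: "'i::countable set" and S :: "nat \<Rightarrow> 'a set" and X :: "nat \<Rightarrow> 'a \<Rightarrow> 'i \<Rightarrow> real"
  assumes I: "finite I" and A: "\<And>i j. i \<in> I \<Longrightarrow> j \<in> I \<Longrightarrow> (\<Sum>k\<in>I. A i k * A j k) = H i j"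
    and cf: "\<And>s. (\<lambda>m. (\<Sum>x\<in>S m. iexp (\<Sum>i\<in>I. s i * X m x i)) / of_nat (card (S m)))
      \<longlonglongrightarrow> of_real (exp (- (\<Sum>i\<in>I. \<Sum>j\<in>I. s i * H i j * s j) / 2))"
    and g: "trig_poly I g"
  shows "(\<lambda>m. unif_mean (S m) (\<lambda>x. g (X m x))) \<longlonglongrightarrow> gauss_expect I A g"
  using g
proof induction
  case (cos c s)
  define f where "f w = iexp (\<Sum>i\<in>I. s i * gauss_map I A w i)" for w
  interpret P: prob_space "std_gauss_vec I" by (rule prob_space_std_gauss_vec)
  note [measurable] = gauss_map_measurable[OF I]
  have "(\<lambda>w. \<Sum>i\<in>I. s i * gauss_map I A w i) \<in> borel_measurable (std_gauss_vec I)"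
    by measurable
  then have int: "integrable (std_gauss_vec I) f"
    unfolding f_def by (intro P.integrable_iexp) (auto simp del: of_real_sum)
  have char: "(LINT w|std_gauss_vec I. f w) = of_real (exp (- (\<Sum>i\<in>I. \<Sum>j\<in>I. s i * H i j * s j) / 2))"
    unfolding f_def by (rule gauss_map_char[OF I A])
  have "(\<lambda>m. c * Re ((\<Sum>x\<in>S m. iexp (\<Sum>i\<in>I. s i * X m x i)) / of_nat (card (S m)))) \<longlonglongrightarrow> c * Re (LINT w|std_gauss_vec I. f w)"
    unfolding char by (intro tendsto_intros cf)
  also have "Re (LINT w|std_gauss_vec I. f w) = (LINT w|std_gauss_vec I. Re (f w))"
    using int by simp
  also have "c * (LINT w|std_gauss_vec I. Re (f w)) = gauss_expect I A (\<lambda>x. c * cos (\<Sum>i\<in>I. s i * x i))"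
    unfolding gauss_expect_eq f_def by (simp add: Re_exp del: of_real_sum)
  also have "(\<lambda>m. c * Re ((\<Sum>x\<in>S m. iexp (\<Sum>i\<in>I. s i * X m x i)) / of_nat (card (S m))))
    = (\<lambda>m. unif_mean (S m) (\<lambda>x. c * cos (\<Sum>i\<in>I. s i * X m x i)))"
    by (simp add: fun_eq_iff unif_mean_def Re_exp sum_distrib_left[symmetric] del: of_real_sum)
  finally show ?case .
next
  case (sin c s)
  define f where "f w = iexp (\<Sum>i\<in>I. s i * gauss_map I A w i)" for w
  interpret P: prob_space "std_gauss_vec I" by (rule prob_space_std_gauss_vec)
  note [measurable] = gauss_map_measurable[OF I]
  have "(\<lambda>w. \<Sum>i\<in>I. s i * gauss_map I A w i) \<in> borel_measurable (std_gauss_vec I)"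
    by measurable
  then have int: "integrable (std_gauss_vec I) f"
    unfolding f_def by (intro P.integrable_iexp) (auto simp del: of_real_sum)
  have char: "(LINT w|std_gauss_vec I. f w) = of_real (exp (- (\<Sum>i\<in>I. \<Sum>j\<in>I. s i * H i j * s j) / 2))"
    unfolding f_def by (rule gauss_map_char[OF I A])
  have "(\<lambda>m. c * Im ((\<Sum>x\<in>S m. iexp (\<Sum>i\<in>I. s i * X m x i)) / of_nat (card (S m)))) \<longlonglongrightarrow> c * Im (LINT w|std_gauss_vec I. f w)"
    unfolding char by (intro tendsto_intros cf)
  also have "Im (LINT w|std_gauss_vec I. f w) = (LINT w|std_gauss_vec I. Im (f w))"
    using int by simp
  also have "c * (LINT w|std_gauss_vec I. Im (f w)) = gauss_expect I A (\<lambda>x. c * sin (\<Sum>i\<in>I. s i * x i))"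
    unfolding gauss_expect_eq f_def by (simp add: Im_exp del: of_real_sum)
  also have "(\<lambda>m. c * Im ((\<Sum>x\<in>S m. iexp (\<Sum>i\<in>I. s i * X m x i)) / of_nat (card (S m))))
    = (\<lambda>m. unif_mean (S m) (\<lambda>x. c * sin (\<Sum>i\<in>I. s i * X m x i)))"
    by (simp add: fun_eq_iff unif_mean_def Im_exp sum_distrib_left[symmetric] del: of_real_sum)
  finally show ?case .
next
  case (add f g)
  have int: "integrable (std_gauss_vec I) (\<lambda>w. h (gauss_map I A w))" if "trig_poly I h" for h
    using integrable_gauss_map[OF I trig_poly_continuous[OF that]] trig_poly_bounded[OF that] by blast
  have "(\<lambda>m. unif_mean (S m) (\<lambda>x. f (X m x)) + unif_mean (S m) (\<lambda>x. g (X m x)))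
    \<longlonglongrightarrow> gauss_expect I A f + gauss_expect I A g"
    by (intro tendsto_add add.IH)
  moreover have "gauss_expect I A f + gauss_expect I A g = gauss_expect I A (\<lambda>x. f x + g x)"
    unfolding gauss_expect_eq using add.hyps int by (intro Bochner_Integration.integral_add[symmetric]) auto
  ultimately show ?case by (simp add: unif_mean_def sum.distrib add_divide_distrib)
qed

text \<open>Compare f with a trigonometric polynomial on both sides. The error off the cube is small
  on the Gaussian side by dominated convergence and on the discrete side by the second moments. Each
  of the three differences is below e / 4.\<close>

theorem conv_gauss_expect:
  fixes I :: "'i::countable set" and S :: "nat \<Rightarrow> 'a set" and X :: "nat \<Rightarrow> 'a \<Rightarrow> 'i \<Rightarrow> real"
  assumes I: "finite I" and A: "\<And>i j. i \<in> I \<Longrightarrow> j \<in> I \<Longrightarrow> (\<Sum>k\<in>I. A i k * A j k) = H i j"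
    and cf: "\<And>s. (\<lambda>m. (\<Sum>x\<in>S m. iexp (\<Sum>i\<in>I. s i * X m x i)) / of_nat (card (S m)))
      \<longlonglongrightarrow> of_real (exp (- (\<Sum>i\<in>I. \<Sum>j\<in>I. s i * H i j * s j) / 2))"
    and X0: "\<And>m x i. i \<notin> I \<Longrightarrow> X m x i = 0"
    and mom: "\<And>i. i \<in> I \<Longrightarrow> \<exists>B. eventually (\<lambda>m. unif_mean (S m) (\<lambda>x. (X m x i)\<^sup>2) \<le> B) sequentially"
    and f: "continuous_on UNIV f" "bounded (range f)"
  shows "(\<lambda>m. unif_mean (S m) (\<lambda>x. f (X m x))) \<longlonglongrightarrow> gauss_expect I A f"
proof (rule LIMSEQ_I)
  fix e :: real assume e: "e > 0"
  obtain B where B: "\<And>x. \<bar>f x\<bar> \<le> B" using f(2) by (auto simp: bounded_iff)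
  have B0: "B \<ge> 0" using B[of undefined] by linarith
  interpret P: prob_space "std_gauss_vec I" by (rule prob_space_std_gauss_vec)
  note [measurable] = gauss_map_measurable[OF I]
  have "\<forall>i\<in>I. \<exists>B. eventually (\<lambda>m. unif_mean (S m) (\<lambda>x. (X m x i)\<^sup>2) \<le> B) sequentially"
    using mom by blast
  from bchoice[OF this] obtain Bf where
    Bf: "\<forall>i\<in>I. eventually (\<lambda>m. unif_mean (S m) (\<lambda>x. (X m x i)\<^sup>2) \<le> Bf i) sequentially"
    by auto
  define B2 where "B2 = (\<Sum>i\<in>I. Bf i)"
  have ev2: "eventually (\<lambda>m. (\<Sum>i\<in>I. unif_mean (S m) (\<lambda>x. (X m x i)\<^sup>2)) \<le> B2) sequentially"
  proof -
    have "eventually (\<lambda>m. \<forall>i\<in>I. unif_mean (S m) (\<lambda>x. (X m x i)\<^sup>2) \<le> Bf i) sequentially"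
      using I Bf by (simp add: eventually_ball_finite)
    then show ?thesis unfolding B2_def by eventually_elim (auto intro: sum_mono)
  qed
  \<comment> \<open>The error off a cube of scale N. Its truncation keeps it integrable without
    Gaussian moments.\<close>
  define h where "h N x = 2 * B * min 1 (\<Sum>i\<in>I. (x i / real N)\<^sup>2)" for N :: nat and x :: "'i \<Rightarrow> real"
  have h: "0 \<le> h N x" "h N x \<le> 2 * B" for N x
    using B0 by (auto simp: h_def sum_nonneg intro!: mult_left_le)
  have hm [measurable]: "(\<lambda>w. h N (gauss_map I A w)) \<in> borel_measurable (std_gauss_vec I)" for N
    unfolding h_def by measurable
  have hint: "integrable (std_gauss_vec I) (\<lambda>w. h N (gauss_map I A w))" for N
    using h by (intro P.integrable_const_bound[of _ "2 * B"]) auto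
  have "(\<lambda>N. LINT w|std_gauss_vec I. h N (gauss_map I A w)) \<longlonglongrightarrow> (LINT w|std_gauss_vec I. 0)"
  proof (rule integral_dominated_convergence[of _ _ _ "\<lambda>_. 2 * B"])
    show "AE w in std_gauss_vec I. (\<lambda>N. h N (gauss_map I A w)) \<longlonglongrightarrow> 0"
    proof (intro always_eventually allI)
      fix w
      have "(\<lambda>N. 2 * B * min 1 (\<Sum>i\<in>I. (gauss_map I A w i / real N)\<^sup>2)) \<longlonglongrightarrow> 2 * B * min 1 (\<Sum>i\<in>I. 0\<^sup>2)"
        by (intro tendsto_intros lim_const_over_n)
      then show "(\<lambda>N. h N (gauss_map I A w)) \<longlonglongrightarrow> 0" by (simp add: h_def)
    qed
  qed (use h in auto)
  then have "eventually (\<lambda>N. (LINT w|std_gauss_vec I. h N (gauss_map I A w)) < e / 8) sequentially"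
    using e by (intro order_tendstoD(2)) auto
  moreover have "(\<lambda>N. 2 * B * B2 * (1 / real N)\<^sup>2) \<longlonglongrightarrow> 2 * B * B2 * 0\<^sup>2"
    by (intro tendsto_intros lim_const_over_n)
  then have "eventually (\<lambda>N. 2 * B * B2 * (1 / real N)\<^sup>2 < e / 8) sequentially"
    using e by (intro order_tendstoD(2)) auto
  moreover have "eventually (\<lambda>N::nat. N > 0) sequentially" by (rule eventually_gt_at_top)
  ultimately have "eventually (\<lambda>N. (LINT w|std_gauss_vec I. h N (gauss_map I A w)) < e / 8
    \<and> 2 * B * B2 * (1 / real N)\<^sup>2 < e / 8 \<and> N > 0) sequentially"
    by (intro eventually_conj)
  then obtain N where N: "(LINT w|std_gauss_vec I. h N (gauss_map I A w)) < e / 8"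
    "2 * B * B2 * (1 / real N)\<^sup>2 < e / 8" "N > 0"
    by (auto simp: eventually_sequentially)
  obtain g where g: "trig_poly I g" and fg: "\<And>x. \<forall>i. i \<notin> I \<longrightarrow> x i = 0 \<Longrightarrow> \<bar>f x - g x\<bar> \<le> e / 8 + h N x"
    using trig_poly_approx[OF I f(1) B, of "real N" "e / 8"] N(3) e unfolding h_def by auto
  have gauss: "\<bar>gauss_expect I A f - gauss_expect I A g\<bar> < e / 4"
  proof -
    obtain B' where B': "\<And>x. \<bar>g x\<bar> \<le> B'" using trig_poly_bounded[OF g] by blast
    have fi: "integrable (std_gauss_vec I) (\<lambda>w. f (gauss_map I A w))"
      by (rule integrable_gauss_map[OF I f(1) B])
    have gi: "integrable (std_gauss_vec I) (\<lambda>w. g (gauss_map I A w))"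
      by (rule integrable_gauss_map[OF I trig_poly_continuous[OF g] B'])
    have "gauss_expect I A f - gauss_expect I A g = (LINT w|std_gauss_vec I. f (gauss_map I A w) - g (gauss_map I A w))"
      unfolding gauss_expect_eq by (rule Bochner_Integration.integral_diff[OF fi gi, symmetric])
    also have "\<bar>\<dots>\<bar> \<le> (LINT w|std_gauss_vec I. \<bar>f (gauss_map I A w) - g (gauss_map I A w)\<bar>)"
      by (rule integral_abs_bound)
    also have "\<dots> \<le> (LINT w|std_gauss_vec I. e / 8 + h N (gauss_map I A w))"
    proof (rule integral_mono)
      show "\<bar>f (gauss_map I A w) - g (gauss_map I A w)\<bar> \<le> e / 8 + h N (gauss_map I A w)" for w
        by (rule fg) (simp add: gauss_map_def)
    qed (intro integrable_abs Bochner_Integration.integrable_diff Bochner_Integration.integrable_add fi gi hint P.integrable_const)+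
    also have "\<dots> = e / 8 + (LINT w|std_gauss_vec I. h N (gauss_map I A w))"
      using hint by (simp add: P.prob_space)
    finally show ?thesis using N(1) by simp
  qed
  have "eventually (\<lambda>m. \<bar>unif_mean (S m) (\<lambda>x. f (X m x)) - unif_mean (S m) (\<lambda>x. g (X m x))\<bar> < e / 4) sequentially"
    using ev2
  proof eventually_elim
    case (elim m)
    have "\<bar>unif_mean (S m) (\<lambda>x. f (X m x)) - unif_mean (S m) (\<lambda>x. g (X m x))\<bar>
      = \<bar>\<Sum>x\<in>S m. f (X m x) - g (X m x)\<bar> / real (card (S m))"
      by (simp add: unif_mean_def sum_subtractf diff_divide_distrib abs_divide flip: diff_divide_distrib)
    also have "\<dots> \<le> (\<Sum>x\<in>S m. e / 8 + 2 * B * (\<Sum>i\<in>I. (X m x i / real N)\<^sup>2)) / real (card (S m))"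
    proof (intro divide_right_mono order_trans[OF sum_abs] sum_mono)
      fix x
      have "\<bar>f (X m x) - g (X m x)\<bar> \<le> e / 8 + h N (X m x)" by (rule fg) (simp add: X0)
      \<comment> \<open>On the discrete side the truncation is dropped, which makes the second
        moments appear.\<close>
      also have "h N (X m x) \<le> 2 * B * (\<Sum>i\<in>I. (X m x i / real N)\<^sup>2)"
        unfolding h_def using B0 by (intro mult_left_mono) auto
      finally show "\<bar>f (X m x) - g (X m x)\<bar> \<le> e / 8 + 2 * B * (\<Sum>i\<in>I. (X m x i / real N)\<^sup>2)" by simp
    qed simp
    also have "\<dots> = real (card (S m)) * (e / 8) / real (card (S m)) + (\<Sum>x\<in>S m. \<Sum>i\<in>I. 2 * B * (1 / real N)\<^sup>2 * (X m x i)\<^sup>2) / real (card (S m))"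
      by (simp add: sum.distrib add_divide_distrib sum_distrib_left power_divide)
    also have "(\<Sum>x\<in>S m. \<Sum>i\<in>I. 2 * B * (1 / real N)\<^sup>2 * (X m x i)\<^sup>2) / real (card (S m))
      = 2 * B * (1 / real N)\<^sup>2 * (\<Sum>i\<in>I. unif_mean (S m) (\<lambda>x. (X m x i)\<^sup>2))"
      unfolding unif_mean_def sum_divide_distrib[symmetric] sum_distrib_left[symmetric]
      by (subst sum.swap) simp
    also have "\<dots> \<le> 2 * B * (1 / real N)\<^sup>2 * B2"
      using elim B0 by (intro mult_left_mono) auto
    also have "real (card (S m)) * (e / 8) / real (card (S m)) \<le> e / 8"
      using e by (cases "card (S m) = 0") auto
    finally show ?case using N(2) by (simp add: mult_ac)
  qed
  moreover have "eventually (\<lambda>m. \<bar>unif_mean (S m) (\<lambda>x. g (X m x)) - gauss_expect I A g\<bar> < e / 4) sequentially"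
  proof -
    have "(\<lambda>m. unif_mean (S m) (\<lambda>x. g (X m x))) \<longlonglongrightarrow> gauss_expect I A g"
      by (rule trig_poly_tendsto[OF I A cf g])
    from tendstoD[OF this, of "e / 4"] e show ?thesis by (simp add: dist_real_def)
  qed
  ultimately have "eventually (\<lambda>m. norm (unif_mean (S m) (\<lambda>x. f (X m x)) - gauss_expect I A f) < e) sequentially"
  proof eventually_elim
    case (elim m)
    then show ?case using gauss e unfolding real_norm_def by linarith
  qed
  then show "\<exists>M. \<forall>m\<ge>M. norm (unif_mean (S m) (\<lambda>x. f (X m x)) - gauss_expect I A f) < e"
    by (simp add: eventually_sequentially)
qed

section \<open>Mean, variance and joint limit\<close>

lemma Hmat_sym: "Hmat \<alpha> i j = Hmat \<alpha> j i"
  by (cases "i = j") (simp_all add: Hmat_def add.commute mult.commute)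

text \<open>The number exp (- R / 2) is a limit of averages of numbers of modulus 1, hence at most
  1, which forces R to be nonnegative.\<close>

lemma psd_Hmat:
  assumes \<alpha>: "\<alpha> > 0"
  shows "psd_on {2..q} (Hmat \<alpha>)"
  unfolding psd_on_def
proof
  fix v :: "nat \<Rightarrow> real"
  define R where "R = (\<Sum>i=2..q. \<Sum>j=2..q. v i * Hmat \<alpha> i j * v j)"
  have "norm (complex_of_real (exp (- R / 2))) \<le> 1"
  proof (rule LIMSEQ_le_const2)
    show "(\<lambda>m. norm ((\<Sum>E\<in>random_graphs \<alpha> m. iexp (\<Sum>j=2..q. v j * normalized_count \<alpha> m E j)) / of_nat (card (random_graphs \<alpha> m))))
      \<longlonglongrightarrow> norm (complex_of_real (exp (- R / 2)))"
      unfolding R_def by (intro tendsto_norm random_graphs_char_tendsto \<alpha>)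
    have "norm ((\<Sum>E\<in>random_graphs \<alpha> m. iexp (\<Sum>j=2..q. v j * normalized_count \<alpha> m E j)) / of_nat (card (random_graphs \<alpha> m))) \<le> 1" for m
    proof -
      have "norm (\<Sum>E\<in>random_graphs \<alpha> m. iexp (\<Sum>j=2..q. v j * normalized_count \<alpha> m E j)) \<le> (\<Sum>E\<in>random_graphs \<alpha> m. 1)"
        by (rule sum_norm_le) (simp del: of_real_sum)
      then show ?thesis by (simp add: norm_divide divide_le_eq)
    qed
    then show "\<exists>N. \<forall>m\<ge>N. norm ((\<Sum>E\<in>random_graphs \<alpha> m. iexp (\<Sum>j=2..q. v j * normalized_count \<alpha> m E j)) / of_nat (card (random_graphs \<alpha> m))) \<le> 1"
      by blast
  qed
  then show "0 \<le> (\<Sum>i=2..q. \<Sum>j=2..q. v i * Hmat \<alpha> i j * v j)"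
    unfolding R_def[symmetric] by simp
qed

section \<open>Mean and variance from second moments\<close>

lemma unif_mean_add: "unif_mean S (\<lambda>x. f x + g x) = unif_mean S f + unif_mean S g"
  by (simp add: unif_mean_def sum.distrib add_divide_distrib)

lemma unif_mean_mult_left: "unif_mean S (\<lambda>x. a * f x) = a * unif_mean S f"
  by (simp add: unif_mean_def sum_distrib_left)

lemma unif_mean_const: "finite S \<Longrightarrow> S \<noteq> {} \<Longrightarrow> unif_mean S (\<lambda>x. a) = a"
  by (simp add: unif_mean_def)

lemma unif_var_eq:
  assumes "finite S" "S \<noteq> {}"
  shows "unif_var S f = unif_mean S (\<lambda>x. (f x)\<^sup>2) - (unif_mean S f)\<^sup>2"
proof -
  let ?\<mu> = "unif_mean S f"
  have "(\<lambda>x. (f x - ?\<mu>)\<^sup>2) = (\<lambda>x. (f x)\<^sup>2 + ((- 2 * ?\<mu>) * f x + ?\<mu>\<^sup>2))"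
    by (simp add: fun_eq_iff power2_eq_square algebra_simps)
  then show ?thesis
    unfolding unif_var_def
    by (simp only: unif_mean_add unif_mean_mult_left unif_mean_const[OF assms]) (simp add: power2_eq_square)
qed

lemma unif_var_affine:
  assumes "finite S" "S \<noteq> {}"
  shows "unif_var S (\<lambda>x. a * f x + b) = a\<^sup>2 * unif_var S f"
proof -
  have "unif_mean S (\<lambda>x. a * f x + b) = a * unif_mean S f + b"
    by (simp add: unif_mean_add unif_mean_mult_left unif_mean_const[OF assms])
  then have "(\<lambda>x. (a * f x + b - unif_mean S (\<lambda>x. a * f x + b))\<^sup>2) = (\<lambda>x. a\<^sup>2 * (f x - unif_mean S f)\<^sup>2)"
    by (simp add: fun_eq_iff power2_eq_square algebra_simps)
  then show ?thesis by (simp add: unif_var_def unif_mean_mult_left)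
qed

lemma unif_var_nonneg: "unif_var S f \<ge> 0"
  unfolding unif_var_def by (simp add: unif_mean_def sum_nonneg)

text \<open>The second moment of the normalised variable is its variance plus its squared mean, so B
  bounds both. Undoing the normalisation multiplies the variance by m and shifts the mean by at most
  sqrt (B * m), negligible against c * m.\<close>

lemma unif_mean_var_asymptotics:
  fixes S :: "nat \<Rightarrow> 'a set" and f :: "nat \<Rightarrow> 'a \<Rightarrow> real"
  assumes c: "c > 0" and fin: "\<And>m. finite (S m)"
    and mom: "\<exists>B M. \<forall>m\<ge>M. S m \<noteq> {} \<and> unif_mean (S m) (\<lambda>x. ((f m x - c * real m) / sqrt (real m))\<^sup>2) \<le> B"
  shows "(\<lambda>m. unif_mean (S m) (f m)) \<sim>[at_top] (\<lambda>m. c * real m)"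
    and "(\<lambda>m. unif_var (S m) (f m)) \<in> O(\<lambda>m. real m)"
proof -
  obtain B M where M: "\<forall>m\<ge>M. S m \<noteq> {} \<and> unif_mean (S m) (\<lambda>x. ((f m x - c * real m) / sqrt (real m))\<^sup>2) \<le> B"
    using mom by blast
  define g where "g m x = (f m x - c * real m) / sqrt (real m)" for m x
  have f: "f m = (\<lambda>x. sqrt (real m) * g m x + c * real m)" if "m > 0" for m
    using that by (simp add: g_def fun_eq_iff)
  have g2: "unif_var (S m) (g m) \<le> B" "(unif_mean (S m) (g m))\<^sup>2 \<le> B" if m: "m \<ge> M" for m
  proof -
    have "S m \<noteq> {}" using M m by blast
    then have "unif_var (S m) (g m) + (unif_mean (S m) (g m))\<^sup>2 \<le> B"
      using unif_var_eq[OF fin, of m "g m"] M[rule_format, OF m] by (simp add: g_def)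
    then show "unif_var (S m) (g m) \<le> B" "(unif_mean (S m) (g m))\<^sup>2 \<le> B"
      using unif_var_nonneg[of "S m" "g m"] zero_le_power2[of "unif_mean (S m) (g m)"] by linarith+
  qed
  have "(\<lambda>m. unif_mean (S m) (f m) / (c * real m)) \<longlonglongrightarrow> 1"
  proof -
    have "(\<lambda>m. unif_mean (S m) (f m) / (c * real m) - 1) \<longlonglongrightarrow> 0"
    proof (rule Lim_null_comparison)
      show "(\<lambda>m. (sqrt B / c) / sqrt (real m)) \<longlonglongrightarrow> 0" by (rule divide_sqrt_tendsto_0)
      show "eventually (\<lambda>m. norm (unif_mean (S m) (f m) / (c * real m) - 1) \<le> (sqrt B / c) / sqrt (real m)) sequentially"
        using eventually_gt_at_top[of 0] eventually_ge_at_top[of M]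
      proof eventually_elim
        case (elim m)
        have ne: "S m \<noteq> {}" using M elim by blast
        have "unif_mean (S m) (f m) = sqrt (real m) * unif_mean (S m) (g m) + c * real m"
          unfolding f[OF elim(1)] unif_mean_add unif_mean_mult_left unif_mean_const[OF fin ne] ..
        then have "unif_mean (S m) (f m) / (c * real m) - 1 = unif_mean (S m) (g m) * (sqrt (real m) / real m) / c"
          using c elim(1) by (simp add: field_simps)
        also have "sqrt (real m) / real m = 1 / sqrt (real m)"
          using elim(1) by (simp add: sqrt_divide_self_eq inverse_eq_divide)
        finally have "norm (unif_mean (S m) (f m) / (c * real m) - 1) = \<bar>unif_mean (S m) (g m)\<bar> / c / sqrt (real m)"
          using c by (simp add: abs_mult abs_divide)
        also have "\<bar>unif_mean (S m) (g m)\<bar> \<le> sqrt B"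
          using g2(2)[OF elim(2)] by (metis real_sqrt_abs real_sqrt_le_iff)
        finally show ?case using c by (simp add: divide_right_mono)
      qed
    qed
    then show ?thesis by (rule LIM_zero_cancel)
  qed
  then show "(\<lambda>m. unif_mean (S m) (f m)) \<sim>[at_top] (\<lambda>m. c * real m)"
    by (rule asymp_equivI')
  show "(\<lambda>m. unif_var (S m) (f m)) \<in> O(\<lambda>m. real m)"
  proof (rule bigoI[of _ B])
    show "eventually (\<lambda>m. norm (unif_var (S m) (f m)) \<le> B * norm (real m)) sequentially"
      using eventually_gt_at_top[of 0] eventually_ge_at_top[of M]
    proof eventually_elim
      case (elim m)
      have ne: "S m \<noteq> {}" using M elim by blast
      have "unif_var (S m) (f m) = real m * unif_var (S m) (g m)"
        unfolding f[OF elim(1)] unif_var_affine[OF fin ne] by simp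
      then show ?case using g2(1)[OF elim(2)] unif_var_nonneg[of "S m" "f m"]
        by (simp add: mult.commute[of B] mult_left_mono)
    qed
  qed
qed

theorem theorem1:
  fixes \<alpha> :: real
  assumes "\<alpha> > 0"
  shows
    "(\<forall>j\<ge>2.
        (\<lambda>m. unif_mean (graphs12 (2*m) (n2_of \<alpha> (2*m)))
                 (\<lambda>E. real (U (2*m + n2_of \<alpha> (2*m)) j E)))
          \<sim>[at_top] (\<lambda>m. cU \<alpha> j * (real (2*m) / 2))
      \<and> (\<lambda>m. unif_var (graphs12 (2*m) (n2_of \<alpha> (2*m)))
                 (\<lambda>E. real (U (2*m + n2_of \<alpha> (2*m)) j E)))
          \<in> O(\<lambda>m. real (2*m) / 2))
   \<and> (\<forall>q\<ge>2::nat.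
        psd_on {2..q} (Hmat \<alpha>) \<and>
        conv_distr_gauss
          (\<lambda>m. graphs12 (2*m) (n2_of \<alpha> (2*m)))
          (\<lambda>m E i. if i \<in> {2..q} then
              (real (U (2*m + n2_of \<alpha> (2*m)) i E) - cU \<alpha> i * (real (2*m) / 2))
                / sqrt (real (2*m) / 2)
             else 0)
          {2..q} (Hmat \<alpha>))"
proof -
  have half: "real (2 * m) / 2 = real m" for m by simp
  have mean_var: "(\<lambda>m. unif_mean (random_graphs \<alpha> m) (\<lambda>E. real (U (2*m + n2_of \<alpha> (2*m)) j E)))
        \<sim>[at_top] (\<lambda>m. cU \<alpha> j * real m)
      \<and> (\<lambda>m. unif_var (random_graphs \<alpha> m) (\<lambda>E. real (U (2*m + n2_of \<alpha> (2*m)) j E))) \<in> O(\<lambda>m. real m)"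
    if j: "j \<ge> 2" for j
  proof -
    have c: "cU \<alpha> j > 0" using assms by (simp add: cU_def)
    have "\<exists>B M. \<forall>m\<ge>M. random_graphs \<alpha> m \<noteq> {} \<and> unif_mean (random_graphs \<alpha> m)
      (\<lambda>E. ((real (U (2*m + n2_of \<alpha> (2*m)) j E) - cU \<alpha> j * real m) / sqrt (real m))\<^sup>2) \<le> B"
      using random_graphs_second_moment[OF assms j] unfolding normalized_count_def .
    from unif_mean_var_asymptotics[OF c finite_random_graphs this] show ?thesis by blast
  qed
  have conv: "conv_distr_gauss (random_graphs \<alpha>)
      (\<lambda>m E i. if i \<in> {2..q} then normalized_count \<alpha> m E i else 0) {2..q} (Hmat \<alpha>)" for q :: nat
  proof -
    obtain A where A: "\<forall>i\<in>{2..q}. \<forall>j\<in>{2..q}. (\<Sum>k\<in>{2..q}. A i k * A j k) = Hmat \<alpha> i j"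
      using psd_factorization[OF finite_atLeastAtMost Hmat_sym psd_Hmat[OF assms]] by blast
    show ?thesis
      unfolding conv_distr_gauss_def
    proof (intro exI[of _ A] conjI A allI impI)
      fix f :: "(nat \<Rightarrow> real) \<Rightarrow> real"
      assume f: "continuous_on UNIV f \<and> bounded (range f)"
      show "(\<lambda>m. unif_mean (random_graphs \<alpha> m) (\<lambda>E. f (\<lambda>i. if i \<in> {2..q} then normalized_count \<alpha> m E i else 0)))
        \<longlonglongrightarrow> gauss_expect {2..q} A f"
      proof (rule conv_gauss_expect)
        show "(\<Sum>k\<in>{2..q}. A i k * A j k) = Hmat \<alpha> i j" if "i \<in> {2..q}" "j \<in> {2..q}" for i j
          using A that by blast
        show "(\<lambda>m. (\<Sum>E\<in>random_graphs \<alpha> m. iexp (\<Sum>i=2..q. s i * (if i \<in> {2..q} then normalized_count \<alpha> m E i else 0))) / of_nat (card (random_graphs \<alpha> m)))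
          \<longlonglongrightarrow> of_real (exp (- (\<Sum>i=2..q. \<Sum>j=2..q. s i * Hmat \<alpha> i j * s j) / 2))" for s
        proof -
          have "(\<Sum>i=2..q. s i * (if i \<in> {2..q} then normalized_count \<alpha> m E i else 0)) = (\<Sum>i=2..q. s i * normalized_count \<alpha> m E i)" for m E
            by (intro sum.cong) auto
          then show ?thesis using random_graphs_char_tendsto[OF assms, of s q] by (simp only:)
        qed
        fix i assume i: "i \<in> {2..q}"
        then obtain B M where "\<forall>m\<ge>M. random_graphs \<alpha> m \<noteq> {} \<and> unif_mean (random_graphs \<alpha> m) (\<lambda>E. (normalized_count \<alpha> m E i)\<^sup>2) \<le> B"
          using random_graphs_second_moment[OF assms, of i] by auto
        then show "\<exists>B. eventually (\<lambda>m. unif_mean (random_graphs \<alpha> m) (\<lambda>E. (if i \<in> {2..q} then normalized_count \<alpha> m E i else 0)\<^sup>2) \<le> B) sequentially"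
          using i unfolding eventually_sequentially by auto
      qed (use f in auto)
    qed
  qed
  show ?thesis
    unfolding half
    using mean_var conv psd_Hmat[OF assms]
    unfolding random_graphs_def[abs_def] normalized_count_def by blast
qed

end
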